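(* Let $C_{\bullet,\bullet}(\mathcal C,\mathcal D)$ be the matched complex of a matched pair $(\mathcal C,\mathcal D)$. Then there are homology spectral sequences $\{E^{hv,r}_{p,q},d^{hv,r}_{p,q}\}$ and $\{E^{vh,r}_{p,q},d^{vh,r}_{p,q}\}$ with first pages $E^{hv,1}_{p,q}=H^v_{p,q}(\mathcal C,\mathcal D)$ and $E^{vh,1}_{p,q}=H^h_{p,q}(\mathcal C,\mathcal D)$, with $d^{hv,1}=\widetilde d^h$ and $d^{vh,1}=\widetilde d^v$, and with second pages $$E^{hv,2}_{p,q}=H^h_pH^v_q(\mathcal C,\mathcal D)\qquad\text{and}\qquad E^{vh,2}_{p,q}=H^v_qH^h_p(\mathcal C,\mathcal D),$$ that both converge to the categorical homology $H_{p+q}(\mathcal C\bowtie\mathcal D)$ of $\mathcal C\bowtie\mathcal D$.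
   Context: A small category $\mathcal C$ is identified with its set of morphisms; $\mathcal C^0$ its identities (objects), $r,s$ codomain and domain, $\mathcal C^n$ the composable $n$-tuples; $\mathcal C^p*\mathcal D^q$ the composable tuples with first $p$ entries in $\mathcal C$ and last $q$ in $\mathcal D$ (when $\mathcal C^0=\mathcal D^0$; $\mathcal C^0*\mathcal D^q=\mathcal D^q$, $\mathcal C^p*\mathcal D^0=\mathcal C^p$). A matched pair $(\mathcal C,\mathcal D)$: small categories with $\mathcal C^0=\mathcal D^0$, a left action $\triangleright\colon\mathcal C*\mathcal D\to\mathcal D$ ($r(d)\triangleright d=d$, $r(c\triangleright d)=r(c)$, $(c_1c_2)\triangleright d=c_1\triangleright(c_2\triangleright d)$, $c\triangleright s(c)=r(c)$) and a right action $\triangleleft\colon\mathcal C*\mathcal D\to\mathcal C$ ($c\triangleleft s(c)=c$, $s(c\triangleleft d)=s(d)$, $c\triangleleft(d_1d_2)=(c\triangleleft d_1)\triangleleft d_2$, $r(d)\triangleleft d=s(d)$) with $s(c\triangleright d)=r(c\triangleleft d)$, $c\triangleright(d_1d_2)=(c\triangleright d_1)((c\triangleleft d_1)\triangleright d_2)$, $(c_1c_2)\triangleleft d=(c_1\triangleleft(c_2\triangleright d))(c_2\triangleleft d)$. $\mathcal C\bowtie\mathcal D$ is the category with morphisms $dc:=(d,c)$, $s(d)=r(c)$, $r(dc)=r(d)$, $s(dc)=s(c)$, and composition $(d_1c_1)(d_2c_2)=(d_1(c_1\triangleright d_2))((c_1\triangleleft d_2)c_2)$. The categorical homology $H_\bullet(\mathcal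 E)$ of a small category $\mathcal E$ is the homology of $C_k(\mathcal E)=\mathbb Z\mathcal E^k$ with $d_k[e_0,\dots,e_k]=[e_1,\dots,e_k]+\sum_{i=1}^k(-1)^i[e_0,\dots,e_{i-1}e_i,\dots,e_k]+(-1)^{k+1}[e_0,\dots,e_{k-1}]$ for $k\ge1$, $d_0[e]=[s(e)]-[r(e)]$. Actions on tuples: $c\triangleright(d_1,\dots,d_q)=(c\triangleright d_1,(c\triangleleft d_1)\triangleright d_2,\dots,(c\triangleleft(d_1\cdots d_{q-1}))\triangleright d_q)$; $(c_1,\dots,c_p)\triangleleft d=(c_1\triangleleft((c_2\cdots c_p)\triangleright d),\dots,c_{p-1}\triangleleft(c_p\triangleright d),c_p\triangleleft d)$. Matched complex: $C_{p,q}=\mathbb Z(\mathcal C^p*\mathcal D^q)$. $d^h_{p,q}\colon C_{p+1,q}\to C_{p,q}$ sends $[c_0,\dots,c_p;d]$ to $[c_1,\dots,c_p;d]+\sum_{i=1}^p(-1)^i[c_0,\dots,c_{i-1}c_i,\dots,c_p;d]+(-1)^{p+1}[c_0,\dots,c_{p-1};c_p\triangleright d]$ (for $q=0$ it is the boundary $d_p$ of $C_\bullet(\mathcal C)$). $d^v_{p,q}\colon C_{p,q+1}\to C_{p,q}$ sends $[c;d_0,\dots,d_q]$ to $(-1)^p$ times $[c\triangleleft d_0;d_1,\dots,d_q]+\sum_{j=1}^q(-1)^j[c;d_0,\dots,d_{j-1}d_j,\dots,d_q]+(-1)^{q+1}[c;d_0,\dots,d_{q-1}]$ (for $p=0$ it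 is the boundary $d_q$ of $C_\bullet(\mathcal D)$). One has $d^vd^h=-d^hd^v$. $H^v_{p,q}=H_q(C_{p,\bullet},d^v_{p,\bullet})$ and $H^h_{p,q}=H_p(C_{\bullet,q},d^h_{\bullet,q})$; $\widetilde d^h\colon H^v_{p+1,q}\to H^v_{p,q}$ and $\widetilde d^v\colon H^h_{p,q+1}\to H^h_{p,q}$ are induced by $d^h,d^v$; $H^h_pH^v_q=H_p(H^v_{\bullet,q},\widetilde d^h)$ and $H^v_qH^h_p=H_q(H^h_{p,\bullet},\widetilde d^v)$. In the $vh$ spectral sequence the index $p$ is still the horizontal and $q$ the vertical degree. *)

theory Defs
  imports "HOL-Algebra.Free_Abelian_Groups"
begin

section \<open>Small categories\<close>

text \<open>
  A small category is identified with its set of morphisms; the objects are the identity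
  morphisms, and \<open>rng\<close> (codomain) and \<open>src\<close> (domain) take values in them. The composite
  \<open>cmp E a b\<close> is meaningful when \<open>src E a = rng E b\<close>.
\<close>

record 'a cat =
  mor :: "'a set"
  rng :: "'a \<Rightarrow> 'a"
  src :: "'a \<Rightarrow> 'a"
  cmp :: "'a \<Rightarrow> 'a \<Rightarrow> 'a"

definition objs :: "'a cat \<Rightarrow> 'a set" where
  "objs E = {u \<in> mor E. rng E u = u \<and> src E u = u}"

locale small_category =
  fixes E :: "'a cat"
  assumes rng_objs: "a \<in> mor E \<Longrightarrow> rng E a \<in> objs E"
    and src_objs: "a \<in> mor E \<Longrightarrow> src E a \<in> objs E"
    and cmp_mor: "\<lbrakk>a \<in> mor E; b \<in> mor E; src E a = rng E b\<rbrakk> \<Longrightarrow> cmp E a b \<in> mor E"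
    and rng_cmp: "\<lbrakk>a \<in> mor E; b \<in> mor E; src E a = rng E b\<rbrakk> \<Longrightarrow> rng E (cmp E a b) = rng E a"
    and src_cmp: "\<lbrakk>a \<in> mor E; b \<in> mor E; src E a = rng E b\<rbrakk> \<Longrightarrow> src E (cmp E a b) = src E b"
    and cmp_rng: "a \<in> mor E \<Longrightarrow> cmp E (rng E a) a = a"
    and cmp_src: "a \<in> mor E \<Longrightarrow> cmp E a (src E a) = a"
    and cmp_assoc: "\<lbrakk>a \<in> mor E; b \<in> mor E; c \<in> mor E; src E a = rng E b; src E b = rng E c\<rbrakk>
        \<Longrightarrow> cmp E (cmp E a b) c = cmp E a (cmp E b c)"

text \<open>\<open>path E u es v\<close>: \<open>es\<close> is a composable tuple with range \<open>u\<close> and source \<open>v\<close>.\<close>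

fun path :: "'a cat \<Rightarrow> 'a \<Rightarrow> 'a list \<Rightarrow> 'a \<Rightarrow> bool" where
  "path E u [] v \<longleftrightarrow> u \<in> objs E \<and> v = u"
| "path E u (e # es) v \<longleftrightarrow> e \<in> mor E \<and> rng E e = u \<and> path E (src E e) es v"

text \<open>\<open>contract E i [e\<^sub>0,\<dots>,e\<^sub>k] = [e\<^sub>0,\<dots>,e\<^sub>i\<^sub>-\<^sub>1e\<^sub>i,\<dots>,e\<^sub>k]\<close> for \<open>1 \<le> i \<le> k\<close>.\<close>

definition contract :: "'a cat \<Rightarrow> nat \<Rightarrow> 'a list \<Rightarrow> 'a list" where
  "contract E i es = take (i - 1) es @ cmp E (es ! (i - 1)) (es ! i) # drop (Suc i) es"


section \<open>Matched pairs and their product category\<close>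

locale matched_pair = C: small_category C + D: small_category D
  for C D :: "'a cat" +
  fixes lact :: "'a \<Rightarrow> 'a \<Rightarrow> 'a" (infixr \<open>\<rhd>\<close> 70)
    and ract :: "'a \<Rightarrow> 'a \<Rightarrow> 'a" (infixl \<open>\<lhd>\<^sub>r\<close> 70)
  assumes same_objs: "objs C = objs D"
    and lact_mor: "\<lbrakk>c \<in> mor C; d \<in> mor D; src C c = rng D d\<rbrakk> \<Longrightarrow> c \<rhd> d \<in> mor D"
    and lact_unit: "d \<in> mor D \<Longrightarrow> rng D d \<rhd> d = d"
    and rng_lact: "\<lbrakk>c \<in> mor C; d \<in> mor D; src C c = rng D d\<rbrakk> \<Longrightarrow> rng D (c \<rhd> d) = rng C c"
    and lact_cmp: "\<lbrakk>c1 \<in> mor C; c2 \<in> mor C; d \<in> mor D; src C c1 = rng C c2; src C c2 = rng D d\<rbrakk>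
        \<Longrightarrow> cmp C c1 c2 \<rhd> d = c1 \<rhd> (c2 \<rhd> d)"
    and lact_src: "c \<in> mor C \<Longrightarrow> c \<rhd> src C c = rng C c"
    and ract_mor: "\<lbrakk>c \<in> mor C; d \<in> mor D; src C c = rng D d\<rbrakk> \<Longrightarrow> c \<lhd>\<^sub>r d \<in> mor C"
    and ract_unit: "c \<in> mor C \<Longrightarrow> c \<lhd>\<^sub>r src C c = c"
    and src_ract: "\<lbrakk>c \<in> mor C; d \<in> mor D; src C c = rng D d\<rbrakk> \<Longrightarrow> src C (c \<lhd>\<^sub>r d) = src D d"
    and ract_cmp: "\<lbrakk>c \<in> mor C; d1 \<in> mor D; d2 \<in> mor D; src C c = rng D d1; src D d1 = rng D d2\<rbrakk>
        \<Longrightarrow> c \<lhd>\<^sub>r cmp D d1 d2 = (c \<lhd>\<^sub>r d1) \<lhd>\<^sub>r d2"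
    and ract_rng: "d \<in> mor D \<Longrightarrow> rng D d \<lhd>\<^sub>r d = src D d"
    and src_lact_rng_ract: "\<lbrakk>c \<in> mor C; d \<in> mor D; src C c = rng D d\<rbrakk>
        \<Longrightarrow> src D (c \<rhd> d) = rng C (c \<lhd>\<^sub>r d)"
    and lact_distrib: "\<lbrakk>c \<in> mor C; d1 \<in> mor D; d2 \<in> mor D; src C c = rng D d1; src D d1 = rng D d2\<rbrakk>
        \<Longrightarrow> c \<rhd> cmp D d1 d2 = cmp D (c \<rhd> d1) ((c \<lhd>\<^sub>r d1) \<rhd> d2)"
    and ract_distrib: "\<lbrakk>c1 \<in> mor C; c2 \<in> mor C; d \<in> mor D; src C c1 = rng C c2; src C c2 = rng D d\<rbrakk>
        \<Longrightarrow> cmp C c1 c2 \<lhd>\<^sub>r d = cmp C (c1 \<lhd>\<^sub>r (c2 \<rhd> d)) (c2 \<lhd>\<^sub>r d)"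

text \<open>The morphism \<open>dc\<close> is the pair \<open>(d, c)\<close>; the object \<open>u\<close> appears as its identity \<open>(u, u)\<close>.\<close>

definition matched_product ::
    "'a cat \<Rightarrow> 'a cat \<Rightarrow> ('a \<Rightarrow> 'a \<Rightarrow> 'a) \<Rightarrow> ('a \<Rightarrow> 'a \<Rightarrow> 'a) \<Rightarrow> ('a \<times> 'a) cat" where
  "matched_product C D lact ract =
    \<lparr>mor = {(d, c). d \<in> mor D \<and> c \<in> mor C \<and> src D d = rng C c},
     rng = (\<lambda>(d, c). (rng D d, rng D d)),
     src = (\<lambda>(d, c). (src C c, src C c)),
     cmp = (\<lambda>(d1, c1) (d2, c2). (cmp D d1 (lact c1 d2), cmp C (ract c1 d2) c2))\<rparr>"


section \<open>Homology of complexes of abelian groups\<close>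

text \<open>
  Complexes are indexed by the integers, the differential \<open>\<delta> n\<close> going from degree \<open>n\<close> to degree
  \<open>n - 1\<close>. All chain groups below are free on sets of tuples of prescribed length, hence trivial in
  negative degrees.
\<close>

definition homology :: "(int \<Rightarrow> 'g monoid) \<Rightarrow> (int \<Rightarrow> 'g \<Rightarrow> 'g) \<Rightarrow> int \<Rightarrow> 'g set monoid" where
  "homology A \<delta> n =
    (A n)\<lparr>carrier := kernel (A n) (A (n - 1)) (\<delta> n)\<rparr> Mod (\<delta> (n + 1) ` carrier (A (n + 1)))"

text \<open>
  The map induced by a chain map \<open>f\<close> on a homology class \<open>X\<close> (a coset of boundaries), with values in
  the degree \<open>n\<close> homology of \<open>(A, \<delta>)\<close>: the image \<open>f ` X\<close> lies in a single coset of the boundaries, and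
  multiplying it by the boundaries fills up that coset.
\<close>

definition induced :: "(int \<Rightarrow> 'g monoid) \<Rightarrow> (int \<Rightarrow> 'g \<Rightarrow> 'g) \<Rightarrow> int \<Rightarrow> ('g \<Rightarrow> 'g) \<Rightarrow> 'g set \<Rightarrow> 'g set" where
  "induced A \<delta> n f X = (\<delta> (n + 1) ` carrier (A (n + 1))) <#>\<^bsub>A n\<^esub> (f ` X)"


section \<open>Categorical homology\<close>

text \<open>
  A composable \<open>n\<close>-tuple \<open>es\<close> is stored as \<open>(u, es)\<close> with \<open>u\<close> its range. For \<open>n \<ge> 1\<close> the entry \<open>u\<close>
  is redundant; for \<open>n = 0\<close> it is the object, so that the \<open>0\<close>-tuples are the objects. The boundary of
  a tuple of length \<open>k + 1\<close> is \<open>d\<^sub>k\<close>, with \<open>d\<^sub>0[e] = [s(e)] - [r(e)]\<close> as the instance without inner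
  faces.
\<close>

definition tuples :: "'a cat \<Rightarrow> int \<Rightarrow> ('a \<times> 'a list) set" where
  "tuples E n = {(u, es). int (length es) = n \<and> (\<exists>v. path E u es v)}"

definition cat_boundary :: "'a cat \<Rightarrow> ('a \<times> 'a list \<Rightarrow>\<^sub>0 int) \<Rightarrow> ('a \<times> 'a list \<Rightarrow>\<^sub>0 int)" where
  "cat_boundary E = frag_extend (\<lambda>(u, es).
     if es = [] then 0
     else frag_of (src E (hd es), tl es)
        + (\<Sum>i = 1..<length es. frag_cmul ((-1) ^ i) (frag_of (u, contract E i es)))
        + frag_cmul ((-1) ^ length es) (frag_of (u, butlast es)))"

definition categorical_homology :: "'a cat \<Rightarrow> int \<Rightarrow> ('a \<times> 'a list \<Rightarrow>\<^sub>0 int) set monoid" where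
  "categorical_homology E =
     homology (\<lambda>n. free_Abelian_group (tuples E n)) (\<lambda>_. cat_boundary E)"


section \<open>The matched complex\<close>

text \<open>
  In both tuple actions the composite of an empty tuple is the relevant identity, which acts
  trivially; so the first, respectively last, entry is acted on by \<open>c\<close>, respectively \<open>d\<close>, itself.
\<close>

definition lact_tuple ::
    "'a cat \<Rightarrow> 'a cat \<Rightarrow> ('a \<Rightarrow> 'a \<Rightarrow> 'a) \<Rightarrow> ('a \<Rightarrow> 'a \<Rightarrow> 'a) \<Rightarrow> 'a \<Rightarrow> 'a list \<Rightarrow> 'a list" where
  "lact_tuple C D lact ract c ds =
     map (\<lambda>j. lact (ract c (foldl (cmp D) (src C c) (take j ds))) (ds ! j)) [0..<length ds]"

definition ract_tuple ::
    "'a cat \<Rightarrow> 'a cat \<Rightarrow> ('a \<Rightarrow> 'a \<Rightarrow> 'a) \<Rightarrow> ('a \<Rightarrow> 'a \<Rightarrow> 'a) \<Rightarrow> 'a list \<Rightarrow> 'a \<Rightarrow> 'a list" where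
  "ract_tuple C D lact ract cs d =
     map (\<lambda>i. ract (cs ! i) (lact (foldr (cmp C) (drop (Suc i) cs) (rng D d)) d)) [0..<length cs]"

text \<open>
  An element \<open>[c; d]\<close> of \<open>C\<^sup>p * D\<^sup>q\<close> is stored as \<open>(cs, u, ds)\<close>, where the object \<open>u\<close> is the source of
  \<open>cs\<close> and the range of \<open>ds\<close>. It is redundant unless \<open>p = q = 0\<close>, when it is the only datum; so
  \<open>C\<^sup>0 * D\<^sup>q = D\<^sup>q\<close> and \<open>C\<^sup>p * D\<^sup>0 = C\<^sup>p\<close>, and the general formulas for the differentials cover \<open>q = 0\<close>
  and \<open>p = 0\<close>. Both differentials are given on all bidegrees at once; \<open>p\<close> and \<open>q\<close> are read off as
  the lengths of \<open>cs\<close> and \<open>ds\<close>.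
\<close>

type_synonym 'a mchain = "'a list \<times> 'a \<times> 'a list \<Rightarrow>\<^sub>0 int"

definition matched_tuples :: "'a cat \<Rightarrow> 'a cat \<Rightarrow> int \<Rightarrow> int \<Rightarrow> ('a list \<times> 'a \<times> 'a list) set" where
  "matched_tuples C D p q =
     {(cs, u, ds). int (length cs) = p \<and> int (length ds) = q
        \<and> (\<exists>v. path C v cs u) \<and> (\<exists>w. path D u ds w)}"

definition matched_chains :: "'a cat \<Rightarrow> 'a cat \<Rightarrow> int \<Rightarrow> int \<Rightarrow> 'a mchain monoid" where
  "matched_chains C D p q = free_Abelian_group (matched_tuples C D p q)"

definition hdiff ::
    "'a cat \<Rightarrow> 'a cat \<Rightarrow> ('a \<Rightarrow> 'a \<Rightarrow> 'a) \<Rightarrow> ('a \<Rightarrow> 'a \<Rightarrow> 'a) \<Rightarrow> 'a mchain \<Rightarrow> 'a mchain" where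
  "hdiff C D lact ract = frag_extend (\<lambda>(cs, u, ds).
     if cs = [] then 0
     else frag_of (tl cs, u, ds)
        + (\<Sum>i = 1..<length cs. frag_cmul ((-1) ^ i) (frag_of (contract C i cs, u, ds)))
        + frag_cmul ((-1) ^ length cs)
            (frag_of (butlast cs, rng C (last cs), lact_tuple C D lact ract (last cs) ds)))"

definition vdiff ::
    "'a cat \<Rightarrow> 'a cat \<Rightarrow> ('a \<Rightarrow> 'a \<Rightarrow> 'a) \<Rightarrow> ('a \<Rightarrow> 'a \<Rightarrow> 'a) \<Rightarrow> 'a mchain \<Rightarrow> 'a mchain" where
  "vdiff C D lact ract = frag_extend (\<lambda>(cs, u, ds).
     if ds = [] then 0
     else frag_cmul ((-1) ^ length cs)
       (frag_of (ract_tuple C D lact ract cs (hd ds), src D (hd ds), tl ds)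
        + (\<Sum>j = 1..<length ds. frag_cmul ((-1) ^ j) (frag_of (cs, u, contract D j ds)))
        + frag_cmul ((-1) ^ length ds) (frag_of (cs, u, butlast ds))))"

definition Hv ::
    "'a cat \<Rightarrow> 'a cat \<Rightarrow> ('a \<Rightarrow> 'a \<Rightarrow> 'a) \<Rightarrow> ('a \<Rightarrow> 'a \<Rightarrow> 'a) \<Rightarrow> int \<Rightarrow> int \<Rightarrow> 'a mchain set monoid" where
  "Hv C D lact ract p q = homology (\<lambda>q. matched_chains C D p q) (\<lambda>_. vdiff C D lact ract) q"

definition Hh ::
    "'a cat \<Rightarrow> 'a cat \<Rightarrow> ('a \<Rightarrow> 'a \<Rightarrow> 'a) \<Rightarrow> ('a \<Rightarrow> 'a \<Rightarrow> 'a) \<Rightarrow> int \<Rightarrow> int \<Rightarrow> 'a mchain set monoid" where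
  "Hh C D lact ract p q = homology (\<lambda>p. matched_chains C D p q) (\<lambda>_. hdiff C D lact ract) p"

text \<open>
  The induced differentials, indexed by their source: \<open>hdiff_Hv p q\<close> maps \<open>Hv p q\<close> to \<open>Hv (p - 1) q\<close>
  and \<open>vdiff_Hh p q\<close> maps \<open>Hh p q\<close> to \<open>Hh p (q - 1)\<close>.
\<close>

definition hdiff_Hv ::
    "'a cat \<Rightarrow> 'a cat \<Rightarrow> ('a \<Rightarrow> 'a \<Rightarrow> 'a) \<Rightarrow> ('a \<Rightarrow> 'a \<Rightarrow> 'a) \<Rightarrow> int \<Rightarrow> int
      \<Rightarrow> 'a mchain set \<Rightarrow> 'a mchain set" where
  "hdiff_Hv C D lact ract p q =
     induced (\<lambda>q. matched_chains C D (p - 1) q) (\<lambda>_. vdiff C D lact ract) q (hdiff C D lact ract)"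

definition vdiff_Hh ::
    "'a cat \<Rightarrow> 'a cat \<Rightarrow> ('a \<Rightarrow> 'a \<Rightarrow> 'a) \<Rightarrow> ('a \<Rightarrow> 'a \<Rightarrow> 'a) \<Rightarrow> int \<Rightarrow> int
      \<Rightarrow> 'a mchain set \<Rightarrow> 'a mchain set" where
  "vdiff_Hh C D lact ract p q =
     induced (\<lambda>p. matched_chains C D p (q - 1)) (\<lambda>_. hdiff C D lact ract) p (vdiff C D lact ract)"

definition HhHv ::
    "'a cat \<Rightarrow> 'a cat \<Rightarrow> ('a \<Rightarrow> 'a \<Rightarrow> 'a) \<Rightarrow> ('a \<Rightarrow> 'a \<Rightarrow> 'a) \<Rightarrow> int \<Rightarrow> int \<Rightarrow> 'a mchain set set monoid" where
  "HhHv C D lact ract p q =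
     homology (\<lambda>p. Hv C D lact ract p q) (\<lambda>p. hdiff_Hv C D lact ract p q) p"

definition HvHh ::
    "'a cat \<Rightarrow> 'a cat \<Rightarrow> ('a \<Rightarrow> 'a \<Rightarrow> 'a) \<Rightarrow> ('a \<Rightarrow> 'a \<Rightarrow> 'a) \<Rightarrow> int \<Rightarrow> int \<Rightarrow> 'a mchain set set monoid" where
  "HvHh C D lact ract p q =
     homology (\<lambda>q. Hh C D lact ract p q) (\<lambda>q. vdiff_Hh C D lact ract p q) q"


section \<open>Homology spectral sequences\<close>

definition page_homology ::
    "(nat \<Rightarrow> int \<Rightarrow> int \<Rightarrow> 'g monoid) \<Rightarrow> (nat \<Rightarrow> int \<Rightarrow> int \<Rightarrow> 'g \<Rightarrow> 'g) \<Rightarrow> nat \<Rightarrow> int \<Rightarrow> int \<Rightarrow> 'g set monoid" where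
  "page_homology E d r p q =
     (E r p q)\<lparr>carrier := kernel (E r p q) (E r (p - int r) (q + int r - 1)) (d r p q)\<rparr>
       Mod (d r (p + int r) (q - int r + 1) ` carrier (E r (p + int r) (q - int r + 1)))"

text \<open>
  Pages start at \<open>r = 1\<close>; \<open>d r p q\<close> is the differential starting at \<open>E r p q\<close>. The isomorphisms
  \<open>\<sigma>\<close> identifying each page with the homology of the preceding one are part of the structure.
\<close>

locale homology_spectral_sequence =
  fixes E :: "nat \<Rightarrow> int \<Rightarrow> int \<Rightarrow> 'g monoid"
    and d :: "nat \<Rightarrow> int \<Rightarrow> int \<Rightarrow> 'g \<Rightarrow> 'g"
    and \<sigma> :: "nat \<Rightarrow> int \<Rightarrow> int \<Rightarrow> 'g set \<Rightarrow> 'g"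
  assumes page_group: "1 \<le> r \<Longrightarrow> comm_group (E r p q)"
    and d_hom: "1 \<le> r \<Longrightarrow> d r p q \<in> hom (E r p q) (E r (p - int r) (q + int r - 1))"
    and d_d: "\<lbrakk>1 \<le> r; x \<in> carrier (E r p q)\<rbrakk>
        \<Longrightarrow> d r (p - int r) (q + int r - 1) (d r p q x)
          = \<one>\<^bsub>E r (p - int r - int r) (q + int r - 1 + int r - 1)\<^esub>"
    and next_page: "1 \<le> r \<Longrightarrow> \<sigma> r p q \<in> iso (page_homology E d r p q) (E (Suc r) p q)"

text \<open>
  Convergence to a graded abelian group \<open>H\<close>: at each position the differentials starting or ending
  there vanish from some page on, so that the pages stabilise to \<open>E\<^sup>\<infinity>\<close>, and each \<open>H n\<close> has a finite
  filtration whose quotients are the entries of \<open>E\<^sup>\<infinity>\<close> in total degree \<open>n\<close>.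
\<close>

definition converges_to ::
    "(nat \<Rightarrow> int \<Rightarrow> int \<Rightarrow> 'g monoid) \<Rightarrow> (nat \<Rightarrow> int \<Rightarrow> int \<Rightarrow> 'g \<Rightarrow> 'g) \<Rightarrow> (int \<Rightarrow> 'h monoid) \<Rightarrow> bool" where
  "converges_to E d H \<longleftrightarrow>
     (\<exists>F :: int \<Rightarrow> int \<Rightarrow> 'h set.
        (\<forall>n p. subgroup (F n p) (H n) \<and> F n p \<subseteq> F n (p + 1))
      \<and> (\<forall>n. (\<exists>a. F n a = {\<one>\<^bsub>H n\<^esub>}) \<and> (\<exists>b. F n b = carrier (H n)))
      \<and> (\<forall>p q. \<exists>r0 \<ge> 1. \<forall>r \<ge> r0.
           (\<forall>x \<in> carrier (E r p q). d r p q x = \<one>\<^bsub>E r (p - int r) (q + int r - 1)\<^esub>)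
         \<and> (\<forall>x \<in> carrier (E r (p + int r) (q - int r + 1)).
              d r (p + int r) (q - int r + 1) x = \<one>\<^bsub>E r p q\<^esub>)
         \<and> E r p q \<cong> (H (p + q))\<lparr>carrier := F (p + q) p\<rparr> Mod F (p + q) (p - 1)))"

end

theory Submission
  imports Defs
begin

text \<open>
  The double complex has the two spectral sequences of a first quadrant double complex, converging
  to the homology of its total complex. It remains to compare this with the homology of the product
  category \<open>E\<close>. Adjoining a coefficient \<open>e\<close> in \<open>E\<close> on the left of \<open>[c; d]\<close> turns the total complex into
  a complex of free \<open>E\<close>-modules whose coinvariants give back the total complex. It resolves the
  trivial module: for \<open>e = ab\<close> one moves \<open>b\<close> into the tuple of the \<open>c\<^sub>i\<close>, which contracts the rows, and what
  is left is the bar resolution of \<open>D\<close>. As the bar resolution of \<open>E\<close> resolves the same module, the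
  two are equivariantly homotopy equivalent, and so are their coinvariants.
\<close>

section \<open>Quotients of subgroups\<close>

text \<open>A direct chain map from the matched complex to the bar complex of the product category,
  with a homotopy inverse, would call for shuffle-like formulas; with coefficients adjoined,
  freeness of the source and a contraction of the target produce these maps recursively. The
  contractions are not equivariant and do not descend to coinvariants. Hence every map or homotopy
  that has to descend is prescribed on basis elements and extended equivariantly, and a contraction
  serves only to solve for its value on a basis element. The contractions do a second service: since
  the actions on tuples make a face by face proof of dd = 0 long, it is deduced from the homotopy
  identity. All pages of a spectral sequence share one type, whereas taking homology adds a level of
  sets. So the pages are not iterated homology groups but subquotients of the chains of one
  bidegree, and \<open>Union\<close> removes the extra level. The second spectral sequence is the
  first one for the transposed bicomplex.\<close>

definition subgrp :: "'g::ab_group_add set \<Rightarrow> bool" where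
  "subgrp Z \<longleftrightarrow> 0 \<in> Z \<and> (\<forall>x\<in>Z. \<forall>y\<in>Z. x - y \<in> Z)"

lemma subgrp_0: "subgrp Z \<Longrightarrow> 0 \<in> Z"
  and subgrp_diff: "subgrp Z \<Longrightarrow> x \<in> Z \<Longrightarrow> y \<in> Z \<Longrightarrow> x - y \<in> Z"
  by (auto simp: subgrp_def)

lemma subgrp_minus: "subgrp Z \<Longrightarrow> x \<in> Z \<Longrightarrow> - x \<in> Z"
  using subgrp_diff[of Z 0 x] by (simp add: subgrp_0)

lemma subgrp_add: "subgrp Z \<Longrightarrow> x \<in> Z \<Longrightarrow> y \<in> Z \<Longrightarrow> x + y \<in> Z"
  using subgrp_diff[of Z x "- y"] by (simp add: subgrp_minus)

definition coset :: "'g::ab_group_add set \<Rightarrow> 'g \<Rightarrow> 'g set" where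
  "coset B z = {y. y - z \<in> B}"

lemma coset_0 [simp]: "coset B 0 = B"
  by (simp add: coset_def)

lemma coset_self: "subgrp B \<Longrightarrow> z \<in> coset B z"
  by (simp add: coset_def subgrp_0)

lemma coset_eq_iff:
  assumes "subgrp B"
  shows "coset B x = coset B y \<longleftrightarrow> x - y \<in> B"
proof
  assume "coset B x = coset B y"
  then show "x - y \<in> B"
    using coset_self[OF assms, of x] by (simp add: coset_def)
next
  assume xy: "x - y \<in> B"
  have "z - x \<in> B \<longleftrightarrow> z - y \<in> B" for z
    using subgrp_add[OF assms _ xy, of "z - x"] subgrp_diff[OF assms _ xy, of "z - y"] by auto
  then show "coset B x = coset B y"
    by (simp add: coset_def)
qed

lemma coset_eq_self_iff: "subgrp B \<Longrightarrow> coset B x = B \<longleftrightarrow> x \<in> B"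
  using coset_eq_iff[of B x 0] by simp

definition quot :: "'g::ab_group_add set \<Rightarrow> 'g set \<Rightarrow> 'g set monoid" where
  "quot Z B = \<lparr>carrier = coset B ` Z, monoid.mult = (\<lambda>X Y. {x + y |x y. x \<in> X \<and> y \<in> Y}), one = B\<rparr>"

lemma carrier_quot [simp]: "carrier (quot Z B) = coset B ` Z"
  and one_quot [simp]: "\<one>\<^bsub>quot Z B\<^esub> = B"
  by (simp_all add: quot_def)

lemma mult_quot:
  assumes "subgrp B"
  shows "coset B x \<otimes>\<^bsub>quot Z B\<^esub> coset B y = coset B (x + y)"
proof -
  have "\<exists>u v. z = u + v \<and> u - x \<in> B \<and> v - y \<in> B" if "z - (x + y) \<in> B" for z
    using that subgrp_0[OF assms] by (intro exI[of _ x] exI[of _ "z - x"]) (simp add: algebra_simps)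
  moreover have "u + v - (x + y) \<in> B" if "u - x \<in> B" "v - y \<in> B" for u v
    using subgrp_add[OF assms that] by (simp add: algebra_simps)
  ultimately show ?thesis
    by (auto simp: quot_def coset_def)
qed

text \<open>An equality of records and not merely an isomorphism: this allows the first pages to be
  \<open>Hv\<close> and \<open>Hh\<close> themselves.\<close>

lemma free_Abelian_group_Mod:
  "(free_Abelian_group S)\<lparr>carrier := Z\<rparr> Mod B = quot Z B"
proof -
  have "(\<Union>h\<in>B. {h + a}) = coset B a" for a
  proof -
    have "x \<in> B \<Longrightarrow> x + a - a \<in> B" for x by simp
    moreover have "\<exists>h\<in>B. x = h + a" if "x - a \<in> B" for x
      using that by (intro bexI[of _ "x - a"]) auto
    ultimately show ?thesis by (auto simp: coset_def)
  qed
  then show ?thesis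
    by (auto simp: FactGroup_def quot_def free_Abelian_group_def RCOSETS_def r_coset_def set_mult_def
        fun_eq_iff)
qed

lemma comm_group_quot:
  assumes B: "subgrp B" and Z: "subgrp Z" and "B \<subseteq> Z"
  shows "comm_group (quot Z B)"
proof (rule comm_groupI)
  show "x \<otimes>\<^bsub>quot Z B\<^esub> y \<in> carrier (quot Z B)"
    if "x \<in> carrier (quot Z B)" "y \<in> carrier (quot Z B)" for x y
    using that by (auto simp: mult_quot[OF B] intro!: imageI subgrp_add[OF Z])
  show "\<one>\<^bsub>quot Z B\<^esub> \<in> carrier (quot Z B)"
    using imageI[OF subgrp_0[OF Z], of "coset B"] by simp
  show "x \<otimes>\<^bsub>quot Z B\<^esub> y \<otimes>\<^bsub>quot Z B\<^esub> z = x \<otimes>\<^bsub>quot Z B\<^esub> (y \<otimes>\<^bsub>quot Z B\<^esub> z)"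
    if "x \<in> carrier (quot Z B)" "y \<in> carrier (quot Z B)" "z \<in> carrier (quot Z B)" for x y z
    using that by (auto simp: mult_quot[OF B] add.assoc)
  show "x \<otimes>\<^bsub>quot Z B\<^esub> y = y \<otimes>\<^bsub>quot Z B\<^esub> x"
    if "x \<in> carrier (quot Z B)" "y \<in> carrier (quot Z B)" for x y
    using that by (auto simp: mult_quot[OF B] add.commute)
  show "\<one>\<^bsub>quot Z B\<^esub> \<otimes>\<^bsub>quot Z B\<^esub> x = x" if "x \<in> carrier (quot Z B)" for x
    using that mult_quot[OF B, of Z 0] by auto
  show "\<exists>y\<in>carrier (quot Z B). y \<otimes>\<^bsub>quot Z B\<^esub> x = \<one>\<^bsub>quot Z B\<^esub>" if x: "x \<in> carrier (quot Z B)" for x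
  proof -
    obtain z where z: "z \<in> Z" "x = coset B z" using x by auto
    then have "coset B (- z) \<otimes>\<^bsub>quot Z B\<^esub> x = \<one>\<^bsub>quot Z B\<^esub>"
      by (simp add: mult_quot[OF B])
    then show ?thesis using subgrp_minus[OF Z z(1)] by auto
  qed
qed

text \<open>The isomorphism (Z'/B)/(B'/B) = Z'/B' in explicit form: an element on the left is the
  set of the \<open>B\<close>-cosets that make up one \<open>B'\<close>-coset, so
  \<open>Union\<close> recovers that coset and \<open>image (coset B)\<close> cuts it up
  again.\<close>

lemma quot_quot_iso:
  assumes B: "subgrp B" and B': "subgrp B'" and Z': "subgrp Z'" and sub: "B \<subseteq> B'" "B' \<subseteq> Z'"
  shows "Union \<in> iso ((quot Z B)\<lparr>carrier := coset B ` Z'\<rparr> Mod (coset B ` B')) (quot Z' B')" (is ?thesis1)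
    and "image (coset B) \<in> iso (quot Z' B') ((quot Z B)\<lparr>carrier := coset B ` Z'\<rparr> Mod (coset B ` B'))"
      (is ?thesis2)
proof -
  let ?G = "(quot Z B)\<lparr>carrier := coset B ` Z'\<rparr>"
  have mult: "coset B x \<otimes>\<^bsub>?G\<^esub> coset B y = coset B (x + y)" for x y
    using mult_quot[OF B, of Z x y] by simp
  have cos: "(coset B ` B') #>\<^bsub>?G\<^esub> coset B z = coset B ` coset B' z" for z
  proof -
    have "(coset B ` B') #>\<^bsub>?G\<^esub> coset B z = (\<lambda>b. coset B (b + z)) ` B'"
      by (simp only: r_coset_def SUP_image o_def mult) blast
    also have "\<dots> = coset B ` coset B' z"
    proof -
      have "coset B' z = (\<lambda>b. b + z) ` B'"
      proof -
        have "x \<in> (\<lambda>b. b + z) ` B'" if "x - z \<in> B'" for x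
          using that by (intro image_eqI[of _ _ "x - z"]) auto
        then show ?thesis by (auto simp: coset_def)
      qed
      then show ?thesis by (simp add: image_image)
    qed
    finally show ?thesis .
  qed
  have carr: "carrier (?G Mod (coset B ` B')) = (\<lambda>z. coset B ` coset B' z) ` Z'"
  proof -
    have "carrier ?G = coset B ` Z'" by simp
    then show ?thesis by (simp only: carrier_FactGroup image_image cos)
  qed
  have Un: "\<Union>(coset B ` coset B' z) = coset B' z" for z
  proof -
    have "x \<in> coset B' z" if "x \<in> coset B y" "y \<in> coset B' z" for x y
      using subgrp_add[OF B', of "x - y" "y - z"] that sub by (auto simp: coset_def)
    then show ?thesis using coset_self[OF B] by blast
  qed
  have mul: "(coset B ` coset B' x) \<otimes>\<^bsub>?G Mod (coset B ` B')\<^esub> (coset B ` coset B' y)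
      = coset B ` coset B' (x + y)" for x y
  proof -
    have "(coset B ` coset B' x) \<otimes>\<^bsub>?G Mod (coset B ` B')\<^esub> (coset B ` coset B' y)
       = {coset B (u + v) |u v. u \<in> coset B' x \<and> v \<in> coset B' y}"
      unfolding mult_FactGroup set_mult_def SUP_image o_def mult by blast
    also have "\<dots> = coset B ` {u + v |u v. u \<in> coset B' x \<and> v \<in> coset B' y}"
      by auto
    also have "{u + v |u v. u \<in> coset B' x \<and> v \<in> coset B' y} = coset B' (x + y)"
      using mult_quot[OF B', of Z x y] by (simp add: quot_def)
    finally show ?thesis .
  qed
  have "Union \<in> hom (?G Mod (coset B ` B')) (quot Z' B')"
  proof (rule homI)
    fix X Y
    assume "X \<in> carrier (?G Mod (coset B ` B'))" "Y \<in> carrier (?G Mod (coset B ` B'))"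
    then obtain x y where "X = coset B ` coset B' x" "Y = coset B ` coset B' y"
      unfolding carr by auto
    then show "\<Union> (X \<otimes>\<^bsub>?G Mod (coset B ` B')\<^esub> Y) = \<Union>X \<otimes>\<^bsub>quot Z' B'\<^esub> \<Union>Y"
      by (simp only: mul Un mult_quot[OF B'])
  qed (auto simp only: carr Un carrier_quot)
  moreover have "bij_betw Union (carrier (?G Mod (coset B ` B'))) (carrier (quot Z' B'))"
    unfolding bij_betw_def carr carrier_quot
  proof
    show "inj_on Union ((\<lambda>z. coset B ` coset B' z) ` Z')"
    proof (rule inj_onI)
      fix X Y
      assume "X \<in> (\<lambda>z. coset B ` coset B' z) ` Z'" "Y \<in> (\<lambda>z. coset B ` coset B' z) ` Z'"
        and eq: "\<Union>X = \<Union>Y"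
      then obtain x y where "X = coset B ` coset B' x" "Y = coset B ` coset B' y" by blast
      with eq show "X = Y" by (simp only: Un)
    qed
    show "Union ` (\<lambda>z. coset B ` coset B' z) ` Z' = coset B' ` Z'"
      by (simp only: image_image Un)
  qed
  ultimately show ?thesis1 by (simp add: iso_def)
  have "image (coset B) \<in> hom (quot Z' B') (?G Mod (coset B ` B'))"
  proof (rule homI)
    fix X Y
    assume "X \<in> carrier (quot Z' B')" "Y \<in> carrier (quot Z' B')"
    then obtain x y where "X = coset B' x" "Y = coset B' y" by auto
    then show "coset B ` (X \<otimes>\<^bsub>quot Z' B'\<^esub> Y) = coset B ` X \<otimes>\<^bsub>?G Mod (coset B ` B')\<^esub> coset B ` Y"
      by (simp only: mul mult_quot[OF B'])
  next
    fix X assume "X \<in> carrier (quot Z' B')"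
    then show "coset B ` X \<in> carrier (?G Mod (coset B ` B'))"
      unfolding carr carrier_quot by blast
  qed
  moreover have "bij_betw (image (coset B)) (carrier (quot Z' B')) (carrier (?G Mod (coset B ` B')))"
    unfolding bij_betw_def carr carrier_quot
  proof
    show "inj_on ((`) (coset B)) (coset B' ` Z')"
    proof (rule inj_onI)
      fix X Y assume "X \<in> coset B' ` Z'" "Y \<in> coset B' ` Z'" and eq: "coset B ` X = coset B ` Y"
      then obtain x y where "X = coset B' x" "Y = coset B' y" by blast
      with arg_cong[OF eq, of Union] show "X = Y" by (simp only: Un)
    qed
  qed (simp only: image_image)
  ultimately show ?thesis2 by (simp add: iso_def)
qed

text \<open>The differentials of the spectral sequence depend on a choice of lifts; describing them as relations
  avoids the choice.\<close>

definition rel_map :: "('g \<Rightarrow> 'h \<Rightarrow> bool) \<Rightarrow> 'h::ab_group_add set \<Rightarrow> 'g set \<Rightarrow> 'h set" where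
  "rel_map R B' X = {y'. \<exists>x\<in>X. \<exists>y. R x y \<and> y' - y \<in> B'}"

text \<open>A many-valued homomorphism. By \<open>R_diff\<close>, values at two points of one coset
  of \<open>B\<close> differ by a value at a point of \<open>B\<close>, hence by an element of
  \<open>B'\<close>; so the induced map of quotients is single-valued.\<close>

locale additive_relation =
  fixes Z B :: "'g::ab_group_add set" and Z' B' :: "'h::ab_group_add set" and R :: "'g \<Rightarrow> 'h \<Rightarrow> bool"
  assumes Z: "subgrp Z" and B: "subgrp B" and Z': "subgrp Z'" and B': "subgrp B'"
    and B_le: "B \<subseteq> Z" and B'_le: "B' \<subseteq> Z'"
    and R_total: "z \<in> Z \<Longrightarrow> \<exists>y\<in>Z'. R z y"
    and R_diff: "R z y \<Longrightarrow> R z' y' \<Longrightarrow> R (z - z') (y - y')"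
    and R_B: "z \<in> B \<Longrightarrow> R z y \<Longrightarrow> y \<in> B'"
begin

lemma R_add: "R z y \<Longrightarrow> R z' y' \<Longrightarrow> R (z + z') (y + y')"
  using R_diff[of 0 0 z' y'] R_diff[of z' y' z' y'] R_diff[of z y "- z'" "- y'"] by simp

lemma rel_map_coset:
  assumes "R z y"
  shows "rel_map R B' (coset B z) = coset B' y"
proof -
  have "y' - y \<in> B'" if "x - z \<in> B" "R x y''" "y' - y'' \<in> B'" for x y' y''
    using subgrp_add[OF B' that(3) R_B[OF that(1) R_diff[OF that(2) assms]]] by simp
  moreover have "y' \<in> rel_map R B' (coset B z)" if "y' - y \<in> B'" for y'
    unfolding rel_map_def using that assms coset_self[OF B, of z] by blast
  ultimately show ?thesis
    by (auto simp: rel_map_def coset_def)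
qed

lemma rel_map_hom: "rel_map R B' \<in> hom (quot Z B) (quot Z' B')"
proof (rule homI)
  fix X assume "X \<in> carrier (quot Z B)"
  then obtain z where z: "z \<in> Z" "X = coset B z" by auto
  with R_total obtain y where "y \<in> Z'" "R z y" by blast
  then show "rel_map R B' X \<in> carrier (quot Z' B')"
    using z by (auto simp: rel_map_coset)
next
  fix X Y assume "X \<in> carrier (quot Z B)" "Y \<in> carrier (quot Z B)"
  then obtain x y where xy: "x \<in> Z" "X = coset B x" "y \<in> Z" "Y = coset B y" by auto
  with R_total obtain x' y' where "R x x'" "R y y'" by blast
  then show "rel_map R B' (X \<otimes>\<^bsub>quot Z B\<^esub> Y) = rel_map R B' X \<otimes>\<^bsub>quot Z' B'\<^esub> rel_map R B' Y"
    using xy R_add[of x x' y y'] by (simp add: mult_quot[OF B] mult_quot[OF B'] rel_map_coset)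
qed

lemma rel_map_iso:
  assumes inj: "\<And>z y. z \<in> Z \<Longrightarrow> R z y \<Longrightarrow> y \<in> B' \<Longrightarrow> z \<in> B"
    and surj: "\<And>y. y \<in> Z' \<Longrightarrow> \<exists>z\<in>Z. \<exists>y'. R z y' \<and> y - y' \<in> B'"
  shows "rel_map R B' \<in> iso (quot Z B) (quot Z' B')"
proof -
  have "inj_on (rel_map R B') (coset B ` Z)"
  proof (rule inj_onI)
    fix X Y assume "X \<in> coset B ` Z" "Y \<in> coset B ` Z" and eq: "rel_map R B' X = rel_map R B' Y"
    then obtain x y where xy: "x \<in> Z" "X = coset B x" "y \<in> Z" "Y = coset B y" by auto
    with R_total obtain x' y' where R: "R x x'" "R y y'" by blast
    then have "x' - y' \<in> B'"
      using eq xy coset_eq_iff[OF B'] by (simp add: rel_map_coset)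
    then have "x - y \<in> B"
      using inj[OF subgrp_diff[OF Z xy(1,3)] R_diff[OF R]] by simp
    then show "X = Y" using xy coset_eq_iff[OF B] by simp
  qed
  moreover have "rel_map R B' ` coset B ` Z = coset B' ` Z'"
  proof
    show "rel_map R B' ` coset B ` Z \<subseteq> coset B' ` Z'"
      using rel_map_hom by (auto simp: hom_def)
    show "coset B' ` Z' \<subseteq> rel_map R B' ` coset B ` Z"
    proof
      fix Y assume "Y \<in> coset B' ` Z'"
      then obtain y where y: "y \<in> Z'" "Y = coset B' y" by auto
      with surj obtain z y' where z: "z \<in> Z" "R z y'" "y - y' \<in> B'" by blast
      then have "Y = rel_map R B' (coset B z)"
        using y coset_eq_iff[OF B'] by (simp add: rel_map_coset)
      then show "Y \<in> rel_map R B' ` coset B ` Z" using z by blast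
    qed
  qed
  ultimately show ?thesis
    using rel_map_hom by (simp add: iso_def bij_betw_def)
qed

end

section \<open>The spectral sequence of a first quadrant double complex\<close>

lemma subgrp_keys: "subgrp {x :: 'k \<Rightarrow>\<^sub>0 int. Poly_Mapping.keys x \<subseteq> A}"
  using keys_diff by (fastforce simp: subgrp_def)

lemma keys_frag_extend_subset:
  assumes "Poly_Mapping.keys x \<subseteq> A" "\<And>k. k \<in> A \<Longrightarrow> Poly_Mapping.keys (g k) \<subseteq> A'"
  shows "Poly_Mapping.keys (frag_extend g x) \<subseteq> A'"
  using keys_frag_extend[of g x] assms by fastforce

lemma frag_extend_0_on:
  assumes "Poly_Mapping.keys x \<subseteq> A" "\<And>k. k \<in> A \<Longrightarrow> g k = 0"
  shows "frag_extend g x = 0"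
  using assms by (intro frag_extend_eq_0) auto

text \<open>One set of generators carries all bidegrees, so each differential is a single map and
  the total complex is only another sorting of the same chains. By bidegree, \<open>gh_gv\<close>
  combines the three identities of a double complex. The data are symmetric in the two directions,
  which gives the second spectral sequence.\<close>

locale first_quadrant_bicomplex =
  fixes S :: "'k set" and P Q :: "'k \<Rightarrow> int" and gh gv :: "'k \<Rightarrow> 'k \<Rightarrow>\<^sub>0 int"
  assumes P_nonneg: "k \<in> S \<Longrightarrow> 0 \<le> P k" and Q_nonneg: "k \<in> S \<Longrightarrow> 0 \<le> Q k"
    and keys_gh: "k \<in> S \<Longrightarrow> Poly_Mapping.keys (gh k) \<subseteq> {l \<in> S. P l = P k - 1 \<and> Q l = Q k}"
    and keys_gv: "k \<in> S \<Longrightarrow> Poly_Mapping.keys (gv k) \<subseteq> {l \<in> S. P l = P k \<and> Q l = Q k - 1}"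
    and gh_gv: "k \<in> S \<Longrightarrow> frag_extend gh (gh k + gv k) + frag_extend gv (gh k + gv k) = 0"
begin

section \<open>The total complex and its filtration by columns\<close>

definition D :: "('k \<Rightarrow>\<^sub>0 int) \<Rightarrow> 'k \<Rightarrow>\<^sub>0 int" where
  "D x = frag_extend gh x + frag_extend gv x"

definition Tot :: "int \<Rightarrow> ('k \<Rightarrow>\<^sub>0 int) set" where
  "Tot n = {x. Poly_Mapping.keys x \<subseteq> {k \<in> S. P k + Q k = n}}"

definition Fil :: "int \<Rightarrow> int \<Rightarrow> ('k \<Rightarrow>\<^sub>0 int) set" where
  "Fil p n = {x. Poly_Mapping.keys x \<subseteq> {k \<in> S. P k \<le> p \<and> P k + Q k = n}}"

definition Bi :: "int \<Rightarrow> int \<Rightarrow> ('k \<Rightarrow>\<^sub>0 int) set" where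
  "Bi p q = {x. Poly_Mapping.keys x \<subseteq> {k \<in> S. P k = p \<and> Q k = q}}"

definition pr :: "int \<Rightarrow> ('k \<Rightarrow>\<^sub>0 int) \<Rightarrow> 'k \<Rightarrow>\<^sub>0 int" where
  "pr p = frag_extend (\<lambda>k. if P k = p then frag_of k else 0)"

lemma D_diff: "D (x - y) = D x - D y"
  by (simp add: D_def frag_extend_diff)

lemma D_0 [simp]: "D 0 = 0"
  by (simp add: D_def)

lemma pr_diff: "pr p (x - y) = pr p x - pr p y"
  by (simp add: pr_def frag_extend_diff)

lemma pr_add: "pr p (x + y) = pr p x + pr p y"
  by (simp add: pr_def frag_extend_add)

lemma pr_0 [simp]: "pr p 0 = 0"
  by (simp add: pr_def)

lemma subgrp_Fil: "subgrp (Fil p n)"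
  by (simp add: Fil_def subgrp_keys)

lemma keys_pr: "Poly_Mapping.keys (pr p x) = {k \<in> Poly_Mapping.keys x. P k = p}"
proof -
  have "Poly_Mapping.lookup (pr p x) k = (if P k = p then Poly_Mapping.lookup x k else 0)" for k
    using subset_UNIV[of "Poly_Mapping.keys x"]
  proof (induction x rule: frag_induction)
    case (diff a b)
    then show ?case by (simp add: pr_diff lookup_minus)
  qed (auto simp: pr_def)
  then show ?thesis by (auto simp: in_keys_iff split: if_splits)
qed

lemma pr_Bi: "x \<in> Fil p n \<Longrightarrow> pr p' x \<in> Bi p' (n - p')"
  by (auto simp: Bi_def Fil_def keys_pr)

lemma pr_eq_0_iff: "x \<in> Fil p n \<Longrightarrow> pr p x = 0 \<longleftrightarrow> x \<in> Fil (p - 1) n"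
  unfolding keys_eq_empty[symmetric] keys_pr by (fastforce simp: Fil_def)

lemma pr_Fil_less: "x \<in> Fil p n \<Longrightarrow> p < p' \<Longrightarrow> pr p' x = 0"
  unfolding keys_eq_empty[symmetric] keys_pr by (fastforce simp: Fil_def)

lemma pr_id: "x \<in> Bi p q \<Longrightarrow> pr p x = x"
proof -
  assume "x \<in> Bi p q"
  then have "frag_extend (\<lambda>k. if P k = p then frag_of k else 0) x = frag_extend frag_of x"
    by (intro frag_extend_eq) (auto simp: Bi_def)
  then show ?thesis by (simp add: pr_def flip: frag_expansion)
qed

lemma Bi_Fil: "x \<in> Bi p q \<Longrightarrow> x \<in> Fil p (p + q)"
  by (auto simp: Bi_def Fil_def)

lemma Fil_mono: "p \<le> p' \<Longrightarrow> Fil p n \<subseteq> Fil p' n"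
  by (fastforce simp: Fil_def)

lemma Fil_Tot: "Fil p n \<subseteq> Tot n"
  by (auto simp: Fil_def Tot_def)

lemma Fil_eq_Tot: "n \<le> p \<Longrightarrow> Fil p n = Tot n"
  using Q_nonneg by (fastforce simp: Fil_def Tot_def)

lemma Fil_neg: "p < 0 \<Longrightarrow> Fil p n = {0}"
  using P_nonneg by (fastforce simp: Fil_def simp flip: keys_eq_empty)

lemma Bi_neg: "p < 0 \<or> q < 0 \<Longrightarrow> Bi p q = {0}"
  using P_nonneg Q_nonneg by (fastforce simp: Bi_def simp flip: keys_eq_empty)

lemma gh_Bi: "x \<in> Bi p q \<Longrightarrow> frag_extend gh x \<in> Bi (p - 1) q"
  unfolding Bi_def mem_Collect_eq
  by (erule keys_frag_extend_subset) (use keys_gh in fastforce)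

lemma gv_Bi: "x \<in> Bi p q \<Longrightarrow> frag_extend gv x \<in> Bi p (q - 1)"
  unfolding Bi_def mem_Collect_eq
  by (erule keys_frag_extend_subset) (use keys_gv in fastforce)

lemma D_Fil:
  assumes "x \<in> Fil p n"
  shows "D x \<in> Fil p (n - 1)"
proof -
  have x: "Poly_Mapping.keys x \<subseteq> {k \<in> S. P k \<le> p \<and> P k + Q k = n}"
    using assms by (simp add: Fil_def)
  have "frag_extend gh x \<in> Fil p (n - 1)" "frag_extend gv x \<in> Fil p (n - 1)"
    unfolding Fil_def mem_Collect_eq
    by (rule keys_frag_extend_subset[OF x]; use keys_gh keys_gv in fastforce)+
  then show ?thesis
    unfolding D_def by (rule subgrp_add[OF subgrp_Fil])
qed

lemma D_D:
  assumes "x \<in> Tot n"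
  shows "D (D x) = 0"
proof -
  have "Poly_Mapping.keys x \<subseteq> S" using assms by (auto simp: Tot_def)
  then show ?thesis
  proof (induction x rule: frag_induction)
    case (one k)
    then show ?case using gh_gv by (simp add: D_def)
  qed (simp_all add: D_diff)
qed

lemma D_D_Fil: "x \<in> Fil p n \<Longrightarrow> D (D x) = 0"
  using D_D Fil_Tot by blast

text \<open>The horizontal part lowers the column, so the leading term of a boundary sees only
  \<open>gv\<close>. This makes the first page the vertical homology.\<close>

lemma pr_D:
  assumes "x \<in> Fil p n"
  shows "pr p (D x) = frag_extend gv (pr p x)"
proof -
  have "Poly_Mapping.keys x \<subseteq> {k \<in> S. P k \<le> p}" using assms by (auto simp: Fil_def)
  then show ?thesis
  proof (induction x rule: frag_induction)
    case (one k)
    have k: "frag_of k \<in> Bi (P k) (Q k)" using one by (auto simp: Bi_def keys_frag_of)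
    have "frag_extend gh (frag_of k) \<in> Fil (P k - 1) (P k - 1 + Q k)"
      by (rule Bi_Fil[OF gh_Bi[OF k]])
    then have 1: "pr p (gh k) = 0"
      using pr_Fil_less one by fastforce
    have gv: "frag_extend gv (frag_of k) \<in> Bi (P k) (Q k - 1)"
      by (rule gv_Bi[OF k])
    have 2: "pr p (gv k) = frag_extend gv (pr p (frag_of k))"
    proof (cases "P k = p")
      case True
      then show ?thesis using pr_id[OF gv] pr_id[OF k] by simp
    next
      case False
      then have "P k < p" using one by simp
      then show ?thesis
        using pr_Fil_less[OF Bi_Fil[OF gv]] pr_Fil_less[OF Bi_Fil[OF k]] by simp
    qed
    show ?case using 1 2 by (simp add: D_def pr_add)
  qed (simp_all add: D_diff pr_diff frag_extend_diff)
qed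

text \<open>The usual cycles and boundaries of the filtration are projected to bidegree \<open>(p, q)\<close>, so that the
  first page is literally the vertical homology of \<open>Bi p q\<close> and every page consists of cosets of
  chains of that bidegree.\<close>

definition Zpage :: "nat \<Rightarrow> int \<Rightarrow> int \<Rightarrow> ('k \<Rightarrow>\<^sub>0 int) set" where
  "Zpage r p q = {pr p x |x. x \<in> Fil p (p + q) \<and> D x \<in> Fil (p - int r) (p + q - 1)}"

definition Bpage :: "nat \<Rightarrow> int \<Rightarrow> int \<Rightarrow> ('k \<Rightarrow>\<^sub>0 int) set" where
  "Bpage r p q = {pr p (D w) |w. w \<in> Fil (p + int r - 1) (p + q + 1) \<and> D w \<in> Fil p (p + q)}"

definition page :: "nat \<Rightarrow> int \<Rightarrow> int \<Rightarrow> ('k \<Rightarrow>\<^sub>0 int) set monoid" where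
  "page r p q = quot (Zpage r p q) (Bpage r p q)"

text \<open>The rule d[x] = [D x'], where the lift x' has leading term x. Two lifts of x differ by
  some w in \<open>Fil (p - 1)\<close>, and the leading term of D w lies in the target
  \<open>Bpage\<close>.\<close>

definition drel :: "nat \<Rightarrow> int \<Rightarrow> int \<Rightarrow> ('k \<Rightarrow>\<^sub>0 int) \<Rightarrow> ('k \<Rightarrow>\<^sub>0 int) \<Rightarrow> bool" where
  "drel r p q x y \<longleftrightarrow> (\<exists>x'. x' \<in> Fil p (p + q) \<and> D x' \<in> Fil (p - int r) (p + q - 1)
      \<and> x = pr p x' \<and> y = pr (p - int r) (D x'))"

definition pdiff :: "nat \<Rightarrow> int \<Rightarrow> int \<Rightarrow> ('k \<Rightarrow>\<^sub>0 int) set \<Rightarrow> ('k \<Rightarrow>\<^sub>0 int) set" where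
  "pdiff r p q = rel_map (drel r p q) (Bpage r (p - int r) (q + int r - 1))"

section \<open>The pages form a spectral sequence\<close>

lemma subgrp_Zpage: "subgrp (Zpage r p q)"
  unfolding subgrp_def
proof (intro conjI ballI)
  show "0 \<in> Zpage r p q"
    unfolding Zpage_def using subgrp_0[OF subgrp_Fil] by (auto intro!: exI[of _ 0])
  fix x y assume "x \<in> Zpage r p q" "y \<in> Zpage r p q"
  then obtain x' y' where "x' \<in> Fil p (p + q)" "D x' \<in> Fil (p - int r) (p + q - 1)" "x = pr p x'"
     "y' \<in> Fil p (p + q)" "D y' \<in> Fil (p - int r) (p + q - 1)" "y = pr p y'"
    unfolding Zpage_def by blast
  then show "x - y \<in> Zpage r p q"
    unfolding Zpage_def by (auto intro!: exI[of _ "x' - y'"] subgrp_diff[OF subgrp_Fil] simp: D_diff pr_diff)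
qed

lemma subgrp_Bpage: "subgrp (Bpage r p q)"
  unfolding subgrp_def
proof (intro conjI ballI)
  show "0 \<in> Bpage r p q"
    unfolding Bpage_def using subgrp_0[OF subgrp_Fil] by (auto intro!: exI[of _ 0])
  fix x y assume "x \<in> Bpage r p q" "y \<in> Bpage r p q"
  then obtain x' y' where "x' \<in> Fil (p + int r - 1) (p + q + 1)" "D x' \<in> Fil p (p + q)" "x = pr p (D x')"
     "y' \<in> Fil (p + int r - 1) (p + q + 1)" "D y' \<in> Fil p (p + q)" "y = pr p (D y')"
    unfolding Bpage_def by blast
  then show "x - y \<in> Bpage r p q"
    unfolding Bpage_def by (auto intro!: exI[of _ "x' - y'"] subgrp_diff[OF subgrp_Fil] simp: D_diff pr_diff)
qed

lemma Zpage_Bi: "Zpage r p q \<subseteq> Bi p q"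
  using pr_Bi[of _ p "p + q" p] by (auto simp: Zpage_def)

text \<open>\<open>D w\<close> is a cycle of the total complex, so its leading term satisfies the
  condition of \<open>Zpage\<close> for every \<open>r'\<close>.\<close>

lemma Bpage_Zpage: "Bpage r p q \<subseteq> Zpage r' p q"
proof
  fix x assume "x \<in> Bpage r p q"
  then obtain w where "w \<in> Fil (p + int r - 1) (p + q + 1)" "D w \<in> Fil p (p + q)" "x = pr p (D w)"
    unfolding Bpage_def by blast
  then show "x \<in> Zpage r' p q"
    using subgrp_0[OF subgrp_Fil] by (auto simp: Zpage_def D_D_Fil intro!: exI[of _ "D w"])
qed

lemma Bpage_mono: "r \<le> r' \<Longrightarrow> Bpage r p q \<subseteq> Bpage r' p q"
  using Fil_mono[of "p + int r - 1" "p + int r' - 1" "p + q + 1"] by (fastforce simp: Bpage_def)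

lemma total_degree: "p - int r + (q + int r - 1) = p + q - 1"
  by simp

lemma drel_relation:
  assumes "1 \<le> r"
  shows "additive_relation (Zpage r p q) (Bpage r p q) (Zpage r (p - int r) (q + int r - 1))
    (Bpage r (p - int r) (q + int r - 1)) (drel r p q)"
proof
  fix z assume "z \<in> Zpage r p q"
  then obtain x where x: "x \<in> Fil p (p + q)" "D x \<in> Fil (p - int r) (p + q - 1)" "z = pr p x"
    unfolding Zpage_def by blast
  have "pr (p - int r) (D x) \<in> Zpage r (p - int r) (q + int r - 1)"
    unfolding Zpage_def total_degree using x subgrp_0[OF subgrp_Fil] by (intro CollectI exI[of _ "D x"]) (simp add: D_D_Fil)
  then show "\<exists>y\<in>Zpage r (p - int r) (q + int r - 1). drel r p q z y"
    unfolding drel_def using x by blast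
next
  fix z y z' y' assume "drel r p q z y" "drel r p q z' y'"
  then obtain x x' where "x \<in> Fil p (p + q)" "D x \<in> Fil (p - int r) (p + q - 1)" "z = pr p x"
    "y = pr (p - int r) (D x)" "x' \<in> Fil p (p + q)" "D x' \<in> Fil (p - int r) (p + q - 1)" "z' = pr p x'"
    "y' = pr (p - int r) (D x')"
    unfolding drel_def by blast
  then show "drel r p q (z - z') (y - y')"
    unfolding drel_def by (auto intro!: exI[of _ "x - x'"] subgrp_diff[OF subgrp_Fil] simp: D_diff pr_diff)
next
  fix z y assume "z \<in> Bpage r p q" "drel r p q z y"
  then obtain w x where w: "w \<in> Fil (p + int r - 1) (p + q + 1)" "D w \<in> Fil p (p + q)" "z = pr p (D w)"
    and x: "x \<in> Fil p (p + q)" "D x \<in> Fil (p - int r) (p + q - 1)" "z = pr p x" "y = pr (p - int r) (D x)"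
    unfolding drel_def Bpage_def by blast
  \<comment> \<open>Both lifts have the leading term z, so \<open>x - D w\<close> drops to
    \<open>Fil (p - 1)\<close> while its boundary is still that of x. It is the chain required by
    the target \<open>Bpage\<close>.\<close>
  have "x - D w \<in> Fil p (p + q)" by (rule subgrp_diff[OF subgrp_Fil x(1) w(2)])
  moreover have "pr p (x - D w) = 0" using w x by (simp add: pr_diff)
  ultimately have "x - D w \<in> Fil (p - 1) (p + q)" using pr_eq_0_iff by blast
  moreover have "D (x - D w) = D x" using w by (simp add: D_diff D_D_Fil)
  ultimately show "y \<in> Bpage r (p - int r) (q + int r - 1)"
    unfolding Bpage_def total_degree using x by (intro CollectI exI[of _ "x - D w"]) simp
qed (use assms in \<open>simp_all add: subgrp_Zpage subgrp_Bpage Bpage_Zpage\<close>)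

lemma pdiff_hom:
  "1 \<le> r \<Longrightarrow> pdiff r p q \<in> hom (page r p q) (page r (p - int r) (q + int r - 1))"
  unfolding pdiff_def page_def by (rule additive_relation.rel_map_hom[OF drel_relation])

lemma pdiff_coset:
  assumes "1 \<le> r" "x \<in> Fil p (p + q)" "D x \<in> Fil (p - int r) (p + q - 1)"
  shows "pdiff r p q (coset (Bpage r p q) (pr p x))
    = coset (Bpage r (p - int r) (q + int r - 1)) (pr (p - int r) (D x))"
  unfolding pdiff_def
  by (rule additive_relation.rel_map_coset[OF drel_relation[OF assms(1)]])
    (use assms in \<open>auto simp: drel_def\<close>)

lemma page_elem:
  assumes "X \<in> carrier (page r p q)"
  obtains x where "x \<in> Fil p (p + q)" "D x \<in> Fil (p - int r) (p + q - 1)" "X = coset (Bpage r p q) (pr p x)"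
  using assms by (auto simp: page_def Zpage_def)

text \<open>If the leading term of D x lies in \<open>Bpage\<close>, it is also that of D w for some
  w in \<open>Fil (p - 1)\<close>. Replacing x by x - w keeps the leading term of x and pushes the
  boundary down one more step of the filtration.\<close>

lemma pdiff_kernel:
  assumes r: "1 \<le> r"
  shows "kernel (page r p q) (page r (p - int r) (q + int r - 1)) (pdiff r p q)
    = coset (Bpage r p q) ` Zpage (Suc r) p q"
proof (intro equalityI subsetI)
  fix X assume "X \<in> kernel (page r p q) (page r (p - int r) (q + int r - 1)) (pdiff r p q)"
  then have X: "X \<in> carrier (page r p q)"
    and 0: "pdiff r p q X = Bpage r (p - int r) (q + int r - 1)"
    by (auto simp: kernel_def page_def)
  then obtain x where x: "x \<in> Fil p (p + q)" "D x \<in> Fil (p - int r) (p + q - 1)"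
    "X = coset (Bpage r p q) (pr p x)"
    using page_elem by blast
  have "pr (p - int r) (D x) \<in> Bpage r (p - int r) (q + int r - 1)"
    using 0 pdiff_coset[OF r x(1,2)] x(3) coset_eq_self_iff[OF subgrp_Bpage] by simp
  then obtain w where w: "w \<in> Fil (p - 1) (p + q)" "D w \<in> Fil (p - int r) (p + q - 1)"
    "pr (p - int r) (D x) = pr (p - int r) (D w)"
    by (auto simp: Bpage_def algebra_simps)
  have w': "w \<in> Fil p (p + q)" using Fil_mono[of "p - 1" p] w(1) by auto
  have "D (x - w) \<in> Fil (p - int r) (p + q - 1)" "pr (p - int r) (D (x - w)) = 0"
    using subgrp_diff[OF subgrp_Fil x(2) w(2)] w(3) by (simp_all add: D_diff pr_diff)
  then have "D (x - w) \<in> Fil (p - int (Suc r)) (p + q - 1)"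
    using pr_eq_0_iff by (fastforce simp: algebra_simps)
  moreover have "pr p x = pr p (x - w)" using pr_eq_0_iff[OF w'] w(1) by (simp add: pr_diff)
  ultimately have "pr p x \<in> Zpage (Suc r) p q"
    unfolding Zpage_def using subgrp_diff[OF subgrp_Fil x(1) w'] by blast
  then show "X \<in> coset (Bpage r p q) ` Zpage (Suc r) p q" using x by blast
next
  fix X assume "X \<in> coset (Bpage r p q) ` Zpage (Suc r) p q"
  then obtain x where x: "x \<in> Fil p (p + q)" "D x \<in> Fil (p - int (Suc r)) (p + q - 1)"
    "X = coset (Bpage r p q) (pr p x)"
    by (auto simp: Zpage_def)
  then have x': "D x \<in> Fil (p - int r) (p + q - 1)"
    using Fil_mono[of "p - int (Suc r)" "p - int r"] by auto
  have "pr (p - int r) (D x) = 0" by (rule pr_Fil_less[OF x(2)]) simp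
  then have "pdiff r p q X = \<one>\<^bsub>page r (p - int r) (q + int r - 1)\<^esub>"
    using pdiff_coset[OF r x(1) x'] x by (simp add: page_def)
  moreover have "X \<in> carrier (page r p q)"
    unfolding page_def using x x' by (auto simp: Zpage_def)
  ultimately show "X \<in> kernel (page r p q) (page r (p - int r) (q + int r - 1)) (pdiff r p q)"
    by (simp add: kernel_def)
qed

text \<open>For \<open>Suc r\<close>, the bound on w in \<open>Bpage\<close> is p + r, the column in
  which the differential arriving at (p, q) starts; so the same chain serves in both
  directions.\<close>

lemma pdiff_image:
  assumes r: "1 \<le> r"
  shows "pdiff r (p + int r) (q - int r + 1) ` carrier (page r (p + int r) (q - int r + 1))
    = coset (Bpage r p q) ` Bpage (Suc r) p q"
proof (intro equalityI subsetI)
  fix Y assume "Y \<in> pdiff r (p + int r) (q - int r + 1) ` carrier (page r (p + int r) (q - int r + 1))"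
  then obtain X where X: "X \<in> carrier (page r (p + int r) (q - int r + 1))"
    "Y = pdiff r (p + int r) (q - int r + 1) X" by blast
  obtain x where x: "x \<in> Fil (p + int r) (p + int r + (q - int r + 1))"
    "D x \<in> Fil (p + int r - int r) (p + int r + (q - int r + 1) - 1)"
    "X = coset (Bpage r (p + int r) (q - int r + 1)) (pr (p + int r) x)"
    using page_elem[OF X(1)] by blast
  have "Y = coset (Bpage r p q) (pr p (D x))"
    unfolding X x(3) using pdiff_coset[OF r x(1,2)] by (simp add: algebra_simps)
  then show "Y \<in> coset (Bpage r p q) ` Bpage (Suc r) p q"
    using x by (auto simp: Bpage_def algebra_simps intro!: imageI)
next
  fix Y assume "Y \<in> coset (Bpage r p q) ` Bpage (Suc r) p q"
  then obtain w where w: "w \<in> Fil (p + int r) (p + q + 1)" "D w \<in> Fil p (p + q)"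
    "Y = coset (Bpage r p q) (pr p (D w))" by (auto simp: Bpage_def)
  have x: "w \<in> Fil (p + int r) (p + int r + (q - int r + 1))"
    "D w \<in> Fil (p + int r - int r) (p + int r + (q - int r + 1) - 1)"
    using w by (simp_all add: algebra_simps)
  have "Y = pdiff r (p + int r) (q - int r + 1)
      (coset (Bpage r (p + int r) (q - int r + 1)) (pr (p + int r) w))"
    using pdiff_coset[OF r x] w(3) by (simp add: algebra_simps)
  moreover have "coset (Bpage r (p + int r) (q - int r + 1)) (pr (p + int r) w)
      \<in> carrier (page r (p + int r) (q - int r + 1))"
    using x by (auto simp: page_def Zpage_def)
  ultimately show "Y \<in> pdiff r (p + int r) (q - int r + 1) ` carrier (page r (p + int r) (q - int r + 1))"
    by blast
qed

lemma next_page_iso: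
  assumes r: "1 \<le> r"
  shows "Union \<in> iso (page_homology page pdiff r p q) (page (Suc r) p q)"
  unfolding page_homology_def pdiff_kernel[OF r] pdiff_image[OF r]
  unfolding page_def
  by (rule quot_quot_iso(1)) (simp_all add: subgrp_Bpage subgrp_Zpage Bpage_mono Bpage_Zpage)

lemma spectral_sequence: "homology_spectral_sequence page pdiff (\<lambda>_ _ _. Union)"
proof (rule homology_spectral_sequence.intro)
  fix r :: nat and p q :: int assume r: "1 \<le> r"
  show "comm_group (page r p q)"
    unfolding page_def by (rule comm_group_quot) (simp_all add: subgrp_Bpage subgrp_Zpage Bpage_Zpage)
  show "pdiff r p q \<in> hom (page r p q) (page r (p - int r) (q + int r - 1))"
    by (rule pdiff_hom[OF r])
  show "Union \<in> iso (page_homology page pdiff r p q) (page (Suc r) p q)"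
    by (rule next_page_iso[OF r])
  fix X assume "X \<in> carrier (page r p q)"
  then obtain x where x: "x \<in> Fil p (p + q)" "D x \<in> Fil (p - int r) (p + q - 1)"
    "X = coset (Bpage r p q) (pr p x)"
    using page_elem by blast
  have "pdiff r (p - int r) (q + int r - 1)
      (coset (Bpage r (p - int r) (q + int r - 1)) (pr (p - int r) (D x)))
      = coset (Bpage r (p - int r - int r) (q + int r - 1 + int r - 1)) (pr (p - int r - int r) (D (D x)))"
    by (rule pdiff_coset[OF r]; unfold total_degree) (use x subgrp_0[OF subgrp_Fil] in \<open>simp_all add: D_D_Fil\<close>)
  then show "pdiff r (p - int r) (q + int r - 1) (pdiff r p q X)
    = \<one>\<^bsub>page r (p - int r - int r) (q + int r - 1 + int r - 1)\<^esub>"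
    unfolding x(3) pdiff_coset[OF r x(1,2)] by (simp add: D_D_Fil[OF x(1)] page_def)
qed

section \<open>The first page and its differential\<close>

lemma Zpage_1: "Zpage 1 p q = {x \<in> Bi p q. frag_extend gv x = 0}"
proof (intro equalityI subsetI)
  fix z assume "z \<in> Zpage 1 p q"
  then obtain x where x: "x \<in> Fil p (p + q)" "D x \<in> Fil (p - 1) (p + q - 1)" "z = pr p x"
    by (auto simp: Zpage_def)
  then have "pr p (D x) = 0" using pr_Fil_less by fastforce
  then have "frag_extend gv z = 0" using pr_D[OF x(1)] x(3) by simp
  then show "z \<in> {x \<in> Bi p q. frag_extend gv x = 0}"
    using pr_Bi[OF x(1), of p] x(3) by simp
next
  fix z assume z: "z \<in> {x \<in> Bi p q. frag_extend gv x = 0}"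
  then have "D z \<in> Fil (p - 1) (p + q - 1)"
    using Bi_Fil[OF gh_Bi, of z p q] by (simp add: D_def algebra_simps)
  then show "z \<in> Zpage 1 p q"
    using z Bi_Fil[of z p q] pr_id[of z p q] by (auto simp: Zpage_def intro!: exI[of _ z])
qed

lemma Bpage_1: "Bpage 1 p q = frag_extend gv ` Bi p (q + 1)"
proof (intro equalityI subsetI)
  fix z assume "z \<in> Bpage 1 p q"
  then obtain w where w: "w \<in> Fil p (p + q + 1)" "z = pr p (D w)"
    by (auto simp: Bpage_def)
  then show "z \<in> frag_extend gv ` Bi p (q + 1)"
    using pr_D[OF w(1)] pr_Bi[OF w(1), of p] by (auto simp: algebra_simps)
next
  fix z assume "z \<in> frag_extend gv ` Bi p (q + 1)"
  then obtain w where w: "w \<in> Bi p (q + 1)" "z = frag_extend gv w" by blast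
  have F: "w \<in> Fil p (p + q + 1)" using Bi_Fil[OF w(1)] by (simp add: algebra_simps)
  have "z = pr p (D w)" using pr_D[OF F] pr_id[OF w(1)] w(2) by simp
  then show "z \<in> Bpage 1 p q" using F D_Fil[OF F] by (auto simp: Bpage_def)
qed

lemma pdiff_1:
  assumes "z \<in> Zpage 1 p q"
  shows "pdiff 1 p q (coset (Bpage 1 p q) z) = coset (Bpage 1 (p - 1) q) (frag_extend gh z)"
proof -
  have z: "z \<in> Bi p q" "frag_extend gv z = 0" using assms Zpage_1 by auto
  have D: "D z = frag_extend gh z" using z by (simp add: D_def)
  have F: "D z \<in> Fil (p - 1) (p + q - 1)" using Bi_Fil[OF gh_Bi[OF z(1)]] D by (simp add: algebra_simps)
  show ?thesis
    using pdiff_coset[of 1 z p q, OF _ Bi_Fil[OF z(1)]] F pr_id[OF z(1)] pr_id[OF gh_Bi[OF z(1)]]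
    by (simp add: D)
qed

text \<open>The limit may be any homology that f identifies with that of the total complex: the last
  four assumptions say that f induces an isomorphism. The filtration is transported along f inside
  the proof, so convergence need not be carried across an isomorphism afterwards.\<close>

lemma convergence:
  fixes f :: "('k \<Rightarrow>\<^sub>0 int) \<Rightarrow> 'h::ab_group_add" and ZZ BB :: "int \<Rightarrow> 'h set"
  assumes ZZ: "\<And>n. subgrp (ZZ n)" and BB: "\<And>n. subgrp (BB n)" and BZ: "\<And>n. BB n \<subseteq> ZZ n"
    and f_diff: "\<And>x y. f (x - y) = f x - f y"
    and f_cycle: "\<And>n x. x \<in> Tot n \<Longrightarrow> D x = 0 \<Longrightarrow> f x \<in> ZZ n"
    and f_boundary: "\<And>n x. x \<in> Tot (n + 1) \<Longrightarrow> f (D x) \<in> BB n"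
    and f_inj: "\<And>n x. x \<in> Tot n \<Longrightarrow> D x = 0 \<Longrightarrow> f x \<in> BB n \<Longrightarrow> \<exists>w\<in>Tot (n + 1). x = D w"
    and f_surj: "\<And>n z. z \<in> ZZ n \<Longrightarrow> \<exists>x\<in>Tot n. D x = 0 \<and> z - f x \<in> BB n"
  shows "converges_to page pdiff (\<lambda>n. quot (ZZ n) (BB n))"
proof -
  \<comment> \<open>The cycles whose class comes from a cycle in \<open>Fil p\<close>, that is, the
    preimage in \<open>ZZ n\<close> of the p-th step of the filtration of homology.\<close>
  define W where "W n p = {z \<in> ZZ n. \<exists>x\<in>Fil p n. D x = 0 \<and> z - f x \<in> BB n}" for n p
  have f_0 [simp]: "f 0 = 0" using f_diff[of 0 0] by simp
  have W_sub: "W n p \<subseteq> ZZ n" for n p by (auto simp: W_def)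
  have B_sub: "BB n \<subseteq> W n p" for n p
    using BZ[of n] subgrp_0[OF subgrp_Fil] by (auto simp: W_def intro!: bexI[of _ 0])
  have W: "subgrp (W n p)" for n p
    unfolding subgrp_def
  proof (intro conjI ballI)
    show "0 \<in> W n p" using B_sub subgrp_0[OF BB] by blast
    fix x y assume "x \<in> W n p" "y \<in> W n p"
    then obtain x' y' where "x \<in> ZZ n" "x' \<in> Fil p n" "D x' = 0" "x - f x' \<in> BB n"
      "y \<in> ZZ n" "y' \<in> Fil p n" "D y' = 0" "y - f y' \<in> BB n"
      unfolding W_def by blast
    then show "x - y \<in> W n p"
      using subgrp_diff[OF BB, of "x - f x'" n "y - f y'"]
      by (auto simp: W_def D_diff f_diff algebra_simps
          intro!: subgrp_diff[OF ZZ] bexI[of _ "x' - y'"] subgrp_diff[OF subgrp_Fil])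
  qed
  have W_mono: "p \<le> p' \<Longrightarrow> W n p \<subseteq> W n p'" for n p p'
    using Fil_mono[of p p' n] by (fastforce simp: W_def)
  have grp: "comm_group (quot (ZZ n) (BB n))" for n
    by (rule comm_group_quot[OF BB ZZ BZ])
  have sub: "subgroup (coset (BB n) ` W n p) (quot (ZZ n) (BB n))" for n p
  proof (rule group.subgroupI)
    show g: "group (quot (ZZ n) (BB n))" using grp comm_group.axioms(2) by blast
    show "coset (BB n) ` W n p \<subseteq> carrier (quot (ZZ n) (BB n))" using W_sub by auto
    show "coset (BB n) ` W n p \<noteq> {}" using B_sub subgrp_0[OF BB] by blast
    fix X assume "X \<in> coset (BB n) ` W n p"
    then obtain x where x: "x \<in> W n p" "X = coset (BB n) x" by blast
    have "coset (BB n) (- x) \<otimes>\<^bsub>quot (ZZ n) (BB n)\<^esub> X = \<one>\<^bsub>quot (ZZ n) (BB n)\<^esub>"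
      by (simp add: x mult_quot[OF BB])
    then have "inv\<^bsub>quot (ZZ n) (BB n)\<^esub> X = coset (BB n) (- x)"
      using x subsetD[OF W_sub x(1)] subgrp_minus[OF ZZ, of x n] by (intro group.inv_equality[OF g]) auto
    then show "inv\<^bsub>quot (ZZ n) (BB n)\<^esub> X \<in> coset (BB n) ` W n p"
      using subgrp_minus[OF W x(1)] by simp
    fix Y assume "Y \<in> coset (BB n) ` W n p"
    then show "X \<otimes>\<^bsub>quot (ZZ n) (BB n)\<^esub> Y \<in> coset (BB n) ` W n p"
      using x by (auto simp: mult_quot[OF BB] intro!: imageI subgrp_add[OF W])
  qed
  have mono: "coset (BB n) ` W n p \<subseteq> coset (BB n) ` W n (p + 1)" for n p
    by (intro image_mono W_mono) simp
  have bot: "coset (BB n) ` W n (-1) = {\<one>\<^bsub>quot (ZZ n) (BB n)\<^esub>}" for n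
  proof -
    have "W n (-1) = BB n" using B_sub[of n "-1"] by (auto simp: W_def Fil_neg)
    then show ?thesis
      using coset_eq_self_iff[OF BB] subgrp_0[OF BB] by fastforce
  qed
  have top: "coset (BB n) ` W n n = carrier (quot (ZZ n) (BB n))" for n
  proof -
    have "W n n = ZZ n" using f_surj[of _ n] by (auto simp: W_def Fil_eq_Tot)
    then show ?thesis by simp
  qed
  have stable: "\<exists>r0 \<ge> 1. \<forall>r \<ge> r0.
      (\<forall>x \<in> carrier (page r p q). pdiff r p q x = \<one>\<^bsub>page r (p - int r) (q + int r - 1)\<^esub>)
    \<and> (\<forall>x \<in> carrier (page r (p + int r) (q - int r + 1)).
         pdiff r (p + int r) (q - int r + 1) x = \<one>\<^bsub>page r p q\<^esub>)
    \<and> page r p q \<cong> (quot (ZZ (p + q)) (BB (p + q)))\<lparr>carrier := coset (BB (p + q)) ` W (p + q) p\<rparr>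
        Mod coset (BB (p + q)) ` W (p + q) (p - 1)" for p q
  \<comment> \<open>For p < r the outgoing differential ends in a negative column and
    \<open>Fil (p - r)\<close> is zero, so \<open>Zpage\<close> consists of leading terms of true
    cycles. For q + 2 \<le> r the incoming differential starts in a negative row and
    \<open>Fil (p + r - 1)\<close> is everything in degree p + q + 1, so \<open>Bpage\<close>
    consists of leading terms of all boundaries in \<open>Fil p\<close>.\<close>
  proof (intro exI[of _ "nat (max 1 (max (p + 1) (q + 2)))"] conjI allI impI)
    fix r assume "nat (max 1 (max (p + 1) (q + 2))) \<le> r"
    then have r: "1 \<le> r" "p < int r" "q + 2 \<le> int r" by simp_all
    show "\<forall>x \<in> carrier (page r p q). pdiff r p q x = \<one>\<^bsub>page r (p - int r) (q + int r - 1)\<^esub>"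
    proof
      fix X assume "X \<in> carrier (page r p q)"
      then have "pdiff r p q X \<in> carrier (page r (p - int r) (q + int r - 1))"
        using pdiff_hom[OF r(1)] by (auto simp: hom_def)
      moreover have "Zpage r (p - int r) (q + int r - 1) \<subseteq> {0}"
        using Zpage_Bi Bi_neg[of "p - int r" "q + int r - 1"] r by fastforce
      ultimately show "pdiff r p q X = \<one>\<^bsub>page r (p - int r) (q + int r - 1)\<^esub>"
        by (auto simp: page_def)
    qed
    show "\<forall>x \<in> carrier (page r (p + int r) (q - int r + 1)).
         pdiff r (p + int r) (q - int r + 1) x = \<one>\<^bsub>page r p q\<^esub>"
    proof
      fix X assume "X \<in> carrier (page r (p + int r) (q - int r + 1))"
      moreover have "Zpage r (p + int r) (q - int r + 1) \<subseteq> {0}"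
        using Zpage_Bi Bi_neg[of "p + int r" "q - int r + 1"] r by fastforce
      ultimately have X: "X = coset (Bpage r (p + int r) (q - int r + 1)) (pr (p + int r) 0)"
        by (auto simp: page_def)
      show "pdiff r (p + int r) (q - int r + 1) X = \<one>\<^bsub>page r p q\<^esub>"
        unfolding X using pdiff_coset[OF r(1), of 0 "p + int r" "q - int r + 1"]
        by (simp add: subgrp_0[OF subgrp_Fil] page_def algebra_simps)
    qed
    \<comment> \<open>A leading term is related to the cycles homologous to the image of a true
      cycle with that leading term. This induces the isomorphism from the stable page to the graded
      piece of the filtration.\<close>
    define R where "R x z \<longleftrightarrow> (\<exists>x'\<in>Fil p (p + q). D x' = 0 \<and> x = pr p x' \<and> z - f x' \<in> BB (p + q))" for x z
    have Z: "Zpage r p q = {pr p x |x. x \<in> Fil p (p + q) \<and> D x = 0}"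
      using r by (simp add: Zpage_def Fil_neg)
    have B: "Bpage r p q = {pr p (D w) |w. w \<in> Tot (p + q + 1) \<and> D w \<in> Fil p (p + q)}"
      using r by (simp add: Bpage_def Fil_eq_Tot)
    have Fil_T: "x \<in> Fil p' (p + q) \<Longrightarrow> x \<in> Tot (p + q)" for x p' using Fil_Tot by blast
    interpret R: additive_relation "Zpage r p q" "Bpage r p q" "W (p + q) p" "W (p + q) (p - 1)" R
    proof
      fix z assume "z \<in> Zpage r p q"
      then obtain x where x: "x \<in> Fil p (p + q)" "D x = 0" "z = pr p x" by (auto simp: Z)
      then have "f x \<in> W (p + q) p"
        using f_cycle[OF Fil_T] subgrp_0[OF BB] by (auto simp: W_def)
      then show "\<exists>y\<in>W (p + q) p. R z y"
        using x subgrp_0[OF BB] unfolding R_def by (intro bexI[of _ "f x"]) auto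
    next
      fix z y z' y' assume "R z y" "R z' y'"
      then obtain x x' where "x \<in> Fil p (p + q)" "D x = 0" "z = pr p x" "y - f x \<in> BB (p + q)"
         "x' \<in> Fil p (p + q)" "D x' = 0" "z' = pr p x'" "y' - f x' \<in> BB (p + q)"
        unfolding R_def by blast
      then show "R (z - z') (y - y')"
        using subgrp_diff[OF BB, of "y - f x" "p + q" "y' - f x'"]
        by (auto simp: R_def D_diff pr_diff f_diff algebra_simps
            intro!: bexI[of _ "x - x'"] subgrp_diff[OF subgrp_Fil])
    next
      fix z y assume "z \<in> Bpage r p q" "R z y"
      then obtain w x where w: "w \<in> Tot (p + q + 1)" "D w \<in> Fil p (p + q)" "z = pr p (D w)"
        and x: "x \<in> Fil p (p + q)" "D x = 0" "z = pr p x" "y - f x \<in> BB (p + q)"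
        unfolding R_def B by blast
      have "x - D w \<in> Fil p (p + q)" by (rule subgrp_diff[OF subgrp_Fil x(1) w(2)])
      moreover have "pr p (x - D w) = 0" using w x by (simp add: pr_diff)
      ultimately have 1: "x - D w \<in> Fil (p - 1) (p + q)" using pr_eq_0_iff by blast
      have 2: "D (x - D w) = 0" using w x by (simp add: D_diff D_D)
      have 3: "y - f (x - D w) \<in> BB (p + q)"
        using subgrp_add[OF BB x(4) f_boundary[OF w(1)]] by (simp add: f_diff algebra_simps)
      have "y \<in> ZZ (p + q)"
        using subgrp_add[OF ZZ _ f_cycle[OF Fil_T[OF x(1)] x(2)], of "y - f x"] BZ x(4) by auto
      with 1 2 3 show "y \<in> W (p + q) (p - 1)" by (auto simp: W_def)
    qed (simp_all add: subgrp_Zpage subgrp_Bpage Bpage_Zpage W W_mono)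
    have "rel_map R (W (p + q) (p - 1)) \<in> iso (quot (Zpage r p q) (Bpage r p q)) (quot (W (p + q) p) (W (p + q) (p - 1)))"
    proof (rule R.rel_map_iso)
      fix z y assume "R z y" "y \<in> W (p + q) (p - 1)"
      then obtain x x' where x: "x \<in> Fil p (p + q)" "D x = 0" "z = pr p x" "y - f x \<in> BB (p + q)"
        and x': "x' \<in> Fil (p - 1) (p + q)" "D x' = 0" "y - f x' \<in> BB (p + q)"
        unfolding R_def W_def by blast
      have x'': "x' \<in> Fil p (p + q)" using Fil_mono[of "p - 1" p] x'(1) by auto
      have F: "x - x' \<in> Fil p (p + q)" by (rule subgrp_diff[OF subgrp_Fil x(1) x''])
      have "f (x - x') \<in> BB (p + q)"
        using subgrp_diff[OF BB x'(3) x(4)] by (simp add: f_diff)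
      then obtain w where w: "w \<in> Tot (p + q + 1)" "x - x' = D w"
        using f_inj[OF Fil_T[OF F]] x x' by (auto simp: D_diff)
      have "z = pr p (x - x')" using pr_eq_0_iff[OF x''] x'(1) x(3) by (simp add: pr_diff)
      then show "z \<in> Bpage r p q" using w F by (auto simp: B)
    next
      fix y assume "y \<in> W (p + q) p"
      then obtain x where "x \<in> Fil p (p + q)" "D x = 0" "y - f x \<in> BB (p + q)" by (auto simp: W_def)
      then show "\<exists>z\<in>Zpage r p q. \<exists>y'. R z y' \<and> y - y' \<in> W (p + q) (p - 1)"
        using subgrp_0[OF W] unfolding Z R_def by (intro bexI[of _ "pr p x"] exI[of _ y]) auto
    qed
    then have "page r p q \<cong> quot (W (p + q) p) (W (p + q) (p - 1))"
      unfolding page_def is_iso_def by blast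
    moreover have "quot (W (p + q) p) (W (p + q) (p - 1)) \<cong>
        (quot (ZZ (p + q)) (BB (p + q)))\<lparr>carrier := coset (BB (p + q)) ` W (p + q) p\<rparr>
        Mod coset (BB (p + q)) ` W (p + q) (p - 1)"
      using quot_quot_iso(2)[OF BB W W B_sub W_mono, of "p - 1" p] unfolding is_iso_def by auto
    ultimately show "page r p q \<cong>
        (quot (ZZ (p + q)) (BB (p + q)))\<lparr>carrier := coset (BB (p + q)) ` W (p + q) p\<rparr>
        Mod coset (BB (p + q)) ` W (p + q) (p - 1)"
      by (rule iso_trans)
  qed simp
  show ?thesis
    unfolding converges_to_def
  proof (rule exI[of _ "\<lambda>n p. coset (BB n) ` W n p"], intro conjI allI)
    show "\<exists>a. coset (BB n) ` W n a = {\<one>\<^bsub>quot (ZZ n) (BB n)\<^esub>}" for n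
      using bot by blast
    show "\<exists>b. coset (BB n) ` W n b = carrier (quot (ZZ n) (BB n))" for n
      using top by blast
  qed (rule sub mono stable)+
qed

end

section \<open>Free resolutions over a category\<close>

definition fmap :: "('a \<Rightarrow> 'b) \<Rightarrow> ('a \<Rightarrow>\<^sub>0 int) \<Rightarrow> 'b \<Rightarrow>\<^sub>0 int" where
  "fmap f = frag_extend (\<lambda>x. frag_of (f x))"

lemma fmap_simps [simp]:
  "fmap f 0 = 0" "fmap f (frag_of v) = frag_of (f v)" "fmap f (x + y) = fmap f x + fmap f y"
  "fmap f (x - y) = fmap f x - fmap f y" "fmap f (- x) = - fmap f x"
  "fmap f (frag_cmul c x) = frag_cmul c (fmap f x)"
  by (simp_all add: fmap_def frag_extend_add frag_extend_diff frag_extend_minus frag_extend_cmul)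

lemma frag_ext_induct [case_names zero of diff]:
  assumes "P 0" "\<And>x. P (frag_of x)" "\<And>x y. P x \<Longrightarrow> P y \<Longrightarrow> P (x - y)"
  shows "P (z :: 'a \<Rightarrow>\<^sub>0 int)"
  using subset_UNIV[of "Poly_Mapping.keys z"] by (induction z rule: frag_induction) (auto intro: assms)

lemma frag_extend_fmap: "frag_extend g (fmap f z) = frag_extend (\<lambda>x. g (f x)) z"
  by (induction z rule: frag_ext_induct) (simp_all add: frag_extend_diff)

lemma fmap_fmap: "fmap g (fmap f z) = fmap (\<lambda>x. g (f x)) z"
  by (induction z rule: frag_ext_induct) simp_all

lemma frag_extend_frag_extend:
  "frag_extend g (frag_extend f z) = frag_extend (\<lambda>x. frag_extend g (f x)) z"
  by (induction z rule: frag_ext_induct) (simp_all add: frag_extend_diff)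

lemma keys_fmap: "Poly_Mapping.keys (fmap f z) \<subseteq> f ` Poly_Mapping.keys z"
  using keys_frag_extend[of "\<lambda>x. frag_of (f x)" z] by (auto simp: fmap_def keys_frag_of)

text \<open>The free left \<open>E\<close>-module on the set \<open>X\<close>, whose element \<open>x\<close> sits at the object \<open>R x\<close>: a basis of
  its value at \<open>u\<close> consists of the pairs \<open>(e, x)\<close>, standing for \<open>e \<cdot> x\<close>.\<close>

definition free_mod :: "'e cat \<Rightarrow> 's set \<Rightarrow> ('s \<Rightarrow> 'e) \<Rightarrow> 'e \<Rightarrow> ('e \<times> 's \<Rightarrow>\<^sub>0 int) set" where
  "free_mod E X R u = {z. Poly_Mapping.keys z \<subseteq> {(e, x). e \<in> mor E \<and> x \<in> X \<and> src E e = R x \<and> rng E e = u}}"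

definition act :: "'e cat \<Rightarrow> 'e \<Rightarrow> ('e \<times> 's \<Rightarrow>\<^sub>0 int) \<Rightarrow> ('e \<times> 's \<Rightarrow>\<^sub>0 int)" where
  "act E a = fmap (\<lambda>(e, x). (cmp E a e, x))"

text \<open>The linear extension to the free module of values given on its basis. It commutes with
  \<open>act\<close> when each \<open>\<phi> x\<close> sits at the object of x, see
  \<open>eqv_act\<close>.\<close>

definition eqv :: "'e cat \<Rightarrow> ('s \<Rightarrow> ('e \<times> 't \<Rightarrow>\<^sub>0 int)) \<Rightarrow> ('e \<times> 's \<Rightarrow>\<^sub>0 int) \<Rightarrow> ('e \<times> 't \<Rightarrow>\<^sub>0 int)" where
  "eqv E \<phi> = frag_extend (\<lambda>(e, x). act E e (\<phi> x))"

lemma act_simps [simp]: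
  "act E a 0 = 0" "act E a (x + y) = act E a x + act E a y" "act E a (x - y) = act E a x - act E a y"
  "act E a (- x) = - act E a x" "act E a (frag_cmul c x) = frag_cmul c (act E a x)"
  "act E a (frag_of (e, s)) = frag_of (cmp E a e, s)"
  by (simp_all add: act_def)

lemma eqv_simps [simp]:
  "eqv E \<phi> 0 = 0" "eqv E \<phi> (x + y) = eqv E \<phi> x + eqv E \<phi> y" "eqv E \<phi> (x - y) = eqv E \<phi> x - eqv E \<phi> y"
  "eqv E \<phi> (- x) = - eqv E \<phi> x" "eqv E \<phi> (frag_cmul c x) = frag_cmul c (eqv E \<phi> x)"
  "eqv E \<phi> (frag_of (e, s)) = act E e (\<phi> s)"
  by (simp_all add: eqv_def frag_extend_add frag_extend_diff frag_extend_minus frag_extend_cmul)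

lemma subgrp_free_mod: "subgrp (free_mod E X R u)"
  by (simp add: free_mod_def subgrp_keys)

lemmas free_mod_diff = subgrp_diff[OF subgrp_free_mod]
  and free_mod_add = subgrp_add[OF subgrp_free_mod]
  and free_mod_0 = subgrp_0[OF subgrp_free_mod]

lemma free_mod_induct [consumes 1, case_names zero of diff]:
  assumes "z \<in> free_mod E X R u" "P 0"
    and "\<And>e x. e \<in> mor E \<Longrightarrow> x \<in> X \<Longrightarrow> src E e = R x \<Longrightarrow> rng E e = u \<Longrightarrow> P (frag_of (e, x))"
    and "\<And>x y. P x \<Longrightarrow> P y \<Longrightarrow> P (x - y)"
  shows "P z"
proof -
  have "Poly_Mapping.keys z \<subseteq> {(e, x). e \<in> mor E \<and> x \<in> X \<and> src E e = R x \<and> rng E e = u}"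
    using assms(1) by (simp add: free_mod_def)
  then show ?thesis by (induction z rule: frag_induction) (auto intro: assms)
qed

lemma free_mod_of: "e \<in> mor E \<Longrightarrow> x \<in> X \<Longrightarrow> src E e = R x \<Longrightarrow> rng E e = u \<Longrightarrow> frag_of (e, x) \<in> free_mod E X R u"
  by (simp add: free_mod_def keys_frag_of)

lemma free_mod_cmul: "z \<in> free_mod E X R u \<Longrightarrow> frag_cmul c z \<in> free_mod E X R u"
  using keys_cmul[of c z] by (auto simp: free_mod_def)

context small_category
begin

lemma act_free_mod:
  assumes "z \<in> free_mod E X R (src E a)" "a \<in> mor E"
  shows "act E a z \<in> free_mod E X R (rng E a)"
  using assms(1)
  by (induction rule: free_mod_induct)
    (use assms(2) in \<open>auto intro!: free_mod_diff free_mod_0 free_mod_of simp: cmp_mor rng_cmp src_cmp\<close>)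

lemma act_act:
  assumes "z \<in> free_mod E X R (src E b)" "a \<in> mor E" "b \<in> mor E" "src E a = rng E b"
  shows "act E a (act E b z) = act E (cmp E a b) z"
  using assms(1) by (induction rule: free_mod_induct) (use assms in \<open>auto simp: cmp_assoc\<close>)

lemma act_obj: "z \<in> free_mod E X R u \<Longrightarrow> act E u z = z"
  by (induction rule: free_mod_induct) (auto simp: cmp_rng)

lemma eqv_free_mod:
  assumes "z \<in> free_mod E X R u" "\<And>x. x \<in> X \<Longrightarrow> \<phi> x \<in> free_mod E Y R' (R x)"
  shows "eqv E \<phi> z \<in> free_mod E Y R' u"
  using assms(1)
proof (induction rule: free_mod_induct)
  case (of e x)
  then show ?case using act_free_mod[of "\<phi> x" Y R' e] assms(2) by auto
qed (simp_all add: free_mod_0 free_mod_diff)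

lemma eqv_act:
  assumes "z \<in> free_mod E X R (src E a)" "a \<in> mor E" "\<And>x. x \<in> X \<Longrightarrow> \<phi> x \<in> free_mod E Y R' (R x)"
  shows "eqv E \<phi> (act E a z) = act E a (eqv E \<phi> z)"
  using assms(1)
proof (induction rule: free_mod_induct)
  case (of e x)
  then show ?case using act_act[of "\<phi> x" Y R' e a] assms(2,3) by auto
qed simp_all

lemma eqv_eqv:
  assumes "z \<in> free_mod E X R u" "\<And>x. x \<in> X \<Longrightarrow> \<phi> x \<in> free_mod E Y R' (R x)"
    "\<And>y. y \<in> Y \<Longrightarrow> \<psi> y \<in> free_mod E W R'' (R' y)"
  shows "eqv E \<psi> (eqv E \<phi> z) = eqv E (\<lambda>x. eqv E \<psi> (\<phi> x)) z"
  using assms(1)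
proof (induction rule: free_mod_induct)
  case (of e x)
  then show ?case using eqv_act[of "\<phi> x" Y R' e \<psi> W R''] assms(2,3) by auto
qed simp_all

lemma eqv_gen: "\<phi> x \<in> free_mod E Y R' (R x) \<Longrightarrow> eqv E \<phi> (frag_of (R x, x)) = \<phi> x"
  by (simp add: act_obj)

lemma eqv_unit: "z \<in> free_mod E X R u \<Longrightarrow> eqv E (\<lambda>x. frag_of (R x, x)) z = z"
proof (induction rule: free_mod_induct)
  case (of e x)
  then show ?case using cmp_src[of e] by simp
qed simp_all

end

lemma eqv_cong:
  assumes "z \<in> free_mod E X R u" "\<And>x. x \<in> X \<Longrightarrow> \<phi> x = \<psi> x"
  shows "eqv E \<phi> z = eqv E \<psi> z"
  using assms(1) by (induction rule: free_mod_induct) (use assms(2) in auto)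

lemma eqv_diff_fun: "eqv E (\<lambda>x. \<phi> x - \<psi> x) z = eqv E \<phi> z - eqv E \<psi> z"
  by (induction z rule: frag_ext_induct) (auto simp: algebra_simps)

lemma eqv_add_fun: "eqv E (\<lambda>x. \<phi> x + \<psi> x) z = eqv E \<phi> z + eqv E \<psi> z"
  by (induction z rule: frag_ext_induct) (auto simp: algebra_simps)

lemma eqv_zero_fun: "(\<And>x. x \<in> X \<Longrightarrow> \<phi> x = 0) \<Longrightarrow> z \<in> free_mod E X R u \<Longrightarrow> eqv E \<phi> z = 0"
  by (erule free_mod_induct) auto

text \<open>Passage to coinvariants: identifying e x with x in a free module leaves the free abelian
  group on the basis. By \<open>co_eqv\<close> equivariant maps descend.\<close>

definition co :: "('e \<times> 's \<Rightarrow>\<^sub>0 int) \<Rightarrow> ('s \<Rightarrow>\<^sub>0 int)" where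
  "co = fmap snd"

lemma co_act [simp]: "co (act E a z) = co z"
  by (induction z rule: frag_ext_induct) (auto simp: co_def)

lemma co_simps [simp]:
  "co 0 = 0" "co (x + y) = co x + co y" "co (x - y) = co x - co y" "co (- x) = - co x"
  "co (frag_cmul c x) = frag_cmul c (co x)" "co (frag_of (e, s)) = frag_of s"
  by (simp_all add: co_def)

lemma co_eqv: "co (eqv E \<phi> z) = frag_extend (\<lambda>x. co (\<phi> x)) (co z)"
  by (induction z rule: frag_ext_induct) (auto simp: frag_extend_diff)

lemma keys_co: "z \<in> free_mod E X R u \<Longrightarrow> Poly_Mapping.keys (co z) \<subseteq> X"
  using keys_fmap[of snd z] by (fastforce simp: co_def free_mod_def)

text \<open>The basis element \<open>x\<close> stands for \<open>(R x, x)\<close>, and \<open>bd x\<close> is its boundary; \<open>eqv E bd\<close> is the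
  differential. The homotopy \<open>H\<close> below is not equivariant, hence given on all pairs \<open>(e, x)\<close>.\<close>

locale free_precomplex = small_category E for E :: "'e cat" +
  fixes S :: "'s set" and deg :: "'s \<Rightarrow> nat" and R :: "'s \<Rightarrow> 'e" and bd :: "'s \<Rightarrow> ('e \<times> 's \<Rightarrow>\<^sub>0 int)"
  assumes R_objs: "x \<in> S \<Longrightarrow> R x \<in> objs E"
    and bd_0: "x \<in> S \<Longrightarrow> deg x = 0 \<Longrightarrow> bd x = 0"
    and bd_Suc: "x \<in> S \<Longrightarrow> deg x = Suc n \<Longrightarrow> bd x \<in> free_mod E {y \<in> S. deg y = n} R (R x)"
    and aug: "x \<in> S \<Longrightarrow> deg x = 1 \<Longrightarrow> fmap (\<lambda>_. ()) (bd x) = 0"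
begin

abbreviation basis :: "nat \<Rightarrow> 's set" where
  "basis n \<equiv> {x \<in> S. deg x = n}"

lemma bd_mod: "x \<in> S \<Longrightarrow> bd x \<in> free_mod E (basis (deg x - 1)) R (R x)"
  by (cases "deg x") (auto simp: bd_0 free_mod_0 intro: bd_Suc)

definition cbd :: "('s \<Rightarrow>\<^sub>0 int) \<Rightarrow> 's \<Rightarrow>\<^sub>0 int" where
  "cbd = frag_extend (\<lambda>x. co (bd x))"

definition chains :: "nat \<Rightarrow> ('s \<Rightarrow>\<^sub>0 int) set" where
  "chains n = {z. Poly_Mapping.keys z \<subseteq> basis n}"

lemma cbd_simps [simp]: "cbd (- x) = - cbd x" "cbd (x - y) = cbd x - cbd y" "cbd (x + y) = cbd x + cbd y" "cbd 0 = 0"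
  by (simp_all add: cbd_def frag_extend_diff frag_extend_add frag_extend_minus)

end

locale free_complex = free_precomplex +
  assumes bd_bd: "x \<in> S \<Longrightarrow> eqv E bd (bd x) = 0"

text \<open>An augmented complex with a contraction onto the trivial module, before dd = 0 is known.
  At each object \<open>pt u\<close> is the only generator of degree 0, so the augmentation is the
  sum of the coefficients and the trivial module is embedded by (u, pt u).\<close>

locale free_preresolution = free_precomplex +
  fixes H :: "'a \<times> 'b \<Rightarrow> ('a \<times> 'b \<Rightarrow>\<^sub>0 int)" and pt :: "'a \<Rightarrow> 'b"
  assumes H_mod: "e \<in> mor E \<Longrightarrow> x \<in> S \<Longrightarrow> src E e = R x
      \<Longrightarrow> H (e, x) \<in> free_mod E {y \<in> S. deg y = Suc (deg x)} R (rng E e)"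
    and pt: "u \<in> objs E \<Longrightarrow> pt u \<in> S \<and> deg (pt u) = 0 \<and> R (pt u) = u"
    and deg_0_pt: "x \<in> S \<Longrightarrow> deg x = 0 \<Longrightarrow> x = pt (R x)"
    and contr_0: "e \<in> mor E \<Longrightarrow> x \<in> S \<Longrightarrow> src E e = R x \<Longrightarrow> deg x = 0
      \<Longrightarrow> eqv E bd (H (e, x)) = frag_of (e, x) - frag_of (rng E e, pt (rng E e))"
    and contr_Suc: "e \<in> mor E \<Longrightarrow> x \<in> S \<Longrightarrow> src E e = R x \<Longrightarrow> deg x = Suc n
      \<Longrightarrow> eqv E bd (H (e, x)) + frag_extend H (act E e (bd x)) = frag_of (e, x)"
begin

lemma h_mod: "z \<in> free_mod E (basis n) R u \<Longrightarrow> frag_extend H z \<in> free_mod E (basis (Suc n)) R u"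
proof (induction rule: free_mod_induct)
  case (of e x)
  then show ?case using H_mod[of e x] by simp
qed (simp_all add: free_mod_0 frag_extend_diff free_mod_diff)

lemma h_contr_0:
  "z \<in> free_mod E (basis 0) R u \<Longrightarrow> eqv E bd (frag_extend H z) = z - fmap (\<lambda>_. (u, pt u)) z"
  by (induction rule: free_mod_induct) (simp_all add: frag_extend_diff contr_0)

lemma h_contr_Suc:
  "z \<in> free_mod E (basis (Suc n)) R u \<Longrightarrow> eqv E bd (frag_extend H z) + frag_extend H (eqv E bd z) = z"
proof (induction rule: free_mod_induct)
  case (diff x y)
  have "eqv E bd (frag_extend H (x - y)) + frag_extend H (eqv E bd (x - y))
    = (eqv E bd (frag_extend H x) + frag_extend H (eqv E bd x))
      - (eqv E bd (frag_extend H y) + frag_extend H (eqv E bd y))"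
    by (simp add: frag_extend_diff)
  then show ?case by (simp only: diff)
qed (simp_all add: contr_Suc)

text \<open>As \<open>\<partial>H = 1 - \<eta>\<epsilon> - H\<partial>\<close>, the square \<open>\<partial>\<partial>\<close> vanishes on \<open>H z\<close> once it vanishes on \<open>z\<close>. This replaces
  the verification of the simplicial identities by an induction on the length of tuples.\<close>

lemma bd_bd_H:
  assumes e: "e \<in> mor E" and y: "y \<in> S" and s: "src E e = R y" and dd: "eqv E bd (bd y) = 0"
  shows "eqv E bd (eqv E bd (H (e, y))) = 0"
proof (cases "deg y")
  case 0
  then show ?thesis
    using contr_0[OF e y s 0] bd_0[OF y 0] pt[OF rng_objs[OF e]] bd_0[of "pt (rng E e)"] by simp
next
  case (Suc n)
  have b: "bd y \<in> free_mod E (basis n) R (src E e)" using bd_Suc[OF y Suc] s by simp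
  define w where "w = act E e (bd y)"
  have w: "w \<in> free_mod E (basis n) R (rng E e)" unfolding w_def by (rule act_free_mod[OF b e])
  have "eqv E bd (H (e, y)) = frag_of (e, y) - frag_extend H w"
    using contr_Suc[OF e y s Suc] by (simp add: w_def algebra_simps)
  \<comment> \<open>What remains is w minus the boundary of H w, which the homotopy identity at w
    evaluates. It vanishes because w has augmentation zero if n = 0, and boundary zero
    otherwise.\<close>
  then have *: "eqv E bd (eqv E bd (H (e, y))) = w - eqv E bd (frag_extend H w)"
    by (simp add: w_def)
  show ?thesis
  proof (cases n)
    case 0
    have "fmap (\<lambda>_. (rng E e, pt (rng E e))) w = fmap (\<lambda>_. (rng E e, pt (rng E e))) (fmap (\<lambda>_. ()) (bd y))"
      by (simp add: w_def act_def fmap_fmap)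
    also have "\<dots> = 0" using aug[OF y] Suc 0 by simp
    finally show ?thesis using * h_contr_0 w 0 by simp
  next
    case (Suc m)
    have "eqv E bd w = act E e (eqv E bd (bd y))"
      unfolding w_def by (rule eqv_act[OF b e]) (use Suc in \<open>auto intro: bd_Suc\<close>)
    then show ?thesis using * h_contr_Suc[of w m] w Suc dd by simp
  qed
qed

end

section \<open>Comparison of free resolutions\<close>

locale free_resolution = free_preresolution E S deg R bd H pt + free_complex E S deg R bd
  for E :: "'e cat" and S :: "'s set" and deg R bd H pt

text \<open>The asymmetry of the comparison theorem: the source contributes freeness, the target its
  contraction.\<close>

locale complex_to_resolution =
  A: free_complex E S deg R bd + B: free_resolution E S' deg' R' bd' H' pt'
  for E :: "'e cat" and S :: "'s set" and deg R bd and S' :: "'t set" and deg' R' bd' H' pt'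
begin

text \<open>The prescribed values in degree 0 say that the map covers the identity of the trivial
  module. This is what makes any two such maps homotopic.\<close>

definition chain_map :: "('s \<Rightarrow> ('e \<times> 't \<Rightarrow>\<^sub>0 int)) \<Rightarrow> bool" where
  "chain_map \<phi> \<longleftrightarrow> (\<forall>x\<in>S. \<phi> x \<in> free_mod E (B.basis (deg x)) R' (R x) \<and> eqv E bd' (\<phi> x) = eqv E \<phi> (bd x))
     \<and> (\<forall>x\<in>S. deg x = 0 \<longrightarrow> \<phi> x = frag_of (R x, pt' (R x)))"

text \<open>For a cycle z of positive degree, or of augmentation zero in degree 0,
  \<open>frag_extend H' z\<close> is an explicit solution y of bd' y = z. So the usual inductive
  lifting needs no choices.\<close>

primrec lift :: "nat \<Rightarrow> 's \<Rightarrow> ('e \<times> 't \<Rightarrow>\<^sub>0 int)" where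
  "lift 0 x = frag_of (R x, pt' (R x))"
| "lift (Suc n) x = frag_extend H' (eqv E (lift n) (bd x))"

lemma lift_mod: "x \<in> A.basis n \<Longrightarrow> lift n x \<in> free_mod E (B.basis n) R' (R x)"
proof (induction n arbitrary: x)
  case 0
  then show ?case
    using A.R_objs[of x] B.pt[of "R x"] by (auto intro!: free_mod_of simp: objs_def)
next
  case (Suc n)
  then show ?case
    using A.eqv_free_mod[OF A.bd_Suc[of x n] Suc.IH] by (auto intro!: B.h_mod)
qed

lemma lift_chain: "x \<in> A.basis (Suc n) \<Longrightarrow> eqv E bd' (lift (Suc n) x) = eqv E (lift n) (bd x)"
proof (induction n arbitrary: x)
  case 0
  have m: "bd x \<in> free_mod E (A.basis 0) R (R x)" using A.bd_Suc[of x 0] 0 by simp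
  \<comment> \<open>\<open>lift 0\<close> preserves sums of coefficients, so the correction term of
    \<open>h_contr_0\<close> is controlled by the augmentation of the source.\<close>
  have "fmap (\<lambda>_. c) (eqv E (lift 0) z) = fmap (\<lambda>_. c) z" if "z \<in> free_mod E (A.basis 0) R u"
    for c :: "'e \<times> 't" and z u
    using that by (induction rule: free_mod_induct) auto
  then have "fmap (\<lambda>_. (R x, pt' (R x))) (eqv E (lift 0) (bd x)) = fmap (\<lambda>_. (R x, pt' (R x))) (bd x)"
    using m by blast
  also have "\<dots> = fmap (\<lambda>_. (R x, pt' (R x))) (fmap (\<lambda>_. ()) (bd x))"
    by (simp add: fmap_fmap)
  also have "\<dots> = 0" using A.aug[of x] 0 by simp
  finally have 1: "fmap (\<lambda>_. (R x, pt' (R x))) (eqv E (lift 0) (bd x)) = 0" .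
  show ?case
    using B.h_contr_0[OF A.eqv_free_mod[OF m lift_mod]] 1 by (simp del: lift.simps add: lift.simps(2))
next
  case (Suc n)
  have m: "bd x \<in> free_mod E (A.basis (Suc n)) R (R x)" using A.bd_Suc[of x "Suc n"] Suc.prems by simp
  have "eqv E bd' (eqv E (lift (Suc n)) (bd x)) = eqv E (\<lambda>y. eqv E bd' (lift (Suc n) y)) (bd x)"
    by (rule A.eqv_eqv[OF m lift_mod, where W = "B.basis n" and R'' = R'])
      (use B.bd_Suc in auto)
  also have "\<dots> = eqv E (\<lambda>y. eqv E (lift n) (bd y)) (bd x)"
    by (rule eqv_cong[OF m Suc.IH])
  also have "\<dots> = eqv E (lift n) (eqv E bd (bd x))"
    by (rule A.eqv_eqv[symmetric, OF m _ lift_mod]) (use A.bd_Suc in auto)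
  also have "\<dots> = 0" using A.bd_bd Suc.prems by simp
  finally have "eqv E bd' (eqv E (lift (Suc n)) (bd x)) = 0" .
  then show ?case
    using B.h_contr_Suc[OF A.eqv_free_mod[OF m lift_mod[of _ "Suc n"]]]
    by (simp del: lift.simps add: lift.simps(2)[of "Suc n"])
qed

lemma chain_map_exists: "\<exists>\<phi>. chain_map \<phi>"
proof (intro exI)
  have "eqv E bd' (lift (deg x) x) = eqv E (\<lambda>x. lift (deg x) x) (bd x)" if x: "x \<in> S" for x
  proof (cases "deg x")
    case 0
    then show ?thesis
      using x B.pt[OF A.R_objs[OF x]] B.bd_0[of "pt' (R x)"] by (simp add: A.bd_0)
  next
    case (Suc n)
    then have m: "bd x \<in> free_mod E (A.basis n) R (R x)" using A.bd_Suc x by blast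
    have "eqv E (\<lambda>x. lift (deg x) x) (bd x) = eqv E (lift n) (bd x)"
      by (rule eqv_cong[OF m]) simp
    then show ?thesis using lift_chain[of x n] x Suc by simp
  qed
  then show "chain_map (\<lambda>x. lift (deg x) x)"
    unfolding chain_map_def using lift_mod by auto
qed

lemma chain_homotopy:
  assumes "chain_map \<phi>" "chain_map \<psi>"
  shows "\<exists>K. \<forall>x\<in>S. K x \<in> free_mod E (B.basis (Suc (deg x))) R' (R x)
      \<and> eqv E bd' (K x) + eqv E K (bd x) = \<phi> x - \<psi> x"
proof -
  \<comment> \<open>Both maps agree in degree 0, so the homotopy starts with zero. In the next
    degree it applies the contraction to the error that is left, which \<open>main\<close> shows to
    be a cycle.\<close>
  define K where "K = rec_nat (\<lambda>x. 0) (\<lambda>n k x. frag_extend H' (\<phi> x - \<psi> x - eqv E k (bd x)))"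
  have K: "K 0 x = 0" "K (Suc n) x = frag_extend H' (\<phi> x - \<psi> x - eqv E (K n) (bd x))" for n x
    by (simp_all add: K_def)
  have \<phi>: "\<phi> x \<in> free_mod E (B.basis (deg x)) R' (R x)" "eqv E bd' (\<phi> x) = eqv E \<phi> (bd x)"
    and \<psi>: "\<psi> x \<in> free_mod E (B.basis (deg x)) R' (R x)" "eqv E bd' (\<psi> x) = eqv E \<psi> (bd x)"
    if "x \<in> S" for x using assms that by (auto simp: chain_map_def)
  have w_mod: "\<phi> x - \<psi> x - eqv E (K n) (bd x) \<in> free_mod E (B.basis (Suc n)) R' (R x)"
    if "x \<in> A.basis (Suc n)" "\<And>y. y \<in> A.basis n \<Longrightarrow> K n y \<in> free_mod E (B.basis (Suc n)) R' (R y)" for n x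
    using that \<phi>(1)[of x] \<psi>(1)[of x] A.eqv_free_mod[OF A.bd_Suc that(2)]
    by (auto intro!: free_mod_diff)
  have K_mod: "K n x \<in> free_mod E (B.basis (Suc n)) R' (R x)" if "x \<in> A.basis n" for n x
    using that
  proof (induction n arbitrary: x)
    case (Suc n)
    show ?case unfolding K by (rule B.h_mod[OF w_mod[OF Suc.prems Suc.IH]])
  qed (simp add: K free_mod_0)
  \<comment> \<open>At n = 0 the value of \<open>n - 1\<close> is harmless, because
    \<open>bd x\<close> is zero there.\<close>
  have main: "eqv E bd' (K n x) + eqv E (K (n - 1)) (bd x) = \<phi> x - \<psi> x" if "x \<in> A.basis n" for n x
    using that
  proof (induction n arbitrary: x)
    case 0
    then show ?case using assms by (auto simp: K A.bd_0 free_mod_0 chain_map_def)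
  next
    case (Suc n)
    then have x: "x \<in> S" "deg x = Suc n" by auto
    have m: "bd x \<in> free_mod E (A.basis n) R (R x)" using A.bd_Suc x by blast
    have IH: "\<And>y. y \<in> A.basis n \<Longrightarrow> eqv E bd' (K n y) = \<phi> y - \<psi> y - eqv E (K (n - 1)) (bd y)"
      using Suc.IH by (auto simp: algebra_simps)
    define w where "w = \<phi> x - \<psi> x - eqv E (K n) (bd x)"
    have w: "w \<in> free_mod E (B.basis (Suc n)) R' (R x)"
      unfolding w_def by (rule w_mod[OF Suc.prems K_mod])
    have "eqv E bd' (eqv E (K n) (bd x)) = eqv E (\<lambda>y. eqv E bd' (K n y)) (bd x)"
      by (rule A.eqv_eqv[OF m K_mod, where W = "B.basis n" and R'' = R']) (use B.bd_Suc in auto)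
    also have "\<dots> = eqv E (\<lambda>y. \<phi> y - \<psi> y - eqv E (K (n - 1)) (bd y)) (bd x)"
      by (rule eqv_cong[OF m IH])
    also have "\<dots> = eqv E \<phi> (bd x) - eqv E \<psi> (bd x) - eqv E (\<lambda>y. eqv E (K (n - 1)) (bd y)) (bd x)"
      by (simp add: eqv_diff_fun)
    also have "eqv E (\<lambda>y. eqv E (K (n - 1)) (bd y)) (bd x) = 0"
    proof (cases n)
      case 0
      show ?thesis by (rule eqv_zero_fun[OF _ m]) (simp add: A.bd_0 0)
    next
      case (Suc k)
      have "eqv E (K k) (eqv E bd (bd x)) = eqv E (\<lambda>y. eqv E (K k) (bd y)) (bd x)"
        by (rule A.eqv_eqv[OF m _ K_mod]) (use A.bd_Suc Suc in auto)
      then show ?thesis using A.bd_bd x Suc by simp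
    qed
    finally have "eqv E bd' w = 0"
      using \<phi>(2)[OF x(1)] \<psi>(2)[OF x(1)] by (simp add: w_def)
    then have "eqv E bd' (K (Suc n) x) = w"
      using B.h_contr_Suc[OF w] by (simp add: K w_def)
    then show ?case by (simp add: w_def)
  qed
  have "eqv E (\<lambda>x. K (deg x) x) (bd x) = eqv E (K (deg x - 1)) (bd x)" if "x \<in> S" for x
    by (rule eqv_cong[OF A.bd_mod[OF that]]) simp
  then show ?thesis
    using main K_mod by (intro exI[of _ "\<lambda>x. K (deg x) x"]) auto
qed

end

section \<open>Homotopy equivalence of the coinvariants\<close>

locale two_resolutions =
  A: free_resolution E S deg R bd H pt + B: free_resolution E S' deg' R' bd' H' pt'
  for E :: "'e cat" and S :: "'s set" and deg R bd H pt and S' :: "'t set" and deg' R' bd' H' pt'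
begin

sublocale AA: complex_to_resolution E S deg R bd S deg R bd H pt ..
sublocale AB: complex_to_resolution E S deg R bd S' deg' R' bd' H' pt' ..

lemma chain_map_id: "AA.chain_map (\<lambda>x. frag_of (R x, x))"
  unfolding AA.chain_map_def
proof (intro conjI ballI impI)
  fix x assume x: "x \<in> S"
  show "frag_of (R x, x) \<in> free_mod E (A.basis (deg x)) R (R x)"
    using x A.R_objs[OF x] by (auto intro!: free_mod_of simp: objs_def)
  show "eqv E bd (frag_of (R x, x)) = eqv E (\<lambda>x. frag_of (R x, x)) (bd x)"
    using A.eqv_gen[where \<phi> = bd and x = x] A.bd_mod[OF x] A.eqv_unit by metis
  show "frag_of (R x, x) = frag_of (R x, pt (R x))" if "deg x = 0"
    using A.deg_0_pt[OF x that] by simp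
qed

lemma chain_map_comp:
  assumes \<phi>: "AB.chain_map \<phi>" and \<psi>: "complex_to_resolution.chain_map E S' deg' R' bd' S deg R bd pt \<psi>"
  shows "AA.chain_map (\<lambda>x. eqv E \<psi> (\<phi> x))"
proof -
  interpret BA: complex_to_resolution E S' deg' R' bd' S deg R bd H pt ..
  have f: "\<phi> x \<in> free_mod E (B.basis (deg x)) R' (R x)" "eqv E bd' (\<phi> x) = eqv E \<phi> (bd x)"
    "deg x = 0 \<Longrightarrow> \<phi> x = frag_of (R x, pt' (R x))"
    if "x \<in> S" for x using assms that by (auto simp: AB.chain_map_def)
  have g: "\<psi> x \<in> free_mod E (A.basis (deg' x)) R (R' x)" "eqv E bd (\<psi> x) = eqv E \<psi> (bd' x)"
    "deg' x = 0 \<Longrightarrow> \<psi> x = frag_of (R' x, pt (R' x))"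
    if "x \<in> S'" for x using assms that by (auto simp: BA.chain_map_def)
  have f1: "\<phi> x \<in> free_mod E (B.basis n) R' (R x)" if "x \<in> A.basis n" for x n
    using f(1)[of x] that by auto
  have g1: "\<psi> x \<in> free_mod E (A.basis n) R (R' x)" if "x \<in> B.basis n" for x n
    using g(1)[of x] that by auto
  have A1: "bd x \<in> free_mod E (A.basis (n - 1)) R (R x)" if "x \<in> A.basis n" for x n
    using A.bd_mod[of x] that by auto
  have B1: "bd' x \<in> free_mod E (B.basis (n - 1)) R' (R' x)" if "x \<in> B.basis n" for x n
    using B.bd_mod[of x] that by auto
  show ?thesis
    unfolding AA.chain_map_def
  proof (intro conjI ballI impI)
    fix x assume x: "x \<in> S"
    show "eqv E \<psi> (\<phi> x) \<in> free_mod E (A.basis (deg x)) R (R x)"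
      by (rule A.eqv_free_mod[OF f(1)[OF x]]) (rule g1)
    have "eqv E bd (eqv E \<psi> (\<phi> x)) = eqv E (\<lambda>y. eqv E bd (\<psi> y)) (\<phi> x)"
      by (rule A.eqv_eqv[OF f(1)[OF x], where Y = "A.basis (deg x)" and R' = R
            and W = "A.basis (deg x - 1)" and R'' = R]) (rule g1 A1; assumption)+
    also have "\<dots> = eqv E (\<lambda>y. eqv E \<psi> (bd' y)) (\<phi> x)"
      by (rule eqv_cong[OF f(1)[OF x]]) (use g(2) in auto)
    also have "\<dots> = eqv E \<psi> (eqv E bd' (\<phi> x))"
      by (rule A.eqv_eqv[symmetric, OF f(1)[OF x], where Y = "B.basis (deg x - 1)" and R' = R'
            and W = "A.basis (deg x - 1)" and R'' = R]) (rule g1 B1; assumption)+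
    also have "\<dots> = eqv E \<psi> (eqv E \<phi> (bd x))" using f(2)[OF x] by simp
    also have "\<dots> = eqv E (\<lambda>x. eqv E \<psi> (\<phi> x)) (bd x)"
      by (rule A.eqv_eqv[OF A.bd_mod[OF x], where Y = "B.basis (deg x - 1)" and R' = R'
            and W = "A.basis (deg x - 1)" and R'' = R]) (rule g1 f1; assumption)+
    finally show "eqv E bd (eqv E \<psi> (\<phi> x)) = eqv E (\<lambda>x. eqv E \<psi> (\<phi> x)) (bd x)" .
    assume "deg x = 0"
    then show "eqv E \<psi> (\<phi> x) = frag_of (R x, pt (R x))"
      using f(3)[OF x] B.pt[OF A.R_objs[OF x]] g(3)[of "pt' (R x)"] A.R_objs[OF x]
        A.cmp_rng[of "R x"] by (auto simp: objs_def)
  qed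
qed

text \<open>The homotopy from the composite to the identity is the equivariant extension of values
  on the basis, so applying \<open>co\<close> to its defining identity gives a homotopy of the
  coinvariants.\<close>

lemma homotopy_coinvariants:
  assumes \<phi>: "AB.chain_map \<phi>" and \<psi>: "complex_to_resolution.chain_map E S' deg' R' bd' S deg R bd pt \<psi>"
  obtains k where "\<And>n z. z \<in> A.chains n \<Longrightarrow> frag_extend k z \<in> A.chains (Suc n)"
    "\<And>n z. z \<in> A.chains n \<Longrightarrow> A.cbd (frag_extend k z) + frag_extend k (A.cbd z)
       = frag_extend (\<lambda>x. co (\<psi> x)) (frag_extend (\<lambda>x. co (\<phi> x)) z) - z"
proof -
  obtain K where K: "\<And>x. x \<in> S \<Longrightarrow> K x \<in> free_mod E (A.basis (Suc (deg x))) R (R x)"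
    "\<And>x. x \<in> S \<Longrightarrow> eqv E bd (K x) + eqv E K (bd x) = eqv E \<psi> (\<phi> x) - frag_of (R x, x)"
    using AA.chain_homotopy[OF chain_map_comp[OF assms] chain_map_id] by blast
  show thesis
  proof (rule that[of "\<lambda>x. co (K x)"])
    fix n z assume z: "z \<in> A.chains n"
    show "frag_extend (\<lambda>x. co (K x)) z \<in> A.chains (Suc n)"
      unfolding A.chains_def mem_Collect_eq
    proof (rule keys_frag_extend_subset[of _ "A.basis n"])
      show "Poly_Mapping.keys (co (K x)) \<subseteq> A.basis (Suc n)" if "x \<in> A.basis n" for x
        using keys_co[OF K(1)[of x]] that by auto
    qed (use z in \<open>simp add: A.chains_def\<close>)
    from z have "Poly_Mapping.keys z \<subseteq> S" by (auto simp: A.chains_def)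
    then show "A.cbd (frag_extend (\<lambda>x. co (K x)) z) + frag_extend (\<lambda>x. co (K x)) (A.cbd z)
       = frag_extend (\<lambda>x. co (\<psi> x)) (frag_extend (\<lambda>x. co (\<phi> x)) z) - z"
    proof (induction rule: frag_induction)
      case (one x)
      have "co (eqv E bd (K x) + eqv E K (bd x)) = co (eqv E \<psi> (\<phi> x) - frag_of (R x, x))"
        using K(2)[OF one] by simp
      then show ?case by (simp add: A.cbd_def co_eqv)
    next
      case (diff a b)
      have "u + v = x - a \<Longrightarrow> u' + v' = y - b \<Longrightarrow> u - u' + (v - v') = x - y - (a - b)"
        for u v x y u' v' :: "'s \<Rightarrow>\<^sub>0 int"
      proof -
        assume *: "u + v = x - a" "u' + v' = y - b"
        have "u - u' + (v - v') = (u + v) - (u' + v')" by simp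
        also have "\<dots> = x - y - (a - b)" unfolding * by simp
        finally show ?thesis .
      qed
      from this[OF diff] show ?case by (simp add: frag_extend_diff)
    qed simp
  qed
qed

lemma co_chain_map:
  assumes "AB.chain_map \<phi>"
  shows "z \<in> A.chains n \<Longrightarrow> frag_extend (\<lambda>x. co (\<phi> x)) z \<in> B.chains n"
    and "z \<in> A.chains n \<Longrightarrow> B.cbd (frag_extend (\<lambda>x. co (\<phi> x)) z) = frag_extend (\<lambda>x. co (\<phi> x)) (A.cbd z)"
proof -
  assume z: "z \<in> A.chains n"
  have *: "\<phi> x \<in> free_mod E (B.basis (deg x)) R' (R x)" "eqv E bd' (\<phi> x) = eqv E \<phi> (bd x)"
    if "x \<in> S" for x using assms that by (auto simp: AB.chain_map_def)
  show "frag_extend (\<lambda>x. co (\<phi> x)) z \<in> B.chains n"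
    unfolding B.chains_def mem_Collect_eq
  proof (rule keys_frag_extend_subset[of _ "A.basis n"])
    show "Poly_Mapping.keys (co (\<phi> x)) \<subseteq> B.basis n" if "x \<in> A.basis n" for x
      using keys_co[OF *(1)[of x]] that by auto
  qed (use z in \<open>simp add: A.chains_def\<close>)
  from z have "Poly_Mapping.keys z \<subseteq> S" by (auto simp: A.chains_def)
  then show "B.cbd (frag_extend (\<lambda>x. co (\<phi> x)) z) = frag_extend (\<lambda>x. co (\<phi> x)) (A.cbd z)"
  proof (induction rule: frag_induction)
    case (one x)
    then show ?case using arg_cong[OF *(2)[OF one], of co] by (simp add: A.cbd_def B.cbd_def co_eqv)
  qed (simp_all add: frag_extend_diff A.cbd_def B.cbd_def)
qed

end

sublocale two_resolutions \<subseteq> swap: two_resolutions E S' deg' R' bd' H' pt' S deg R bd H pt ..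

context two_resolutions
begin

text \<open>The isomorphism in homology is spelled out with chains, cycles and boundaries because
  \<open>convergence\<close> takes it in this form. A homotopy inverse from the opposite comparison
  yields the last two clauses.\<close>

lemma coinvariants_comparison:
  obtains f where "\<And>n z. z \<in> A.chains n \<Longrightarrow> frag_extend f z \<in> B.chains n"
    "\<And>n z. z \<in> A.chains n \<Longrightarrow> B.cbd (frag_extend f z) = frag_extend f (A.cbd z)"
    "\<And>n z w. z \<in> A.chains n \<Longrightarrow> A.cbd z = 0 \<Longrightarrow> w \<in> B.chains (Suc n) \<Longrightarrow> frag_extend f z = B.cbd w
      \<Longrightarrow> \<exists>w'\<in>A.chains (Suc n). z = A.cbd w'"
    "\<And>n z. z \<in> B.chains n \<Longrightarrow> B.cbd z = 0
      \<Longrightarrow> \<exists>x\<in>A.chains n. A.cbd x = 0 \<and> (\<exists>w\<in>B.chains (Suc n). z - frag_extend f x = B.cbd w)"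
proof -
  obtain \<phi> where \<phi>: "AB.chain_map \<phi>" using AB.chain_map_exists by blast
  obtain \<psi> where \<psi>: "swap.AB.chain_map \<psi>" using swap.AB.chain_map_exists by blast
  note f = co_chain_map[OF \<phi>] and g = swap.co_chain_map[OF \<psi>]
  let ?f = "frag_extend (\<lambda>x. co (\<phi> x))" and ?g = "frag_extend (\<lambda>x. co (\<psi> x))"
  obtain k where k: "\<And>n z. z \<in> A.chains n \<Longrightarrow> frag_extend k z \<in> A.chains (Suc n)"
    "\<And>n z. z \<in> A.chains n \<Longrightarrow> A.cbd (frag_extend k z) + frag_extend k (A.cbd z) = ?g (?f z) - z"
    using homotopy_coinvariants[OF \<phi> \<psi>] by blast
  obtain k' where k': "\<And>n z. z \<in> B.chains n \<Longrightarrow> frag_extend k' z \<in> B.chains (Suc n)"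
    "\<And>n z. z \<in> B.chains n \<Longrightarrow> B.cbd (frag_extend k' z) + frag_extend k' (B.cbd z) = ?f (?g z) - z"
    using swap.homotopy_coinvariants[OF \<psi> \<phi>] by blast
  have A: "subgrp (A.chains n)" for n by (simp add: A.chains_def subgrp_keys)
  have B: "subgrp (B.chains n)" for n by (simp add: B.chains_def subgrp_keys)
  show thesis
  proof (rule that[OF f])
    fix n z w assume z: "z \<in> A.chains n" "A.cbd z = 0" "w \<in> B.chains (Suc n)" "?f z = B.cbd w"
    have "z = A.cbd (?g w - frag_extend k z)"
      using k(2)[OF z(1)] g(2)[OF z(3)] z(2,4) by (simp add: algebra_simps)
    then show "\<exists>w'\<in>A.chains (Suc n). z = A.cbd w'"
      using subgrp_diff[OF A g(1)[OF z(3)] k(1)[OF z(1)]] by blast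
  next
    fix n z assume z: "z \<in> B.chains n" "B.cbd z = 0"
    have "A.cbd (?g z) = 0" using g(2)[OF z(1)] z(2) by simp
    moreover have "z - ?f (?g z) = B.cbd (0 - frag_extend k' z)"
      using k'(2)[OF z(1)] z(2) by (simp add: algebra_simps)
    ultimately show "\<exists>x\<in>A.chains n. A.cbd x = 0 \<and> (\<exists>w\<in>B.chains (Suc n). z - ?f x = B.cbd w)"
      using g(1)[OF z(1)] subgrp_diff[OF B subgrp_0[OF B] k'(1)[OF z(1)]] by blast
  qed
qed

end

section \<open>The bar resolution\<close>

lemma frag_cmul_minus: "frag_cmul (- c) x = - frag_cmul c x"
  by simp

lemma fmap_sum: "finite I \<Longrightarrow> fmap f (\<Sum>i\<in>I. g i) = (\<Sum>i\<in>I. fmap f (g i))"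
  by (induction I rule: finite_induct) simp_all

lemma act_fmap: "act E a (fmap (\<lambda>x. (f x, g x)) z) = fmap (\<lambda>x. (cmp E a (f x), g x)) z"
  by (simp add: act_def fmap_fmap)

lemma co_fmap: "co (fmap (\<lambda>x. (f x, g x)) z) = fmap g z"
  by (simp add: co_def fmap_fmap)

text \<open>The inner faces, with signs, are common to all boundaries in the proof. Their recursion
  along the list, in \<open>inner_simps\<close>, replaces calculations with indices.\<close>

definition inner :: "'e cat \<Rightarrow> 'e list \<Rightarrow> ('e list \<Rightarrow>\<^sub>0 int)" where
  "inner E es = (\<Sum>i = 1..<length es. frag_cmul ((-1) ^ i) (frag_of (contract E i es)))"

lemma inner_simps [simp]:
  "inner E [] = 0" "inner E [e] = 0"
  "inner E (e # e' # es) = - frag_of (cmp E e e' # es) - fmap (Cons e) (inner E (e' # es))"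
proof -
  have 1: "contract E (Suc i) (e # l) = e # contract E i l" if "1 \<le> i" for i l
    using that by (cases i) (auto simp: contract_def)
  have "inner E (e # e' # es) = (\<Sum>i = 1..<Suc (length (e' # es)). frag_cmul ((-1) ^ i) (frag_of (contract E i (e # e' # es))))"
    by (simp add: inner_def)
  also have "\<dots> = frag_cmul ((-1) ^ 1) (frag_of (contract E 1 (e # e' # es)))
    + (\<Sum>i = Suc 1..<Suc (length (e' # es)). frag_cmul ((-1) ^ i) (frag_of (contract E i (e # e' # es))))"
    by (rule sum.atLeast_Suc_lessThan) simp
  also have "(\<Sum>i = Suc 1..<Suc (length (e' # es)). frag_cmul ((-1) ^ i) (frag_of (contract E i (e # e' # es))))
     = (\<Sum>i = 1..<length (e' # es). frag_cmul ((-1) ^ Suc i) (frag_of (contract E (Suc i) (e # e' # es))))"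
    by (rule sum.shift_bounds_Suc_ivl)
  also have "\<dots> = (\<Sum>i = 1..<length (e' # es). - fmap (Cons e) (frag_cmul ((-1) ^ i) (frag_of (contract E i (e' # es)))))"
    by (rule sum.cong) (simp_all add: 1)
  also have "\<dots> = - fmap (Cons e) (inner E (e' # es))"
    unfolding inner_def by (simp only: sum_negf fmap_sum finite_atLeastLessThan)
  finally show "inner E (e # e' # es) = - frag_of (cmp E e e' # es) - fmap (Cons e) (inner E (e' # es))"
    by (simp add: contract_def)
qed (simp_all add: inner_def)

lemma fmap_inner:
  "fmap f (inner E es) = (\<Sum>i = 1..<length es. frag_cmul ((-1) ^ i) (frag_of (f (contract E i es))))"
  by (simp add: inner_def fmap_sum)

lemma objsD: "u \<in> objs E \<Longrightarrow> u \<in> mor E" "u \<in> objs E \<Longrightarrow> rng E u = u" "u \<in> objs E \<Longrightarrow> src E u = u"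
  by (simp_all add: objs_def)

context small_category
begin

lemma path_objs: "path E u es v \<Longrightarrow> u \<in> objs E"
  by (cases es) (auto simp: rng_objs)

lemma path_butlast: "path E u es v \<Longrightarrow> es \<noteq> [] \<Longrightarrow> path E u (butlast es) (rng E (last es)) \<and> last es \<in> mor E \<and> src E (last es) = v"
proof (induction es arbitrary: u)
  case (Cons e es)
  then show ?case by (cases es) (auto simp: rng_objs)
qed simp

lemma keys_inner:
  "path E u es v \<Longrightarrow> Poly_Mapping.keys (inner E es) \<subseteq> {l. path E u l v \<and> Suc (length l) = length es}"
proof (induction es arbitrary: u)
  case (Cons e es)
  show ?case
  proof (cases es)
    case (Cons e' es')
    have e: "e \<in> mor E" "rng E e = u" "path E (src E e) es v" using Cons.prems by auto
    have e': "e' \<in> mor E" "rng E e' = src E e" using e(3) Cons by auto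
    have "Poly_Mapping.keys (fmap (Cons e) (inner E es)) \<subseteq> Cons e ` Poly_Mapping.keys (inner E es)"
      by (rule keys_fmap)
    also have "\<dots> \<subseteq> {l. path E u l v \<and> Suc (length l) = length (e # es)}"
      using Cons.IH[OF e(3)] e by auto
    finally have "fmap (Cons e) (inner E es) \<in> {z. Poly_Mapping.keys z \<subseteq> {l. path E u l v \<and> Suc (length l) = length (e # es)}}"
      by simp
    moreover have "frag_of (cmp E e e' # es') \<in> {z. Poly_Mapping.keys z \<subseteq> {l. path E u l v \<and> Suc (length l) = length (e # es)}}"
      using e e' Cons by (auto simp: keys_frag_of cmp_mor rng_cmp src_cmp)
    ultimately have "- frag_of (cmp E e e' # es') - fmap (Cons e) (inner E es)
        \<in> {z. Poly_Mapping.keys z \<subseteq> {l. path E u l v \<and> Suc (length l) = length (e # es)}}"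
      by (intro subgrp_diff[OF subgrp_keys] subgrp_minus[OF subgrp_keys])
    then show ?thesis using Cons by simp
  qed simp
qed simp

section \<open>The bar complex of a category and its contraction\<close>

definition bar :: "('a \<times> 'a list) set" where
  "bar = {(u, es). \<exists>v. path E u es v}"

definition bar_deg :: "'a \<times> 'a list \<Rightarrow> nat" where
  "bar_deg = (\<lambda>(u, es). length es)"

text \<open>The first face does not drop the first entry but turns it into the coefficient; under
  \<open>co\<close> this becomes the first face of \<open>cat_boundary\<close>.\<close>

definition bar_bd :: "'a \<times> 'a list \<Rightarrow> ('a \<times> ('a \<times> 'a list) \<Rightarrow>\<^sub>0 int)" where
  "bar_bd = (\<lambda>(u, es). if es = [] then 0
     else frag_of (hd es, (src E (hd es), tl es)) + fmap (\<lambda>l. (u, (u, l))) (inner E es)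
        + frag_cmul ((-1) ^ length es) (frag_of (u, (u, butlast es))))"

text \<open>The extra degeneracy: the coefficient becomes the first entry and leaves an identity
  behind.\<close>

definition bar_H :: "'a \<times> ('a \<times> 'a list) \<Rightarrow> ('a \<times> ('a \<times> 'a list) \<Rightarrow>\<^sub>0 int)" where
  "bar_H = (\<lambda>(e, (u, es)). frag_of (rng E e, (rng E e, e # es)))"

lemma bar_H_fmap: "frag_extend bar_H z = fmap (\<lambda>(e, (u, es)). (rng E e, (rng E e, e # es))) z"
  unfolding fmap_def bar_H_def by (rule frag_extend_eq) auto

lemma free_mod_fmap:
  assumes "Poly_Mapping.keys z \<subseteq> A"
    "\<And>l. l \<in> A \<Longrightarrow> a \<in> mor E \<and> f l \<in> X \<and> src E a = R (f l) \<and> rng E a = u"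
  shows "fmap (\<lambda>l. (a, f l)) z \<in> free_mod E X R u"
  using keys_fmap[of "\<lambda>l. (a, f l)" z] assms unfolding free_mod_def by fastforce

text \<open>The first face of [e, es] returns e [es]. The other faces cancel against the degeneracy
  applied to e times the boundary of [es], except that for empty es the last face remains and is the
  point over the range of e.\<close>

lemma bar_preresolution: "free_preresolution E bar bar_deg fst bar_bd bar_H (\<lambda>u. (u, []))"
proof unfold_locales
  fix x assume x: "x \<in> bar"
  obtain u es where [simp]: "x = (u, es)" by (cases x)
  then obtain v where p: "path E u es v" using x by (auto simp: bar_def)
  show u: "fst x \<in> objs E" using path_objs[OF p] by simp
  show "bar_deg x = 0 \<Longrightarrow> bar_bd x = 0" by (simp add: bar_bd_def bar_deg_def)
  show "bar_deg x = 0 \<Longrightarrow> x = (fst x, [])" by (simp add: bar_deg_def)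
  show "bar_bd x \<in> free_mod E {y \<in> bar. bar_deg y = n} fst (fst x)" if n: "bar_deg x = Suc n" for n
  proof -
    obtain e es' where es [simp]: "es = e # es'" and n: "n = length es'" using n by (cases es) (auto simp: bar_deg_def)
    have "frag_of (e, (src E e, es')) \<in> free_mod E {y \<in> bar. bar_deg y = n} fst u"
      using p n by (auto intro!: free_mod_of simp: bar_def bar_deg_def)
    moreover have "frag_of (u, (u, butlast es)) \<in> free_mod E {y \<in> bar. bar_deg y = n} fst u"
      using path_butlast[OF p] n u by (auto intro!: free_mod_of simp: bar_def bar_deg_def objsD)
    moreover have "fmap (\<lambda>l. (u, (u, l))) (inner E es) \<in> free_mod E {y \<in> bar. bar_deg y = n} fst u"
      using u n by (intro free_mod_fmap[OF keys_inner[OF p]]) (auto simp: bar_def bar_deg_def objsD)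
    ultimately have "frag_of (e, (src E e, es')) + fmap (\<lambda>l. (u, (u, l))) (inner E es)
        + frag_cmul ((-1) ^ length es) (frag_of (u, (u, butlast es))) \<in> free_mod E {y \<in> bar. bar_deg y = n} fst u"
      by (intro free_mod_add free_mod_cmul)
    then show ?thesis by (simp add: bar_bd_def)
  qed
  show "fmap (\<lambda>_. ()) (bar_bd x) = 0" if n: "bar_deg x = 1"
    using n by (cases es) (auto simp: bar_deg_def bar_bd_def)
  fix e assume e: "e \<in> mor E" "src E e = fst x"
  have eu [simp]: "src E e = u" "cmp E e u = e" using e cmp_src[OF e(1)] by auto
  show "bar_H (e, x) \<in> free_mod E {y \<in> bar. bar_deg y = Suc (bar_deg x)} fst (rng E e)"
    using e p rng_objs[OF e(1)] by (auto simp: bar_H_def bar_def bar_deg_def objsD intro!: free_mod_of)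
  note r [simp] = cmp_rng[OF e(1)] objsD[OF rng_objs[OF e(1)]] cmp_rng[OF objsD(1)[OF rng_objs[OF e(1)]], simplified]
  show "eqv E bar_bd (bar_H (e, x)) = frag_of (e, x) - frag_of (rng E e, rng E e, [])" if "bar_deg x = 0"
    using that by (simp add: bar_deg_def bar_H_def bar_bd_def)
  show "eqv E bar_bd (bar_H (e, x)) + frag_extend bar_H (act E e (bar_bd x)) = frag_of (e, x)"
    if n: "bar_deg x = Suc n" for n
  proof -
    obtain e1 es' where es [simp]: "es = e1 # es'" using n by (cases es) (auto simp: bar_deg_def)
    have [simp]: "rng E (cmp E e e1) = rng E e" using p e rng_cmp by auto
    show ?thesis
      unfolding bar_H_fmap
      by (simp add: bar_bd_def bar_H_def act_fmap fmap_fmap frag_cmul_minus del: minus_frag_cmul)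
  qed
next
  fix u assume "u \<in> objs E"
  then have "path E u [] u" by simp
  then show "(u, []) \<in> bar \<and> bar_deg (u, []) = 0 \<and> fst (u, []) = u"
    unfolding bar_def bar_deg_def by auto
qed

text \<open>Each nonempty generator is the degeneracy of a shorter one with coefficient its first
  entry, so \<open>bd_bd_H\<close> drives an induction on the length.\<close>

lemma bar_resolution: "free_resolution E bar bar_deg fst bar_bd bar_H (\<lambda>u. (u, []))"
proof -
  interpret free_preresolution E bar bar_deg fst bar_bd bar_H "\<lambda>u. (u, [])"
    by (rule bar_preresolution)
  have "eqv E bar_bd (bar_bd (u, es)) = 0" if "path E u es v" for u es v
    using that
  proof (induction es arbitrary: u)
    case (Cons e es)
    then have e: "e \<in> mor E" "rng E e = u" "path E (src E e) es v" by auto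
    have b: "(src E e, es) \<in> bar" "(u, e # es) \<in> bar" using e(3) Cons.prems by (auto simp: bar_def)
    have "eqv E bar_bd (bar_H (e, (src E e, es))) = bar_bd (u, e # es)"
      using e(2) act_obj[OF bd_mod[OF b(2)]] by (simp add: bar_H_def)
    then show ?case
      using bd_bd_H[OF e(1) b(1) _ Cons.IH[OF e(3)]] by simp
  qed (simp add: bar_bd_def)
  then show ?thesis
    by unfold_locales (auto simp: bar_def)
qed

lemma cat_boundary_bar: "cat_boundary E = frag_extend (\<lambda>x. co (bar_bd x))"
proof -
  have "(\<lambda>(u, es). if es = [] then 0
     else frag_of (src E (hd es), tl es)
        + (\<Sum>i = 1..<length es. frag_cmul ((-1) ^ i) (frag_of (u, contract E i es)))
        + frag_cmul ((-1) ^ length es) (frag_of (u, butlast es))) = (\<lambda>x. co (bar_bd x))"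
    by (auto simp: bar_bd_def co_fmap fun_eq_iff) (simp_all add: fmap_inner)
  then show ?thesis by (simp add: cat_boundary_def)
qed

lemma tuples_bar: "tuples E n = {x \<in> bar. int (bar_deg x) = n}"
  by (auto simp: tuples_def bar_def bar_deg_def)

end

section \<open>The matched resolution\<close>

lemma fmap_cong_keys:
  assumes "Poly_Mapping.keys z \<subseteq> A" "\<And>x. x \<in> A \<Longrightarrow> f x = g x"
  shows "fmap f z = fmap g z"
  unfolding fmap_def by (rule frag_extend_eq) (use assms in auto)

context matched_pair
begin

section \<open>The product category\<close>

abbreviation E :: "('a \<times> 'a) cat" where
  "E \<equiv> matched_product C D lact ract"

lemma E_simps [simp]:
  "(d, c) \<in> mor E \<longleftrightarrow> d \<in> mor D \<and> c \<in> mor C \<and> src D d = rng C c"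
  "rng E (d, c) = (rng D d, rng D d)"
  "src E (d, c) = (src C c, src C c)"
  "cmp E (d1, c1) (d2, c2) = (cmp D d1 (lact c1 d2), cmp C (ract c1 d2) c2)"
  by (simp_all add: matched_product_def)

lemma obj:
  assumes "u \<in> objs D"
  shows "u \<in> mor C" "u \<in> mor D" "rng C u = u" "src C u = u" "rng D u = u" "src D u = u" "u \<in> objs C"
  using assms same_objs by (auto simp: objs_def)

lemmas obj_C = C.rng_objs[unfolded same_objs] C.src_objs[unfolded same_objs]

lemma objs_E: "(u, v) \<in> objs E \<longleftrightarrow> u = v \<and> u \<in> objs D"
proof
  assume "(u, v) \<in> objs E"
  then have "u = v" "v \<in> mor C" "src C v = u"
    unfolding objs_def[of E] by auto
  then show "u = v \<and> u \<in> objs D" using obj_C(2)[of v] by simp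
next
  assume "u = v \<and> u \<in> objs D"
  then show "(u, v) \<in> objs E"
    unfolding objs_def[of E] using obj[of v] by auto
qed

lemma lact_obj: "d \<in> mor D \<Longrightarrow> u = rng D d \<Longrightarrow> lact u d = d"
  and ract_obj: "d \<in> mor D \<Longrightarrow> u = rng D d \<Longrightarrow> ract u d = src D d"
  and lact_obj': "c \<in> mor C \<Longrightarrow> u = src C c \<Longrightarrow> lact c u = rng C c"
  and ract_obj': "c \<in> mor C \<Longrightarrow> u = src C c \<Longrightarrow> ract c u = c"
  by (simp_all add: lact_unit ract_rng lact_src ract_unit)

lemma small_category_E: "small_category E"
proof
  fix x y z :: "'a \<times> 'a"
  obtain d1 c1 d2 c2 d3 c3 where [simp]: "x = (d1, c1)" "y = (d2, c2)" "z = (d3, c3)"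
    by (cases x, cases y, cases z)
  show "x \<in> mor E \<Longrightarrow> rng E x \<in> objs E"
    by (simp add: objs_E D.rng_objs)
  show "x \<in> mor E \<Longrightarrow> src E x \<in> objs E"
    by (simp add: objs_E obj_C)
  assume x: "x \<in> mor E"
  have r: "rng D d1 \<in> objs D" "src C c1 \<in> objs D" "src D d1 \<in> objs D"
    using x by (auto simp: D.rng_objs obj_C D.src_objs)
  show "cmp E (rng E x) x = x"
    using x r[THEN obj(3)] C.cmp_rng by (simp add: lact_obj ract_obj D.cmp_rng)
  show "cmp E x (src E x) = x"
    using x D.cmp_src[of d1] by (simp add: lact_obj' ract_obj' C.cmp_src)
  assume y: "y \<in> mor E" and xy: "src E x = rng E y"
  note m = lact_mor ract_mor rng_lact src_ract D.cmp_mor C.cmp_mor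
    D.rng_cmp C.rng_cmp D.src_cmp C.src_cmp
  show "cmp E x y \<in> mor E" "rng E (cmp E x y) = rng E x" "src E (cmp E x y) = src E y"
    using x y xy by (simp_all add: m src_lact_rng_ract[symmetric])
  assume z: "z \<in> mor E" and yz: "src E y = rng E z"
  show "cmp E (cmp E x y) z = cmp E x (cmp E y z)"
    using x y z xy yz
    by (simp add: m lact_cmp lact_distrib ract_distrib ract_cmp D.cmp_assoc C.cmp_assoc
        src_lact_rng_ract[symmetric])
qed

sublocale E: small_category E
  by (rule small_category_E)

lemma cmp_E_C:
  assumes "(a, b) \<in> mor E" "c \<in> mor C" "src C b = rng C c"
  shows "cmp E (a, b) (rng C c, c) = (a, cmp C b c)"
  using assms D.cmp_src[of a] by (simp add: lact_obj' ract_obj')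

lemma cmp_E_D:
  assumes "(a, b) \<in> mor E" "d \<in> mor D" "src C b = rng D d" "s = src D d"
  shows "cmp E (a, b) (d, s) = (cmp D a (lact b d), ract b d)"
  using assms C.cmp_src[of "ract b d"] by (simp add: ract_mor src_ract)

lemma cmp_E_obj:
  assumes "(a, b) \<in> mor E" "u = src C b"
  shows "cmp E (a, b) (u, u) = (a, b)"
  using assms E.cmp_src[of "(a, b)"] by simp

section \<open>The actions on tuples\<close>

abbreviation L_tuple :: "'a \<Rightarrow> 'a list \<Rightarrow> 'a list" where
  "L_tuple \<equiv> lact_tuple C D lact ract"

abbreviation R_tuple :: "'a list \<Rightarrow> 'a \<Rightarrow> 'a list" where
  "R_tuple \<equiv> ract_tuple C D lact ract"

text \<open>\<open>lact_tuple\<close> composes prefixes from the left, starting at an identity. A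
  recursion on the tuple needs the first factor pulled out.\<close>

lemma foldl_cmp:
  "a \<in> mor D \<Longrightarrow> path D (src D a) xs w \<Longrightarrow> foldl (cmp D) a xs \<in> mor D \<and> rng D (foldl (cmp D) a xs) = rng D a
    \<and> src D (foldl (cmp D) a xs) = w \<and> foldl (cmp D) a xs = cmp D a (foldl (cmp D) (src D a) xs)"
proof (induction xs arbitrary: a)
  case (Cons x xs)
  then have x: "x \<in> mor D" "rng D x = src D a" "path D (src D x) xs w" by auto
  note IH1 = Cons.IH[OF x(1,3)]
  have p: "path D (src D (cmp D a x)) xs w" using x Cons.prems by (simp add: D.src_cmp)
  note IH2 = Cons.IH[OF _ p]
  have "cmp D (src D a) x = x" using D.cmp_rng[OF x(1)] x by simp
  moreover have "foldl (cmp D) (src D x) xs \<in> mor D \<and> rng D (foldl (cmp D) (src D x) xs) = src D x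
      \<and> src D (foldl (cmp D) (src D x) xs) = w"
    using Cons.IH[of "src D x"] x D.src_objs[OF x(1)] by (auto simp: objsD)
  ultimately show ?case
    using IH1 IH2 x Cons.prems by (simp add: D.cmp_mor D.rng_cmp D.src_cmp D.cmp_assoc)
qed (auto simp: D.cmp_src)

lemma path_take: "path D u ds w \<Longrightarrow> \<exists>w'. path D u (take j ds) w'"
proof (induction ds arbitrary: u j)
  case (Cons d ds)
  then have "d \<in> mor D" "rng D d = u" "\<exists>w'. path D (src D d) (take (j - 1) ds) w'" by auto
  then show ?case using D.rng_objs by (cases j) auto
qed auto

lemma L_tuple_Nil [simp]: "L_tuple c [] = []"
  by (simp add: lact_tuple_def)

lemma length_L_tuple [simp]: "length (L_tuple c ds) = length ds"
  by (simp add: lact_tuple_def)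

text \<open>By \<open>ract_cmp\<close>, acting on c by a prefix is acting by its first entry and
  then by the rest. This recursion replaces the closed formula in the inductions that
  follow.\<close>

lemma L_tuple_Cons:
  assumes c: "c \<in> mor C" and p: "path D (src C c) (d # ds) w"
  shows "L_tuple c (d # ds) = lact c d # L_tuple (ract c d) ds"
proof -
  have d: "d \<in> mor D" "rng D d = src C c" "path D (src D d) ds w" using p by auto
  have "ract c (foldl (cmp D) (src C c) (take (Suc j) (d # ds)))
     = ract (ract c d) (foldl (cmp D) (src C (ract c d)) (take j ds))" for j
  proof -
    obtain w' where w': "path D (src D d) (take j ds) w'" using path_take[OF d(3)] by blast
    have 1: "foldl (cmp D) d (take j ds) = cmp D d (foldl (cmp D) (src D d) (take j ds))"
      using foldl_cmp[OF d(1) w'] by blast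
    have o: "src D d \<in> mor D" "src D (src D d) = src D d" "rng D (src D d) = src D d"
      using D.src_objs[OF d(1)] by (auto simp: objs_def)
    have "foldl (cmp D) (src D d) (take j ds) \<in> mor D \<and> rng D (foldl (cmp D) (src D d) (take j ds)) = src D d"
      using foldl_cmp[OF o(1)] w' o by simp
    then show ?thesis
      using 1 d c D.cmp_rng[OF d(1)] by (simp add: ract_cmp src_ract)
  qed
  then show ?thesis
    using c by (simp add: lact_tuple_def ract_unit upt_rec[of 0] map_Suc_upt[symmetric] del: upt_Suc)
qed

lemma L_tuple_path:
  "c \<in> mor C \<Longrightarrow> path D (src C c) ds w \<Longrightarrow> \<exists>w'. path D (rng C c) (L_tuple c ds) w'"
proof (induction ds arbitrary: c)
  case Nil
  then show ?case using obj_C by auto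
next
  case (Cons d ds)
  then have d: "d \<in> mor D" "src C c = rng D d" "path D (src D d) ds w" by auto
  show ?case
    using Cons.IH[of "ract c d"] d Cons.prems(1)
    by (simp add: L_tuple_Cons[OF Cons.prems] ract_mor src_ract lact_mor rng_lact src_lact_rng_ract)
qed

lemma L_tuple_cmp:
  "b \<in> mor C \<Longrightarrow> c \<in> mor C \<Longrightarrow> src C b = rng C c \<Longrightarrow> path D (src C c) ds w \<Longrightarrow> L_tuple (cmp C b c) ds = L_tuple b (L_tuple c ds)"
proof (induction ds arbitrary: b c)
  case (Cons d ds)
  then have d: "d \<in> mor D" "src C c = rng D d" "path D (src D d) ds w" by auto
  obtain w' where w': "path D (rng C c) (L_tuple c (d # ds)) w'" using L_tuple_path Cons.prems by blast
  have 1: "L_tuple (cmp C b c) (d # ds) = lact (cmp C b c) d # L_tuple (ract (cmp C b c) d) ds"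
    by (rule L_tuple_Cons[of _ _ _ w]) (use Cons.prems in \<open>simp_all add: C.cmp_mor C.src_cmp\<close>)
  have c: "L_tuple c (d # ds) = lact c d # L_tuple (ract c d) ds"
    by (rule L_tuple_Cons[of _ _ _ w]) (use Cons.prems in auto)
  have 2: "L_tuple b (L_tuple c (d # ds)) = lact b (lact c d) # L_tuple (ract b (lact c d)) (L_tuple (ract c d) ds)"
    unfolding c by (rule L_tuple_Cons) (use Cons.prems w' c in auto)
  show ?case
    unfolding 1 2 using Cons.IH[of "ract b (lact c d)" "ract c d"] Cons.prems d
    by (simp add: lact_cmp ract_distrib ract_mor src_ract lact_mor rng_lact src_lact_rng_ract)
qed simp

text \<open>Merging two neighbours commutes with the action: \<open>lact_distrib\<close> handles the
  merged entry and \<open>ract_cmp\<close> the entries after it. With \<open>L_tuple_butlast\<close>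
  this makes \<open>proj\<close> compatible with the faces.\<close>

lemma L_tuple_inner:
  "c \<in> mor C \<Longrightarrow> path D (src C c) ds w \<Longrightarrow> fmap (L_tuple c) (inner D ds) = inner D (L_tuple c ds)"
proof (induction ds arbitrary: c)
  case (Cons d ds)
  note c = Cons.prems(1)
  have d: "d \<in> mor D" "src C c = rng D d" "path D (src D d) ds w" using Cons.prems by auto
  show ?case
  proof (cases ds)
    case Nil
    then show ?thesis using L_tuple_Cons[OF Cons.prems] by simp
  next
    case ds: (Cons d' ds')
    have d': "d' \<in> mor D" "src D d = rng D d'" "path D (src D d') ds' w" using d ds by auto
    have cd: "ract c d \<in> mor C" "src C (ract c d) = src D d" using c d by (simp_all add: ract_mor src_ract)
    have 1: "L_tuple c (d # ds) = lact c d # L_tuple (ract c d) ds" by (rule L_tuple_Cons[OF Cons.prems])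
    have 2: "L_tuple (ract c d) ds = lact (ract c d) d' # L_tuple (ract (ract c d) d') ds'"
      unfolding ds by (rule L_tuple_Cons[OF cd(1), of _ _ w]) (use cd d ds in simp)
    have 3: "L_tuple c (cmp D d d' # ds') = lact c (cmp D d d') # L_tuple (ract c (cmp D d d')) ds'"
      by (rule L_tuple_Cons[OF c]) (use d d' in \<open>simp add: D.cmp_mor D.rng_cmp D.src_cmp\<close>)
    have "fmap (L_tuple c) (fmap (Cons d) (inner D ds)) = fmap (\<lambda>l. lact c d # L_tuple (ract c d) l) (inner D ds)"
      unfolding fmap_fmap
    proof (rule fmap_cong_keys[OF D.keys_inner[OF d(3)]])
      fix l assume "l \<in> {l. path D (src D d) l w \<and> Suc (length l) = length ds}"
      then show "L_tuple c (d # l) = lact c d # L_tuple (ract c d) l"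
        using d by (intro L_tuple_Cons[OF c, of _ _ w]) auto
    qed
    also have "\<dots> = fmap (Cons (lact c d)) (fmap (L_tuple (ract c d)) (inner D ds))"
      by (simp add: fmap_fmap)
    also have "fmap (L_tuple (ract c d)) (inner D ds) = inner D (L_tuple (ract c d) ds)"
      by (rule Cons.IH[OF cd(1)]) (use cd d in simp)
    finally have 4: "fmap (L_tuple c) (fmap (Cons d) (inner D ds)) = fmap (Cons (lact c d)) (inner D (L_tuple (ract c d) ds))" .
    have "fmap (L_tuple c) (inner D (d # ds)) = - frag_of (L_tuple c (cmp D d d' # ds')) - fmap (L_tuple c) (fmap (Cons d) (inner D ds))"
      by (simp add: ds)
    also have "\<dots> = inner D (L_tuple c (d # ds))"
      unfolding 1 3 4 unfolding 2 using c d d' by (simp add: lact_distrib ract_cmp)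
    finally show ?thesis .
  qed
qed simp

lemma L_tuple_butlast: "c \<in> mor C \<Longrightarrow> path D (src C c) ds w \<Longrightarrow> L_tuple c (butlast ds) = butlast (L_tuple c ds)"
proof (induction ds arbitrary: c)
  case (Cons d ds)
  have d: "d \<in> mor D" "src C c = rng D d" "path D (src D d) ds w" using Cons.prems by auto
  show ?case
  proof (cases "ds = []")
    case True
    then show ?thesis using L_tuple_Cons[OF Cons.prems] by simp
  next
    case False
    then obtain w' where p: "path D (src D d) (butlast ds) w'" using D.path_butlast[OF d(3)] by blast
    have "L_tuple c (d # butlast ds) = lact c d # L_tuple (ract c d) (butlast ds)"
      by (rule L_tuple_Cons[OF Cons.prems(1)]) (use p d in auto)
    moreover have "L_tuple (ract c d) ds \<noteq> []" using False by (metis length_L_tuple length_0_conv)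
    ultimately show ?thesis
      using False L_tuple_Cons[OF Cons.prems] Cons.IH[of "ract c d"] d Cons.prems(1) by (simp add: ract_mor src_ract)
  qed
qed simp

abbreviation composite :: "'a list \<Rightarrow> 'a \<Rightarrow> 'a" where
  "composite cs u \<equiv> foldr (cmp C) cs u"

lemma composite: "path C v cs u \<Longrightarrow> composite cs u \<in> mor C \<and> rng C (composite cs u) = v \<and> src C (composite cs u) = u"
  by (induction cs arbitrary: v) (auto simp: objsD C.cmp_mor C.rng_cmp C.src_cmp)

lemma R_tuple_Nil [simp]: "R_tuple [] d = []"
  by (simp add: ract_tuple_def)

lemma R_tuple_Cons [simp]: "R_tuple (c # cs) d = ract c (lact (composite cs (rng D d)) d) # R_tuple cs d"
  by (simp add: ract_tuple_def upt_rec[of 0] map_Suc_upt[symmetric] del: upt_Suc)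

lemma length_R_tuple [simp]: "length (R_tuple cs d) = length cs"
  by (simp add: ract_tuple_def)

lemma R_tuple_path:
  "path C v cs u \<Longrightarrow> d \<in> mor D \<Longrightarrow> u = rng D d \<Longrightarrow> path C (src D (lact (composite cs u) d)) (R_tuple cs d) (src D d)"
proof (induction cs arbitrary: v)
  case Nil
  then show ?case using obj(7)[OF D.src_objs] by (simp add: lact_obj)
next
  case (Cons c cs)
  then have c: "c \<in> mor C" "path C (src C c) cs u" by auto
  then show ?case
    using Cons.IH[OF c(2)] Cons.prems composite[OF c(2)]
    by (simp add: lact_cmp lact_mor rng_lact ract_mor src_ract src_lact_rng_ract)
qed

section \<open>Generators and boundaries of the matched resolution\<close>

definition matched_basis :: "('a list \<times> 'a \<times> 'a list) set" where
  "matched_basis = {(cs, u, ds). (\<exists>v. path C v cs u) \<and> (\<exists>w. path D u ds w)}"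

definition pdeg :: "'a list \<times> 'a \<times> 'a list \<Rightarrow> int" where
  "pdeg = (\<lambda>(cs, u, ds). int (length cs))"

definition qdeg :: "'a list \<times> 'a \<times> 'a list \<Rightarrow> int" where
  "qdeg = (\<lambda>(cs, u, ds). int (length ds))"

definition tdeg :: "'a list \<times> 'a \<times> 'a list \<Rightarrow> nat" where
  "tdeg = (\<lambda>(cs, u, ds). length cs + length ds)"

fun r0 :: "'a list \<Rightarrow> 'a \<Rightarrow> 'a" where
  "r0 [] u = u"
| "r0 (c # cs) u = rng C c"

definition matched_rng :: "'a list \<times> 'a \<times> 'a list \<Rightarrow> 'a \<times> 'a" where
  "matched_rng = (\<lambda>(cs, u, ds). (r0 cs u, r0 cs u))"

lemma r0_path: "path C v cs u \<Longrightarrow> r0 cs u = v"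
  by (cases cs) auto

type_synonym 'b cell = "('b \<times> 'b) \<times> ('b list \<times> 'b \<times> 'b list)"

text \<open>The differentials of the matched complex with coefficients: the face that drops \<open>c\<^sub>1\<close>, or passes
  \<open>d\<^sub>1\<close> to the left of \<open>c\<^sub>1\<dots>c\<^sub>p\<close>, records the morphism of the product category that comes out.\<close>

definition hbd :: "'a list \<times> 'a \<times> 'a list \<Rightarrow> ('a cell \<Rightarrow>\<^sub>0 int)" where
  "hbd = (\<lambda>(cs, u, ds). if cs = [] then 0
     else frag_of ((rng C (hd cs), hd cs), (tl cs, u, ds))
        + fmap (\<lambda>l. ((r0 cs u, r0 cs u), (l, u, ds))) (inner C cs)
        + frag_cmul ((-1) ^ length cs)
            (frag_of ((r0 cs u, r0 cs u), (butlast cs, rng C (last cs), L_tuple (last cs) ds))))"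

definition vbd :: "'a list \<times> 'a \<times> 'a list \<Rightarrow> ('a cell \<Rightarrow>\<^sub>0 int)" where
  "vbd = (\<lambda>(cs, u, ds). if ds = [] then 0
     else frag_cmul ((-1) ^ length cs)
       (frag_of ((lact (composite cs u) (hd ds), src D (lact (composite cs u) (hd ds))), (R_tuple cs (hd ds), src D (hd ds), tl ds))
        + fmap (\<lambda>l. ((r0 cs u, r0 cs u), (cs, u, l))) (inner D ds)
        + frag_cmul ((-1) ^ length ds) (frag_of ((r0 cs u, r0 cs u), (cs, u, butlast ds)))))"

definition matched_bd :: "'a list \<times> 'a \<times> 'a list \<Rightarrow> ('a cell \<Rightarrow>\<^sub>0 int)" where
  "matched_bd x = hbd x + vbd x"

text \<open>Over a product \<open>ab\<close> with \<open>a\<close> in \<open>D\<close> and \<open>b\<close> in \<open>C\<close>, the map \<open>prepend\<close> contracts each row of the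
  resolution to the column \<open>p = 0\<close>, where \<open>proj\<close> and \<open>incl\<close> compare it with the bar resolution
  of \<open>D\<close>, using \<open>(ab)d = (a(b \<rhd> d))(b \<lhd>\<^sub>r d)\<close>.\<close>

definition prepend :: "'a cell \<Rightarrow> 'a cell" where
  "prepend = (\<lambda>((a, b), (cs, u, ds)). ((a, src D a), (b # cs, u, ds)))"

definition proj :: "'a cell \<Rightarrow> ('a \<times> ('a \<times> 'a list) \<Rightarrow>\<^sub>0 int)" where
  "proj = (\<lambda>((a, b), (cs, u, ds)). if cs = [] then frag_of (a, (src D a, L_tuple b ds)) else 0)"

definition incl :: "'a \<times> ('a \<times> 'a list) \<Rightarrow> 'a cell" where
  "incl = (\<lambda>(a, (v, ds)). ((a, src D a), ([], v, ds)))"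

text \<open>Two contractions in sequence: \<open>prepend\<close> deforms the identity to
  \<open>incl\<close> after \<open>proj\<close>, and the degeneracy of the bar resolution of D,
  conjugated by these maps, deforms that to the point. The sum of the two homotopies contracts
  everything.\<close>

definition matched_H :: "'a cell \<Rightarrow> ('a cell \<Rightarrow>\<^sub>0 int)" where
  "matched_H x = frag_of (prepend x) + fmap incl (frag_extend D.bar_H (proj x))"

lemma matched_basis_cell:
  assumes "(cs, u, ds) \<in> matched_basis" "(a, b) \<in> mor E" "src E (a, b) = matched_rng (cs, u, ds)"
  obtains w where "path C (src C b) cs u" "path D u ds w" "a \<in> mor D" "b \<in> mor C" "src D a = rng C b"
    "r0 cs u = src C b"
  using assms r0_path by (auto simp: matched_basis_def matched_rng_def)

lemma hbd_free_mod:
  assumes x: "x \<in> matched_basis"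
  shows "hbd x \<in> free_mod E {y \<in> matched_basis. pdeg y = pdeg x - 1 \<and> qdeg y = qdeg x} matched_rng (matched_rng x)"
proof -
  obtain cs u ds where [simp]: "x = (cs, u, ds)" by (cases x)
  obtain v w where p: "path C v cs u" "path D u ds w" using x by (auto simp: matched_basis_def)
  have v: "v \<in> objs D" "r0 cs u = v" using C.path_objs[OF p(1)] same_objs r0_path[OF p(1)] by auto
  let ?X = "{y \<in> matched_basis. pdeg y = pdeg x - 1 \<and> qdeg y = qdeg x}"
  show ?thesis
  proof (cases cs)
    case (Cons c cs')
    have c: "c \<in> mor C" "rng C c = v" "path C (src C c) cs' u" using p Cons by auto
    have l: "path C v (butlast cs) (rng C (last cs))" "last cs \<in> mor C" "src C (last cs) = u"
      using C.path_butlast[OF p(1)] Cons by auto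
    obtain w' where w': "path D (rng C (last cs)) (L_tuple (last cs) ds) w'"
      using L_tuple_path[OF l(2)] l(3) p(2) by blast
    have "frag_of ((rng C c, c), (cs', u, ds)) \<in> free_mod E ?X matched_rng (v, v)"
      using c p r0_path[OF c(3)] obj[OF v(1)] Cons
      by (intro free_mod_of) (auto simp: matched_basis_def pdeg_def qdeg_def matched_rng_def)
    moreover have "fmap (\<lambda>l. ((v, v), (l, u, ds))) (inner C cs) \<in> free_mod E ?X matched_rng (v, v)"
    proof (rule E.free_mod_fmap[OF C.keys_inner[OF p(1)]])
      fix l assume "l \<in> {l. path C v l u \<and> Suc (length l) = length cs}"
      then show "(v, v) \<in> mor E \<and> (l, u, ds) \<in> ?X \<and> src E (v, v) = matched_rng (l, u, ds) \<and> rng E (v, v) = (v, v)"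
        using p obj[OF v(1)] r0_path[of v l u] by (auto simp: matched_basis_def pdeg_def qdeg_def matched_rng_def)
    qed
    moreover have "frag_of ((v, v), (butlast cs, rng C (last cs), L_tuple (last cs) ds)) \<in> free_mod E ?X matched_rng (v, v)"
      using l w' r0_path[OF l(1)] obj[OF v(1)] Cons
      by (intro free_mod_of) (auto simp: matched_basis_def pdeg_def qdeg_def matched_rng_def)
    ultimately have "frag_of ((rng C c, c), (cs', u, ds)) + fmap (\<lambda>l. ((v, v), (l, u, ds))) (inner C cs)
      + frag_cmul ((-1) ^ length cs) (frag_of ((v, v), (butlast cs, rng C (last cs), L_tuple (last cs) ds)))
      \<in> free_mod E ?X matched_rng (v, v)"
      by (intro free_mod_add free_mod_cmul)
    then show ?thesis using v(2) Cons by (simp add: hbd_def matched_rng_def)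
  qed (simp add: hbd_def free_mod_0)
qed

lemma vbd_free_mod:
  assumes x: "x \<in> matched_basis"
  shows "vbd x \<in> free_mod E {y \<in> matched_basis. pdeg y = pdeg x \<and> qdeg y = qdeg x - 1} matched_rng (matched_rng x)"
proof -
  obtain cs u ds where [simp]: "x = (cs, u, ds)" by (cases x)
  obtain v w where p: "path C v cs u" "path D u ds w" using x by (auto simp: matched_basis_def)
  have v: "v \<in> objs D" "r0 cs u = v" using C.path_objs[OF p(1)] same_objs r0_path[OF p(1)] by auto
  let ?X = "{y \<in> matched_basis. pdeg y = pdeg x \<and> qdeg y = qdeg x - 1}"
  show ?thesis
  proof (cases ds)
    case (Cons d ds')
    have d: "d \<in> mor D" "rng D d = u" "path D (src D d) ds' w" using p Cons by auto
    obtain w' where l: "path D u (butlast ds) w'"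
      using D.path_butlast[OF p(2)] Cons by auto
    let ?P = "lact (composite cs u) d"
    have P: "?P \<in> mor D" "rng D ?P = v" using composite[OF p(1)] d by (auto simp: lact_mor rng_lact)
    have Rp: "path C (src D ?P) (R_tuple cs d) (src D d)" by (rule R_tuple_path[OF p(1) d(1)]) (use d in simp)
    have "frag_of ((?P, src D ?P), (R_tuple cs d, src D d, ds')) \<in> free_mod E ?X matched_rng (v, v)"
      using d P Rp r0_path[OF Rp] obj[OF D.src_objs[OF P(1)]] Cons
      by (intro free_mod_of) (auto simp: matched_basis_def pdeg_def qdeg_def matched_rng_def)
    moreover have "fmap (\<lambda>l. ((v, v), (cs, u, l))) (inner D ds) \<in> free_mod E ?X matched_rng (v, v)"
    proof (rule E.free_mod_fmap[OF D.keys_inner[OF p(2)]])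
      fix l assume "l \<in> {l. path D u l w \<and> Suc (length l) = length ds}"
      then show "(v, v) \<in> mor E \<and> (cs, u, l) \<in> ?X \<and> src E (v, v) = matched_rng (cs, u, l) \<and> rng E (v, v) = (v, v)"
        using p obj[OF v(1)] v by (auto simp: matched_basis_def pdeg_def qdeg_def matched_rng_def)
    qed
    moreover have "frag_of ((v, v), (cs, u, butlast ds)) \<in> free_mod E ?X matched_rng (v, v)"
      using p l v obj[OF v(1)] Cons
      by (intro free_mod_of) (auto simp: matched_basis_def pdeg_def qdeg_def matched_rng_def)
    ultimately have "frag_cmul ((-1) ^ length cs) (frag_of ((?P, src D ?P), (R_tuple cs d, src D d, ds'))
      + fmap (\<lambda>l. ((v, v), (cs, u, l))) (inner D ds)
      + frag_cmul ((-1) ^ length ds) (frag_of ((v, v), (cs, u, butlast ds)))) \<in> free_mod E ?X matched_rng (v, v)"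
      by (intro free_mod_add free_mod_cmul)
    then show ?thesis using v(2) Cons by (simp add: vbd_def matched_rng_def)
  qed (simp add: vbd_def free_mod_0)
qed

end

lemma free_mod_mono: "z \<in> free_mod E X R u \<Longrightarrow> X \<subseteq> Y \<Longrightarrow> z \<in> free_mod E Y R u"
  by (auto simp: free_mod_def)

lemma frag_extend_plus_fun: "frag_extend (\<lambda>x. f x + g x) z = frag_extend f z + frag_extend g z"
  by (induction z rule: frag_ext_induct) (simp_all add: frag_extend_diff)

section \<open>The contraction of the rows and the column p = 0\<close>

context matched_pair
begin

declare E_simps(4) [simp del]

text \<open>For [b, cs] the first face returns ab [cs], and the remaining faces cancel those of [cs]
  with a prepended. If cs is empty nothing cancels the last face of [b], which is a [b \<rhd> ds],
  the value of \<open>incl\<close> after \<open>proj\<close>.\<close>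

lemma prepend_hbd:
  assumes x: "(cs, u, ds) \<in> matched_basis" and e: "(a, b) \<in> mor E" and s: "src E (a, b) = matched_rng (cs, u, ds)"
  shows "eqv E hbd (frag_of (prepend ((a, b), (cs, u, ds)))) + fmap prepend (act E (a, b) (hbd (cs, u, ds)))
    = frag_of ((a, b), (cs, u, ds)) - fmap incl (proj ((a, b), (cs, u, ds)))"
proof -
  obtain w where p: "path C (src C b) cs u" "path D u ds w" and a: "a \<in> mor D" and b: "b \<in> mor C"
    and ab: "src D a = rng C b" and r0: "r0 cs u = src C b"
    using matched_basis_cell[OF x e s] .
  have o: "rng C b \<in> objs D" "src C b \<in> objs D" using b obj_C by auto
  have as: "(a, rng C b) \<in> mor E" using a ab obj[OF o(1)] by simp
  have A1: "cmp E (a, rng C b) (rng C b, b) = (a, b)"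
    using cmp_E_C[OF as b] obj[OF o(1)] C.cmp_rng[OF b] by simp
  have A2: "cmp E (a, rng C b) (rng C b, rng C b) = (a, rng C b)"
    using cmp_E_obj[OF as] obj[OF o(1)] by simp
  have A3: "cmp E (a, b) (src C b, src C b) = (a, b)"
    using cmp_E_obj[OF e] by simp
  show ?thesis
  proof (cases cs)
    case Nil
    then show ?thesis by (simp add: prepend_def hbd_def proj_def incl_def A1 A2 ab)
  next
    case (Cons c cs')
    have c: "c \<in> mor C" "src C b = rng C c" using p Cons by auto
    have A4: "cmp E (a, b) (rng C c, c) = (a, cmp C b c)" using cmp_E_C[OF e c] by simp
    have A5: "cmp E (a, b) (rng C c, rng C c) = (a, b)" using A3 c by simp
    show ?thesis
      by (simp add: Cons prepend_def hbd_def proj_def A1 A2 A4 A5 ab act_fmap fmap_fmap frag_cmul_minus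
          del: minus_frag_cmul)
  qed
qed

text \<open>Prepending lengthens cs and so flips the sign of the vertical boundary; it commutes with
  every face. For the first face this is the composition rule ab y = (a (b \<rhd> y)) (b \<lhd> y),
  where y is the entry of D after it has passed cs.\<close>

lemma prepend_vbd:
  assumes x: "(cs, u, ds) \<in> matched_basis" and e: "(a, b) \<in> mor E" and s: "src E (a, b) = matched_rng (cs, u, ds)"
  shows "eqv E vbd (frag_of (prepend ((a, b), (cs, u, ds)))) + fmap prepend (act E (a, b) (vbd (cs, u, ds))) = 0"
proof -
  obtain w where p: "path C (src C b) cs u" "path D u ds w" and a: "a \<in> mor D" and b: "b \<in> mor C"
    and ab: "src D a = rng C b" and r0: "r0 cs u = src C b"
    using matched_basis_cell[OF x e s] .
  have o: "rng C b \<in> objs D" "src C b \<in> objs D" using b obj_C by auto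
  have as: "(a, rng C b) \<in> mor E" using a ab obj[OF o(1)] by simp
  have A2: "cmp E (a, rng C b) (rng C b, rng C b) = (a, rng C b)"
    using cmp_E_obj[OF as] obj[OF o(1)] by simp
  have A3: "cmp E (a, b) (src C b, src C b) = (a, b)"
    using cmp_E_obj[OF e] by simp
  show ?thesis
  proof (cases ds)
    case (Cons d ds')
    have d: "d \<in> mor D" "rng D d = u" using p Cons by auto
    note P = composite[OF p(1)]
    define y where "y = lact (composite cs u) d"
    have y: "y \<in> mor D" "rng D y = src C b" using P d by (simp_all add: y_def lact_mor rng_lact)
    have bm: "lact b y \<in> mor D" "rng D (lact b y) = rng C b" using b y by (simp_all add: lact_mor rng_lact)
    have bP: "lact (cmp C b (composite cs u)) d = lact b y" unfolding y_def by (rule lact_cmp) (use b P d in auto)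
    have X1: "cmp E (a, rng C b) (lact b y, src D (lact b y)) = (cmp D a (lact b y), src D (lact b y))"
      using cmp_E_D[OF as bm(1)] bm obj[OF o(1)] by (simp add: lact_obj ract_obj)
    have X2: "cmp E (a, b) (y, src D y) = (cmp D a (lact b y), ract b y)"
      by (rule cmp_E_D[OF e y(1)]) (use y in auto)
    have X3: "src D (cmp D a (lact b y)) = src D (lact b y)"
      by (rule D.src_cmp) (use a ab bm in auto)
    show ?thesis
      by (simp add: Cons prepend_def vbd_def A2 A3 bP r0 ab X1 X2 X3 y_def[symmetric] d act_fmap fmap_fmap
          frag_cmul_minus frag_cmul_distrib2 del: minus_frag_cmul)
  qed (simp add: vbd_def prepend_def)
qed

text \<open>\<open>proj\<close> is a chain map. In column 0 this is compatibility of the action with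
  the faces. In column 1 the two horizontal faces have the same image, as (bc) \<rhd> ds = b \<rhd>
  (c \<rhd> ds), and opposite signs. All other faces stay in positive columns, where
  \<open>proj\<close> is zero.\<close>

lemma proj_matched_bd:
  assumes x: "(cs, u, ds) \<in> matched_basis" and e: "(a, b) \<in> mor E" and s: "src E (a, b) = matched_rng (cs, u, ds)"
  shows "frag_extend proj (act E (a, b) (matched_bd (cs, u, ds))) = eqv D D.bar_bd (proj ((a, b), (cs, u, ds)))"
proof -
  obtain w where p: "path C (src C b) cs u" "path D u ds w" and a: "a \<in> mor D" and b: "b \<in> mor C"
    and ab: "src D a = rng C b" and r0: "r0 cs u = src C b"
    using matched_basis_cell[OF x e s] .
  have A3: "cmp E (a, b) (src C b, src C b) = (a, b)"
    using cmp_E_obj[OF e] by simp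
  have aa: "cmp D a (rng C b) = a" using D.cmp_src[OF a] ab by simp
  note fe = frag_extend_add frag_extend_diff frag_extend_minus frag_extend_cmul frag_extend_fmap
  show ?thesis
  proof (cases cs)
    case Nil
    then have u: "u = src C b" using p by simp
    show ?thesis
    proof (cases ds)
      case Nil
      then show ?thesis using \<open>cs = []\<close> by (simp add: matched_bd_def hbd_def vbd_def proj_def D.bar_bd_def)
    next
      case (Cons d ds')
      have d: "d \<in> mor D" "rng D d = src C b" "path D (src D d) ds' w" using p Cons u by auto
      have pd: "path D (src C b) ds w" using p u by simp
      have A: "cmp E (a, b) (d, src D d) = (cmp D a (lact b d), ract b d)"
        by (rule cmp_E_D[OF e d(1)]) (use d in auto)
      have bd: "lact b d \<in> mor D" "rng D (lact b d) = rng C b" using b d by (simp_all add: lact_mor rng_lact)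
      have S: "src D (cmp D a (lact b d)) = src D (lact b d)"
        by (rule D.src_cmp) (use a ab bd in auto)
      have L_tuple: "L_tuple b ds = lact b d # L_tuple (ract b d) ds'"
        unfolding Cons by (rule L_tuple_Cons[OF b, of _ _ w]) (use d in auto)
      have bl: "L_tuple b (butlast ds) = butlast (L_tuple b ds)" by (rule L_tuple_butlast[OF b pd])
      have "frag_extend (\<lambda>l. frag_of (a, rng C b, L_tuple b l)) (inner D ds) = fmap (\<lambda>l. (a, (rng C b, l))) (fmap (L_tuple b) (inner D ds))"
        by (simp add: fmap_def frag_extend_frag_extend)
      also have "fmap (L_tuple b) (inner D ds) = inner D (L_tuple b ds)" by (rule L_tuple_inner[OF b pd])
      finally have I: "frag_extend (\<lambda>l. frag_of (a, rng C b, L_tuple b l)) (inner D ds) = fmap (\<lambda>l. (a, (rng C b, l))) (inner D (L_tuple b ds))" .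
      have h: "hd ds = d" "tl ds = ds'" "ds \<noteq> []" "hd (L_tuple b ds) = lact b d" "tl (L_tuple b ds) = L_tuple (ract b d) ds'"
        "L_tuple b ds \<noteq> []" "lact (src C b) d = d"
        using Cons L_tuple d by (simp_all add: lact_obj)
      show ?thesis
        by (simp add: \<open>cs = []\<close> u h matched_bd_def hbd_def vbd_def proj_def D.bar_bd_def act_fmap fe A A3 S ab I bl aa)
    qed
  next
    case (Cons c cs')
    have c: "c \<in> mor C" "src C b = rng C c" "path C (src C c) cs' u" using p Cons by auto
    have A4: "cmp E (a, b) (rng C c, c) = (a, cmp C b c)" using cmp_E_C[OF e c(1,2)] by simp
    have A5: "cmp E (a, b) (rng C c, rng C c) = (a, b)" using A3 c by simp
    have v: "frag_extend proj (act E (a, b) (vbd (cs, u, ds))) = 0"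
      by (cases ds) (simp_all add: Cons vbd_def proj_def act_fmap fe c(2) A5 frag_extend_eq_0 case_prod_unfold act_def)
    have h: "frag_extend proj (act E (a, b) (hbd (cs, u, ds))) = 0"
    proof (cases cs')
      case Nil
      have "L_tuple (cmp C b c) ds = L_tuple b (L_tuple c ds)"
        by (rule L_tuple_cmp[OF b c(1,2)]) (use c Nil p in auto)
      then show ?thesis
        by (simp add: Cons Nil hbd_def proj_def fe A4 A5)
    next
      case (Cons c' cs'')
      have "frag_extend (\<lambda>l. proj ((a, b), (l, u, ds))) (inner C cs) = 0"
        by (rule frag_extend_0_on[OF C.keys_inner[OF p(1)]]) (auto simp: \<open>cs = c # cs'\<close> Cons proj_def)
      then show ?thesis
        using Cons by (simp add: \<open>cs = c # cs'\<close> hbd_def proj_def act_fmap fe A4 A5 del: inner_simps)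
    qed
    show ?thesis using v h Cons by (simp add: matched_bd_def fe proj_def)
  qed
qed

text \<open>In column 0 the horizontal part vanishes and the vertical sign is 1. With coefficients
  from D no morphism of C is passed, so the boundary is that of the bar resolution of D.\<close>

lemma matched_bd_incl:
  assumes a: "a \<in> mor D" and p: "path D (src D a) ds w"
  shows "eqv E matched_bd (frag_of (incl (a, (src D a, ds)))) = fmap incl (act D a (D.bar_bd (src D a, ds)))"
proof -
  have o: "src D a \<in> objs D" using a D.src_objs by simp
  have as: "(a, src D a) \<in> mor E" using a obj[OF o] by simp
  have A: "cmp E (a, src D a) (src D a, src D a) = (a, src D a)"
    using cmp_E_obj[OF as] obj[OF o] by simp
  have aa: "cmp D a (src D a) = a" using D.cmp_src[OF a] by simp
  show ?thesis
  proof (cases ds)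
    case (Cons d ds')
    have d: "d \<in> mor D" "rng D d = src D a" using p Cons by auto
    have B: "cmp E (a, src D a) (d, src D d) = (cmp D a d, src D d)"
      using cmp_E_D[OF as d(1)] d obj[OF o] by (simp add: lact_obj ract_obj)
    have S: "src D (cmp D a d) = src D d" by (rule D.src_cmp) (use a d in auto)
    have h: "hd ds = d" "tl ds = ds'" "ds \<noteq> []" "lact (src D a) d = d" using Cons d by (simp_all add: lact_obj)
    show ?thesis
      by (simp add: h matched_bd_def hbd_def vbd_def incl_def D.bar_bd_def A B S aa act_fmap fmap_fmap)
  qed (simp add: matched_bd_def hbd_def vbd_def D.bar_bd_def incl_def)
qed

lemma matched_bd_incl_free_mod:
  "y \<in> free_mod D D.bar fst v \<Longrightarrow> eqv E matched_bd (fmap incl y) = fmap incl (eqv D D.bar_bd y)"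
proof (induction rule: free_mod_induct)
  case (of a x)
  then show ?case using matched_bd_incl[of a "snd x"] by (cases x) (auto simp: D.bar_def)
qed simp_all

lemma tdeg: "int (tdeg x) = pdeg x + qdeg x"
  by (cases x) (simp add: tdeg_def pdeg_def qdeg_def)

lemma matched_rng_objs: "x \<in> matched_basis \<Longrightarrow> matched_rng x \<in> objs E"
  by (auto simp: matched_basis_def matched_rng_def r0_path objs_E same_objs[symmetric] C.path_objs)

lemma matched_preresolution:
  "free_preresolution E matched_basis tdeg matched_rng matched_bd matched_H (\<lambda>u. ([], fst u, []))"
proof unfold_locales
  interpret B: free_resolution D D.bar D.bar_deg fst D.bar_bd D.bar_H "\<lambda>u. (u, [])"
    by (rule D.bar_resolution)
  fix x assume x: "x \<in> matched_basis"
  obtain cs u ds where xe: "x = (cs, u, ds)" by (cases x)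
  show "matched_rng x \<in> objs E" by (rule matched_rng_objs[OF x])
  show "tdeg x = 0 \<Longrightarrow> matched_bd x = 0" by (simp add: xe tdeg_def matched_bd_def hbd_def vbd_def)
  show "tdeg x = 0 \<Longrightarrow> x = ([], fst (matched_rng x), [])" by (simp add: xe tdeg_def matched_rng_def)
  show "matched_bd x \<in> free_mod E {y \<in> matched_basis. tdeg y = n} matched_rng (matched_rng x)" if n: "tdeg x = Suc n" for n
  proof -
    have y: "tdeg y = n \<longleftrightarrow> pdeg y + qdeg y = pdeg x + qdeg x - 1" for y
      using tdeg[of x] tdeg[of y] n by linarith
    show ?thesis
      unfolding matched_bd_def y by (rule free_mod_add; rule free_mod_mono[OF hbd_free_mod[OF x]] free_mod_mono[OF vbd_free_mod[OF x]]) auto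
  qed
  show "fmap (\<lambda>_. ()) (matched_bd x) = 0" if "tdeg x = 1"
  proof -
    have "(\<exists>c. cs = [c]) \<and> ds = [] \<or> cs = [] \<and> (\<exists>d. ds = [d])"
      using that by (cases cs; cases ds) (auto simp: xe tdeg_def)
    then show ?thesis by (auto simp: xe matched_bd_def hbd_def vbd_def)
  qed
  fix e assume e: "e \<in> mor E" "src E e = matched_rng x"
  obtain a b where ee: "e = (a, b)" by (cases e)
  obtain w where p: "path C (src C b) cs u" "path D u ds w" and a: "a \<in> mor D" and b: "b \<in> mor C"
    and ab: "src D a = rng C b" and r0: "r0 cs u = src C b"
    using matched_basis_cell[OF x[unfolded xe] e[unfolded ee xe]] .
  have o: "rng C b \<in> objs D" "rng D a \<in> objs D" using b obj_C a D.rng_objs by auto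
  define y where "y = proj (e, x)"
  have y: "cs = [] \<Longrightarrow> y = frag_of (a, (rng C b, L_tuple b ds))" "cs \<noteq> [] \<Longrightarrow> y = 0"
    using ab by (auto simp: y_def proj_def xe ee)
  have Lp: "\<exists>w. path D (rng C b) (L_tuple b ds) w" if "cs = []"
    using L_tuple_path[OF b, of ds] p that by auto
  have y_mod: "y \<in> free_mod D {z \<in> D.bar. D.bar_deg z = length ds} fst (rng D a)"
    using y Lp a ab by (cases "cs = []") (auto simp: D.bar_def D.bar_deg_def free_mod_0 intro!: free_mod_of)
  show "matched_H (e, x) \<in> free_mod E {y \<in> matched_basis. tdeg y = Suc (tdeg x)} matched_rng (rng E e)"
  proof -
    have "frag_of (prepend (e, x)) \<in> free_mod E {y \<in> matched_basis. tdeg y = Suc (tdeg x)} matched_rng (rng E e)"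
      unfolding prepend_def xe ee using a b ab p obj[OF o(1)]
      by (auto intro!: free_mod_of simp: matched_basis_def tdeg_def matched_rng_def)
    moreover have "fmap incl (frag_extend D.bar_H y) \<in> free_mod E {y \<in> matched_basis. tdeg y = Suc (tdeg x)} matched_rng (rng E e)"
    proof (cases "cs = []")
      case True
      then show ?thesis
        using Lp a ab obj[OF o(2)] o C.path_objs
        by (auto intro!: free_mod_of simp: y D.bar_H_def incl_def xe ee matched_basis_def tdeg_def matched_rng_def same_objs)
    qed (simp add: y free_mod_0)
    ultimately show ?thesis unfolding matched_H_def y_def by (rule free_mod_add)
  qed
  have mHext: "frag_extend matched_H z = fmap prepend z + fmap incl (frag_extend D.bar_H (frag_extend proj z))" for z
    unfolding matched_H_def frag_extend_plus_fun by (simp add: fmap_def frag_extend_frag_extend)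
  \<comment> \<open>The homotopy identity is split into the rows, where \<open>prepend\<close> meets
    \<open>hbd\<close> and \<open>vbd\<close> separately, and the contribution of column 0.\<close>
  have "eqv E matched_bd (matched_H (e, x)) + frag_extend matched_H (act E e (matched_bd x))
    = (eqv E hbd (frag_of (prepend (e, x))) + fmap prepend (act E e (hbd x)))
    + (eqv E vbd (frag_of (prepend (e, x))) + fmap prepend (act E e (vbd x)))
    + (eqv E matched_bd (fmap incl (frag_extend D.bar_H y)) + fmap incl (frag_extend D.bar_H (frag_extend proj (act E e (matched_bd x)))))"
  proof -
    have "eqv E matched_bd z = eqv E hbd z + eqv E vbd z" for z unfolding matched_bd_def[abs_def] by (rule eqv_add_fun)
    then have "eqv E matched_bd (matched_H (e, x)) = eqv E hbd (frag_of (prepend (e, x))) + eqv E vbd (frag_of (prepend (e, x)))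
      + eqv E matched_bd (fmap incl (frag_extend D.bar_H y))"
      unfolding matched_H_def y_def by (simp only: eqv_simps(2))
    then show ?thesis unfolding mHext by (simp add: matched_bd_def)
  qed
  also have "\<dots> = frag_of (e, x) - fmap incl y
    + fmap incl (eqv D D.bar_bd (frag_extend D.bar_H y) + frag_extend D.bar_H (eqv D D.bar_bd y))"
  proof -
    have 1: "eqv E matched_bd (fmap incl (frag_extend D.bar_H y)) = fmap incl (eqv D D.bar_bd (frag_extend D.bar_H y))"
      by (rule matched_bd_incl_free_mod[OF free_mod_mono[OF B.h_mod[OF y_mod]]]) auto
    note 2 = prepend_hbd[OF x[unfolded xe] e[unfolded ee xe]] prepend_vbd[OF x[unfolded xe] e[unfolded ee xe]]
      proj_matched_bd[OF x[unfolded xe] e[unfolded ee xe]]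
    show ?thesis
      unfolding 1 unfolding y_def xe ee 2 by simp
  qed
  \<comment> \<open>Valid in every degree. It remains to evaluate the contraction of the bar
    resolution of D at y, which cancels \<open>incl y\<close> up to the point in degree 0; outside
    column 0, y is zero.\<close>
  finally have main: "eqv E matched_bd (matched_H (e, x)) + frag_extend matched_H (act E e (matched_bd x)) = frag_of (e, x) - fmap incl y
    + fmap incl (eqv D D.bar_bd (frag_extend D.bar_H y) + frag_extend D.bar_H (eqv D D.bar_bd y))" .
  show "eqv E matched_bd (matched_H (e, x)) = frag_of (e, x) - frag_of (rng E e, [], fst (rng E e), [])" if 0: "tdeg x = 0"
  proof -
    have n: "cs = []" "ds = []" using 0 by (auto simp: xe tdeg_def)
    then have m: "matched_bd x = 0" by (simp add: xe matched_bd_def hbd_def vbd_def)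
    have "eqv D D.bar_bd y = 0" using y n by (simp add: D.bar_bd_def)
    moreover have "eqv D D.bar_bd (frag_extend D.bar_H y) = y - fmap (\<lambda>_. (rng D a, (rng D a, []))) y"
      by (rule B.h_contr_0) (use y_mod n in simp)
    moreover have "fmap (\<lambda>_. (rng D a, (rng D a, [] :: 'a list))) y = frag_of (rng D a, (rng D a, []))"
      using y n by simp
    ultimately show ?thesis
      using main m obj[OF o(2)] by (simp add: incl_def ee)
  qed
  show "eqv E matched_bd (matched_H (e, x)) + frag_extend matched_H (act E e (matched_bd x)) = frag_of (e, x)" if S: "tdeg x = Suc n" for n
  proof (cases "cs = []")
    case True
    then obtain k where "length ds = Suc k" using S by (auto simp: xe tdeg_def)
    then show ?thesis
      unfolding main using B.h_contr_Suc y_mod by simp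
  next
    case False
    then show ?thesis unfolding main by (simp add: y)
  qed
next
  fix u assume "u \<in> objs E"
  then show "([], fst u, []) \<in> matched_basis \<and> tdeg ([], fst u, []) = 0 \<and> matched_rng ([], fst u, []) = u"
    by (cases u) (auto simp: objs_E matched_basis_def tdeg_def matched_rng_def same_objs)
qed

text \<open>For cs empty, dd = 0 is carried over by \<open>incl\<close> from the bar resolution of
  D. A generator with first entry c is the \<open>prepend\<close> summand of
  \<open>matched_H\<close> at the shorter tuple with coefficient c, so \<open>bd_bd_H\<close> gives
  an induction on cs.\<close>

lemma matched_resolution: "free_resolution E matched_basis tdeg matched_rng matched_bd matched_H (\<lambda>u. ([], fst u, []))"
proof -
  interpret free_preresolution E matched_basis tdeg matched_rng matched_bd matched_H "\<lambda>u. ([], fst u, [])"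
    by (rule matched_preresolution)
  interpret B: free_resolution D D.bar D.bar_deg fst D.bar_bd D.bar_H "\<lambda>u. (u, [])"
    by (rule D.bar_resolution)
  have base: "eqv E matched_bd (matched_bd ([], u, ds)) = 0" if p: "path D u ds w" for u ds w
  proof -
    have u: "u \<in> objs D" using D.path_objs[OF p] .
    have x: "([], u, ds) \<in> matched_basis" using p obj(7)[OF u] by (auto simp: matched_basis_def)
    have b: "(u, ds) \<in> D.bar" using p by (auto simp: D.bar_def)
    have "matched_bd ([], u, ds) = eqv E matched_bd (frag_of (incl (u, (u, ds))))"
      using E.act_obj[OF bd_mod[OF x]] obj[OF u] by (simp add: incl_def matched_rng_def)
    also have "\<dots> = fmap incl (act D u (D.bar_bd (u, ds)))"
      using matched_bd_incl[of u ds w] obj[OF u] p by simp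
    also have "act D u (D.bar_bd (u, ds)) = D.bar_bd (u, ds)"
      using D.act_obj[OF B.bd_mod[OF b]] by simp
    finally have "eqv E matched_bd (matched_bd ([], u, ds)) = eqv E matched_bd (fmap incl (D.bar_bd (u, ds)))" by simp
    also have "\<dots> = fmap incl (eqv D D.bar_bd (D.bar_bd (u, ds)))"
      by (rule matched_bd_incl_free_mod[OF free_mod_mono[OF B.bd_mod[OF b]]]) auto
    also have "\<dots> = 0" using B.bd_bd[OF b] by simp
    finally show ?thesis .
  qed
  have "eqv E matched_bd (matched_bd (cs, u, ds)) = 0" if p: "path C v cs u" and q: "path D u ds w" for cs u ds v w
    using p
  proof (induction cs arbitrary: v)
    case Nil
    then show ?case using base[OF q] by simp
  next
    case (Cons c cs)
    then have c: "c \<in> mor C" "rng C c = v" "path C (src C c) cs u" by auto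
    have o: "rng C c \<in> objs D" "v \<in> objs D" using obj_C c by auto
    have e: "(v, c) \<in> mor E" "src E (v, c) = matched_rng (cs, u, ds)"
      using c obj[OF o(2)] r0_path[OF c(3)] by (auto simp: matched_rng_def)
    have x: "(cs, u, ds) \<in> matched_basis" "(c # cs, u, ds) \<in> matched_basis" using c(3) Cons.prems q by (auto simp: matched_basis_def)
    have 1: "act E (v, v) (matched_bd (c # cs, u, ds)) = matched_bd (c # cs, u, ds)"
      using E.act_obj[OF bd_mod[OF x(2)]] c by (simp add: matched_rng_def)
    have dd: "eqv E matched_bd (eqv E matched_bd (matched_H ((v, c), (cs, u, ds)))) = 0"
      by (rule bd_bd_H[OF e(1) x(1) e(2) Cons.IH[OF c(3)]])
    show ?case
    proof (cases "cs = []")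
      \<comment> \<open>Here \<open>matched_H\<close> has a second summand,
        \<open>([], v, v # L_tuple c ds)\<close> in column 0. Its tuple differs from ds, which is
        why \<open>base\<close> is proved for all tuples in D.\<close>
      case True
      then have u: "u = src C c" using c(3) by simp
      obtain w' where w': "path D (rng C c) (L_tuple c ds) w'" using L_tuple_path[OF c(1)] q u by blast
      then have p: "path D v (v # L_tuple c ds) w'" using c obj[OF o(2)] by simp
      then have y: "([], v, v # L_tuple c ds) \<in> matched_basis" using obj[OF o(2)] by (auto simp: matched_basis_def)
      have "act E (v, v) (matched_bd ([], v, v # L_tuple c ds)) = matched_bd ([], v, v # L_tuple c ds)"
        using E.act_obj[OF bd_mod[OF y]] by (simp add: matched_rng_def)
      then have "eqv E matched_bd (matched_H ((v, c), (cs, u, ds))) = matched_bd (c # cs, u, ds) + matched_bd ([], v, v # L_tuple c ds)"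
        using True 1 obj[OF o(2)] by (simp add: matched_H_def prepend_def proj_def D.bar_H_def incl_def)
      then show ?thesis using dd base[OF p] by simp
    next
      case False
      then have "eqv E matched_bd (matched_H ((v, c), (cs, u, ds))) = matched_bd (c # cs, u, ds)"
        using 1 obj[OF o(2)] by (simp add: matched_H_def prepend_def proj_def)
      then show ?thesis using dd by simp
    qed
  qed
  then show ?thesis
    by unfold_locales (auto simp: matched_basis_def)
qed

end

section \<open>The two spectral sequences of the matched complex\<close>

context first_quadrant_bicomplex
begin

lemma first_page:
  "homology (\<lambda>q. free_Abelian_group {k \<in> S. P k = p \<and> Q k = q}) (\<lambda>_. frag_extend gv) q = page 1 p q"
proof -
  have "kernel (free_Abelian_group {k \<in> S. P k = p \<and> Q k = q})
      (free_Abelian_group {k \<in> S. P k = p \<and> Q k = q - 1}) (frag_extend gv) = Zpage 1 p q"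
    unfolding Zpage_1 by (auto simp: kernel_def Bi_def)
  moreover have "carrier (free_Abelian_group {k \<in> S. P k = p \<and> Q k = q + 1}) = Bi p (q + 1)"
    by (auto simp: Bi_def free_Abelian_group_def)
  ultimately show ?thesis
    by (simp only: homology_def free_Abelian_group_Mod page_def Bpage_1)
qed

lemma first_diff:
  assumes "X \<in> carrier (page 1 p q)"
  shows "induced (\<lambda>q. free_Abelian_group {k \<in> S. P k = p - 1 \<and> Q k = q}) (\<lambda>_. frag_extend gv) q
     (frag_extend gh) X = pdiff 1 p q X"
proof -
  obtain z where z: "z \<in> Zpage 1 p q" "X = coset (Bpage 1 p q) z"
    using assms by (auto simp: page_def)
  have c: "carrier (free_Abelian_group {k \<in> S. P k = p - 1 \<and> Q k = q + 1}) = Bi (p - 1) (q + 1)"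
    by (auto simp: Bi_def free_Abelian_group_def)
  \<comment> \<open>For r = 1 a vertical cycle is its own lift, so \<open>drel\<close> relates it to
    its horizontal boundary and \<open>R_B\<close> applies.\<close>
  have gh_Bpage: "frag_extend gh x \<in> Bpage 1 (p - 1) q" if "x \<in> Bpage 1 p q" for x
  proof -
    interpret additive_relation "Zpage 1 p q" "Bpage 1 p q" "Zpage 1 (p - 1) q" "Bpage 1 (p - 1) q" "drel 1 p q"
      using drel_relation[of 1 p q] by simp
    have x: "x \<in> Bi p q" "frag_extend gv x = 0" using that B_le Zpage_1 by auto
    then have D: "D x = frag_extend gh x" by (simp add: D_def)
    have "drel 1 p q x (frag_extend gh x)"
      unfolding drel_def using x pr_id[OF x(1)] pr_id[OF gh_Bi[OF x(1)]] Bi_Fil[OF x(1)]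
        Bi_Fil[OF gh_Bi[OF x(1)]]
      by (intro exI[of _ x]) (simp add: D algebra_simps)
    then show ?thesis using R_B that by blast
  qed
  have "induced (\<lambda>q. free_Abelian_group {k \<in> S. P k = p - 1 \<and> Q k = q}) (\<lambda>_. frag_extend gv) q
     (frag_extend gh) X = {b + frag_extend gh x |b x. b \<in> Bpage 1 (p - 1) q \<and> x \<in> X}"
    unfolding induced_def set_mult_def c Bpage_1 by auto
  also have "\<dots> = coset (Bpage 1 (p - 1) q) (frag_extend gh z)"
  proof (intro equalityI subsetI)
    fix y assume "y \<in> {b + frag_extend gh x |b x. b \<in> Bpage 1 (p - 1) q \<and> x \<in> X}"
    then obtain b x where y: "y = b + frag_extend gh x" "b \<in> Bpage 1 (p - 1) q" "x - z \<in> Bpage 1 p q"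
      by (auto simp: z(2) coset_def)
    then show "y \<in> coset (Bpage 1 (p - 1) q) (frag_extend gh z)"
      using subgrp_add[OF subgrp_Bpage y(2) gh_Bpage[OF y(3)]] by (simp add: coset_def frag_extend_diff algebra_simps)
  next
    fix y assume "y \<in> coset (Bpage 1 (p - 1) q) (frag_extend gh z)"
    then have "y - frag_extend gh z \<in> Bpage 1 (p - 1) q" by (simp add: coset_def)
    moreover have "z \<in> X" unfolding z(2) by (rule coset_self[OF subgrp_Bpage])
    moreover have "y = (y - frag_extend gh z) + frag_extend gh z" by simp
    ultimately show "y \<in> {b + frag_extend gh x |b x. b \<in> Bpage 1 (p - 1) q \<and> x \<in> X}" by blast
  qed
  finally show ?thesis using pdiff_1[OF z(1)] z(2) by simp
qed

text \<open>The given differential and \<open>pdiff\<close> agree only on carriers, which is enough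
  for equal kernels and images and hence for equal homology.\<close>

lemma second_page:
  assumes "\<And>p X. X \<in> carrier (page 1 p q) \<Longrightarrow> \<delta> p X = pdiff 1 p q X"
  shows "Union \<in> iso (homology (\<lambda>p. page 1 p q) \<delta> p) (page 2 p q)"
proof -
  have "kernel (page 1 p q) (page 1 (p - 1) q) (\<delta> p) = kernel (page 1 p q) (page 1 (p - 1) q) (pdiff 1 p q)"
    using assms by (auto simp: kernel_def)
  moreover have "\<delta> (p + 1) ` carrier (page 1 (p + 1) q) = pdiff 1 (p + 1) q ` carrier (page 1 (p + 1) q)"
    using assms by (intro image_cong) auto
  ultimately have "homology (\<lambda>p. page 1 p q) \<delta> p = page_homology page pdiff 1 p q"
    by (simp add: homology_def page_homology_def)
  then show ?thesis using next_page_iso[of 1 p q] by (simp add: numeral_2_eq_2)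
qed

end

context matched_pair
begin

section \<open>The matched complex as a bicomplex, in both orders\<close>

lemma matched_chains_degrees:
  "matched_chains C D p q = free_Abelian_group {k \<in> matched_basis. pdeg k = p \<and> qdeg k = q}"
  "matched_chains C D p q = free_Abelian_group {k \<in> matched_basis. qdeg k = q \<and> pdeg k = p}"
proof -
  have "matched_tuples C D p q = {k \<in> matched_basis. pdeg k = p \<and> qdeg k = q}"
    by (auto simp: matched_tuples_def matched_basis_def pdeg_def qdeg_def)
  then show "matched_chains C D p q = free_Abelian_group {k \<in> matched_basis. pdeg k = p \<and> qdeg k = q}"
    "matched_chains C D p q = free_Abelian_group {k \<in> matched_basis. qdeg k = q \<and> pdeg k = p}"
    by (simp_all add: matched_chains_def conj_commute)
qed

lemma hdiff_co: "hdiff C D lact ract = frag_extend (\<lambda>x. co (hbd x))"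
proof -
  have "(\<lambda>(cs, u, ds).
     if cs = [] then 0
     else frag_of (tl cs, u, ds)
        + (\<Sum>i = 1..<length cs. frag_cmul ((-1) ^ i) (frag_of (contract C i cs, u, ds)))
        + frag_cmul ((-1) ^ length cs)
            (frag_of (butlast cs, rng C (last cs), lact_tuple C D lact ract (last cs) ds))) = (\<lambda>x. co (hbd x))"
    by (auto simp: hbd_def co_fmap fun_eq_iff) (simp_all add: fmap_inner)
  then show ?thesis by (simp add: hdiff_def)
qed

lemma vdiff_co: "vdiff C D lact ract = frag_extend (\<lambda>x. co (vbd x))"
proof -
  have "(\<lambda>(cs, u, ds).
     if ds = [] then 0
     else frag_cmul ((-1) ^ length cs)
       (frag_of (ract_tuple C D lact ract cs (hd ds), src D (hd ds), tl ds)
        + (\<Sum>j = 1..<length ds. frag_cmul ((-1) ^ j) (frag_of (cs, u, contract D j ds)))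
        + frag_cmul ((-1) ^ length ds) (frag_of (cs, u, butlast ds)))) = (\<lambda>x. co (vbd x))"
    by (auto simp: vbd_def co_fmap fun_eq_iff) (simp_all add: fmap_inner)
  then show ?thesis by (simp add: vdiff_def)
qed

text \<open>The square of the total differential vanishes because it is obtained by
  \<open>co\<close> from that of the matched resolution; no face identities are checked
  here.\<close>

lemma matched_bicomplex:
  "first_quadrant_bicomplex matched_basis pdeg qdeg (\<lambda>x. co (hbd x)) (\<lambda>x. co (vbd x))"
  "first_quadrant_bicomplex matched_basis qdeg pdeg (\<lambda>x. co (vbd x)) (\<lambda>x. co (hbd x))"
proof -
  interpret A: free_resolution E matched_basis tdeg matched_rng matched_bd matched_H "\<lambda>u. ([], fst u, [])"
    by (rule matched_resolution)
  have dd: "frag_extend (\<lambda>x. co (hbd x)) (co (hbd k) + co (vbd k))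
      + frag_extend (\<lambda>x. co (vbd x)) (co (hbd k) + co (vbd k)) = 0" if "k \<in> matched_basis" for k
  proof -
    have "frag_extend (\<lambda>x. co (matched_bd x)) (co (matched_bd k)) = 0"
      using arg_cong[OF A.bd_bd[OF that], of co] by (simp add: co_eqv)
    then show ?thesis by (simp add: matched_bd_def frag_extend_plus_fun)
  qed
  have nn: "0 \<le> pdeg k" "0 \<le> qdeg k" for k
    by (auto simp: pdeg_def qdeg_def split: prod.split)
  have h: "Poly_Mapping.keys (co (hbd k)) \<subseteq> {l \<in> matched_basis. pdeg l = pdeg k - 1 \<and> qdeg l = qdeg k}" if "k \<in> matched_basis" for k
    by (rule keys_co[OF hbd_free_mod[OF that]])
  have v: "Poly_Mapping.keys (co (vbd k)) \<subseteq> {l \<in> matched_basis. pdeg l = pdeg k \<and> qdeg l = qdeg k - 1}" if "k \<in> matched_basis" for k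
    by (rule keys_co[OF vbd_free_mod[OF that]])
  show "first_quadrant_bicomplex matched_basis pdeg qdeg (\<lambda>x. co (hbd x)) (\<lambda>x. co (vbd x))"
    by unfold_locales (use nn h v dd in auto)
  show "first_quadrant_bicomplex matched_basis qdeg pdeg (\<lambda>x. co (vbd x)) (\<lambda>x. co (hbd x))"
  proof
    fix k assume "k \<in> matched_basis"
    then show "frag_extend (\<lambda>x. co (vbd x)) (co (vbd k) + co (hbd k)) + frag_extend (\<lambda>x. co (hbd x)) (co (vbd k) + co (hbd k)) = 0"
      using dd[of k] by (simp add: add.commute)
    show "Poly_Mapping.keys (co (vbd k)) \<subseteq> {l \<in> matched_basis. qdeg l = qdeg k - 1 \<and> pdeg l = pdeg k}"
      "Poly_Mapping.keys (co (hbd k)) \<subseteq> {l \<in> matched_basis. qdeg l = qdeg k \<and> pdeg l = pdeg k - 1}"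
      using v[OF \<open>k \<in> matched_basis\<close>] h[OF \<open>k \<in> matched_basis\<close>] by blast+
  qed (rule nn)+
qed

section \<open>The total complex and the homology of the product category\<close>

definition product_cycles :: "int \<Rightarrow> (('a \<times> 'a) \<times> ('a \<times> 'a) list \<Rightarrow>\<^sub>0 int) set" where
  "product_cycles n = {z. Poly_Mapping.keys z \<subseteq> tuples E n \<and> cat_boundary E z = 0}"

definition product_boundaries :: "int \<Rightarrow> (('a \<times> 'a) \<times> ('a \<times> 'a) list \<Rightarrow>\<^sub>0 int) set" where
  "product_boundaries n = cat_boundary E ` {z. Poly_Mapping.keys z \<subseteq> tuples E (n + 1)}"

lemma categorical_homology_quot: "categorical_homology E n = quot (product_cycles n) (product_boundaries n)"
proof -
  have "kernel (free_Abelian_group (tuples E n)) (free_Abelian_group (tuples E (n - 1))) (cat_boundary E) = product_cycles n"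
    by (auto simp: kernel_def product_cycles_def)
  moreover have "carrier (free_Abelian_group (tuples E (n + 1))) = {z. Poly_Mapping.keys z \<subseteq> tuples E (n + 1)}"
    by (auto simp: free_Abelian_group_def)
  ultimately show ?thesis
    by (simp add: categorical_homology_def homology_def free_Abelian_group_Mod product_boundaries_def)
qed

definition total_chains :: "int \<Rightarrow> ('a list \<times> 'a \<times> 'a list \<Rightarrow>\<^sub>0 int) set" where
  "total_chains n = {z. Poly_Mapping.keys z \<subseteq> {k \<in> matched_basis. pdeg k + qdeg k = n}}"

definition total_bd :: "('a list \<times> 'a \<times> 'a list \<Rightarrow>\<^sub>0 int) \<Rightarrow> ('a list \<times> 'a \<times> 'a list \<Rightarrow>\<^sub>0 int)" where
  "total_bd x = frag_extend (\<lambda>x. co (hbd x)) x + frag_extend (\<lambda>x. co (vbd x)) x"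

text \<open>Provides the assumptions of \<open>convergence\<close>. The resolutions are graded by
  natural numbers and the statement by integers, so negative degrees are treated apart.\<close>

lemma total_comparison:
  obtains f where
    "\<And>n. subgrp (product_cycles n)" "\<And>n. subgrp (product_boundaries n)" "\<And>n. product_boundaries n \<subseteq> product_cycles n"
    "\<And>x y. f (x - y) = f x - f y"
    "\<And>n x. x \<in> total_chains n \<Longrightarrow> total_bd x = 0 \<Longrightarrow> f x \<in> product_cycles n"
    "\<And>n x. x \<in> total_chains (n + 1) \<Longrightarrow> f (total_bd x) \<in> product_boundaries n"
    "\<And>n x. x \<in> total_chains n \<Longrightarrow> total_bd x = 0 \<Longrightarrow> f x \<in> product_boundaries n \<Longrightarrow> \<exists>w\<in>total_chains (n + 1). x = total_bd w"
    "\<And>n z. z \<in> product_cycles n \<Longrightarrow> \<exists>x\<in>total_chains n. total_bd x = 0 \<and> z - f x \<in> product_boundaries n"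
proof -
  interpret two_resolutions E matched_basis tdeg matched_rng matched_bd matched_H "\<lambda>u. ([], fst u, [])"
    E.bar E.bar_deg fst E.bar_bd E.bar_H "\<lambda>u. (u, [])"
    by (intro two_resolutions.intro matched_resolution E.bar_resolution)
  have total_bd: "total_bd = A.cbd"
    by (simp add: fun_eq_iff total_bd_def A.cbd_def matched_bd_def frag_extend_plus_fun)
  have cb: "cat_boundary E = B.cbd"
    by (simp add: E.cat_boundary_bar B.cbd_def)
  have neg: "total_chains n = {0}" "product_cycles n = {0}" if "n < 0" for n
  proof -
    have 1: "{k \<in> matched_basis. pdeg k + qdeg k = n} = {}" "tuples E n = {}"
      using that unfolding tdeg[symmetric] by (auto simp: tuples_def)
    show "total_chains n = {0}" "product_cycles n = {0}"
      unfolding total_chains_def product_cycles_def 1 by (auto simp: cat_boundary_def)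
  qed
  have Tn: "total_chains (int m) = A.chains m" for m
    by (simp add: total_chains_def A.chains_def tdeg[symmetric])
  have Zn: "product_cycles (int m) = {z \<in> B.chains m. B.cbd z = 0}" for m
    by (auto simp: product_cycles_def B.chains_def E.tuples_bar cb)
  have Tn': "total_chains (int m + 1) = A.chains (Suc m)" for m
    using Tn[of "Suc m"] by (simp add: add.commute)
  have Bn: "product_boundaries (int m) = B.cbd ` B.chains (Suc m)" for m
  proof -
    have "tuples E (int m + 1) = B.basis (Suc m)" by (auto simp: E.tuples_bar)
    then show ?thesis by (simp add: product_boundaries_def B.chains_def cb)
  qed
  obtain f where f: "\<And>n z. z \<in> A.chains n \<Longrightarrow> frag_extend f z \<in> B.chains n"
    "\<And>n z. z \<in> A.chains n \<Longrightarrow> B.cbd (frag_extend f z) = frag_extend f (A.cbd z)"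
    "\<And>n z w. z \<in> A.chains n \<Longrightarrow> A.cbd z = 0 \<Longrightarrow> w \<in> B.chains (Suc n) \<Longrightarrow> frag_extend f z = B.cbd w
      \<Longrightarrow> \<exists>w'\<in>A.chains (Suc n). z = A.cbd w'"
    "\<And>n z. z \<in> B.chains n \<Longrightarrow> B.cbd z = 0
      \<Longrightarrow> \<exists>x\<in>A.chains n. A.cbd x = 0 \<and> (\<exists>w\<in>B.chains (Suc n). z - frag_extend f x = B.cbd w)"
    using coinvariants_comparison by blast
  have subZ: "subgrp (product_cycles n)" for n
    using subgrp_keys[of "tuples E n"] by (auto simp: subgrp_def product_cycles_def cb)
  have subB: "subgrp (product_boundaries n)" for n
  proof -
    have "cat_boundary E x - cat_boundary E y \<in> product_boundaries n"
      if "Poly_Mapping.keys x \<subseteq> tuples E (n + 1)" "Poly_Mapping.keys y \<subseteq> tuples E (n + 1)" for x y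
      using subgrp_diff[OF subgrp_keys, of x "tuples E (n + 1)" y] that
      unfolding product_boundaries_def cb by (auto simp flip: B.cbd_simps(2))
    moreover have "0 \<in> product_boundaries n"
      unfolding product_boundaries_def by (rule image_eqI[of _ _ 0]) (simp_all add: cat_boundary_def)
    ultimately show ?thesis by (auto simp: subgrp_def product_boundaries_def cb)
  qed
  have BZ: "product_boundaries n \<subseteq> product_cycles n" for n
  proof
    fix z assume "z \<in> product_boundaries n"
    then obtain w where w: "Poly_Mapping.keys w \<subseteq> tuples E (n + 1)" "z = B.cbd w" by (auto simp: product_boundaries_def cb)
    have "Poly_Mapping.keys (co (E.bar_bd x)) \<subseteq> tuples E n" if "x \<in> tuples E (n + 1)" for x
    proof -
      have x: "x \<in> E.bar" "int (E.bar_deg x) = n + 1" using that by (auto simp: E.tuples_bar)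
      show ?thesis
      proof (cases "E.bar_deg x")
        case (Suc k)
        then show ?thesis using keys_co[OF B.bd_Suc[OF x(1) Suc]] x(2) by (auto simp: E.tuples_bar)
      qed (use B.bd_0[OF x(1)] in simp)
    qed
    then have "Poly_Mapping.keys z \<subseteq> tuples E n"
      unfolding w(2) B.cbd_def by (rule keys_frag_extend_subset[OF w(1)])
    moreover have "B.cbd (B.cbd w) = 0"
    proof -
      have "Poly_Mapping.keys w \<subseteq> E.bar" using w(1) by (auto simp: E.tuples_bar)
      then show ?thesis
      proof (induction w rule: frag_induction)
        case (one x)
        then show ?case using arg_cong[OF B.bd_bd[OF one], of co] by (simp add: B.cbd_def co_eqv)
      qed simp_all
    qed
    ultimately show "z \<in> product_cycles n" by (simp add: product_cycles_def cb w(2))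
  qed
  show thesis
  proof (rule that[of "frag_extend f"])
    fix n x assume x: "x \<in> total_chains n" "total_bd x = 0"
    show "frag_extend f x \<in> product_cycles n"
    proof (cases "n < 0")
      case True
      then show ?thesis using x neg by simp
    next
      case False
      then obtain m where n: "n = int m" by (metis nonneg_int_cases not_less)
      show ?thesis using x f(1)[of x m] f(2)[of x m] unfolding n total_bd Tn Zn by simp
    qed
    assume "frag_extend f x \<in> product_boundaries n"
    then show "\<exists>w\<in>total_chains (n + 1). x = total_bd w"
    proof (cases "n < 0")
      case True
      then have "x = total_bd 0" using x neg by (simp add: total_bd)
      moreover have "0 \<in> total_chains (n + 1)" by (simp add: total_chains_def)
      ultimately show ?thesis by blast
    next
      case False
      then obtain m where n: "n = int m" by (metis nonneg_int_cases not_less)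
      show ?thesis using x f(3)[of x m] \<open>frag_extend f x \<in> product_boundaries n\<close> unfolding n total_bd Tn Tn' Bn by auto
    qed
  next
    fix n x assume x: "x \<in> total_chains (n + 1)"
    show "frag_extend f (total_bd x) \<in> product_boundaries n"
    proof (cases "n < 0")
      case True
      have "total_bd x = 0"
      \<comment> \<open>For n = -1 there may be nonzero chains in degree n + 1 = 0, but their
        boundary is zero.\<close>
      proof (cases "n + 1 < 0")
        case True
        then show ?thesis using x neg by (simp add: total_bd)
      next
        case False
        then have "n + 1 = int 0" using True by simp
        then have "Poly_Mapping.keys x \<subseteq> {k \<in> matched_basis. tdeg k = 0}" using x Tn[of 0] by (simp add: A.chains_def)
        then show ?thesis
          unfolding total_bd A.cbd_def by (rule frag_extend_0_on) (simp add: A.bd_0)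
      qed
      then show ?thesis using subgrp_0[OF subB] by simp
    next
      case False
      then obtain m where n: "n = int m" by (metis nonneg_int_cases not_less)
      show ?thesis using x f(1)[of x "Suc m"] f(2)[of x "Suc m"] unfolding n total_bd Tn' Bn
        by (metis imageI)
    qed
  next
    fix n z assume z: "z \<in> product_cycles n"
    show "\<exists>x\<in>total_chains n. total_bd x = 0 \<and> z - frag_extend f x \<in> product_boundaries n"
    proof (cases "n < 0")
      case True
      then show ?thesis using z neg subgrp_0[OF subB] by (simp add: total_bd)
    next
      case False
      then obtain m where n: "n = int m" by (metis nonneg_int_cases not_less)
      show ?thesis using z f(4)[of z m] unfolding n total_bd Tn Zn Bn by blast
    qed
  qed (simp_all add: subZ subB BZ frag_extend_diff)
qed

end

theorem corollary5p18:
  fixes C D :: "'a cat" and lact ract :: "'a \<Rightarrow> 'a \<Rightarrow> 'a"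
  assumes "matched_pair C D lact ract"
  shows
    "(\<exists>E d \<sigma>.
        homology_spectral_sequence E d \<sigma>
      \<and> (\<forall>p q. E 1 p q = Hv C D lact ract p q)
      \<and> (\<forall>p q. \<forall>x \<in> carrier (Hv C D lact ract p q). d 1 p q x = hdiff_Hv C D lact ract p q x)
      \<and> (\<forall>p q. \<sigma> 1 p q \<in> iso (HhHv C D lact ract p q) (E 2 p q))
      \<and> converges_to E d (categorical_homology (matched_product C D lact ract)))
   \<and> (\<exists>E d \<sigma>.
        homology_spectral_sequence (\<lambda>r q p. E r p q) (\<lambda>r q p. d r p q) (\<lambda>r q p. \<sigma> r p q)
      \<and> (\<forall>p q. E 1 p q = Hh C D lact ract p q)
      \<and> (\<forall>p q. \<forall>x \<in> carrier (Hh C D lact ract p q). d 1 p q x = vdiff_Hh C D lact ract p q x)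
      \<and> (\<forall>p q. \<sigma> 1 p q \<in> iso (HvHh C D lact ract p q) (E 2 p q))
      \<and> converges_to (\<lambda>r q p. E r p q) (\<lambda>r q p. d r p q)
          (categorical_homology (matched_product C D lact ract)))"
proof -
  interpret matched_pair C D lact ract by (rule assms)
  interpret h: first_quadrant_bicomplex matched_basis pdeg qdeg "\<lambda>x. co (hbd x)" "\<lambda>x. co (vbd x)"
    by (rule matched_bicomplex)
  interpret v: first_quadrant_bicomplex matched_basis qdeg pdeg "\<lambda>x. co (vbd x)" "\<lambda>x. co (hbd x)"
    by (rule matched_bicomplex)
  \<comment> \<open>Transposing the bicomplex changes the filtration but neither the total chains
    nor their differential, so one comparison serves both spectral sequences.\<close>
  have T: "h.Tot = total_chains" "h.D = total_bd" "v.Tot = total_chains" "v.D = total_bd"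
    by (auto simp: fun_eq_iff h.Tot_def v.Tot_def total_chains_def h.D_def v.D_def total_bd_def add.commute)
  have H: "categorical_homology E = (\<lambda>n. quot (product_cycles n) (product_boundaries n))"
    by (simp add: fun_eq_iff categorical_homology_quot)
  have conv: "converges_to h.page h.pdiff (categorical_homology E)
    \<and> converges_to v.page v.pdiff (categorical_homology E)"
  proof (rule total_comparison, goal_cases)
    case (1 f)
    show ?case
      unfolding H using h.convergence[unfolded T, OF 1] v.convergence[unfolded T, OF 1] by blast
  qed
  have Hv: "Hv C D lact ract p q = h.page 1 p q" for p q
    unfolding Hv_def vdiff_co matched_chains_degrees(1) by (rule h.first_page)
  have Hh: "Hh C D lact ract p q = v.page 1 q p" for p q
    unfolding Hh_def hdiff_co matched_chains_degrees(2) by (rule v.first_page)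
  have dh: "hdiff_Hv C D lact ract p q x = h.pdiff 1 p q x" if "x \<in> carrier (h.page 1 p q)" for p q x
    unfolding hdiff_Hv_def vdiff_co hdiff_co matched_chains_degrees(1) by (rule h.first_diff[OF that])
  have dv: "vdiff_Hh C D lact ract p q x = v.pdiff 1 q p x" if "x \<in> carrier (v.page 1 q p)" for p q x
    unfolding vdiff_Hh_def vdiff_co hdiff_co matched_chains_degrees(2) by (rule v.first_diff[OF that])
  have isoh: "Union \<in> iso (HhHv C D lact ract p q) (h.page 2 p q)" for p q
    unfolding HhHv_def Hv by (rule h.second_page[OF dh])
  have isov: "Union \<in> iso (HvHh C D lact ract p q) (v.page 2 q p)" for p q
    unfolding HvHh_def Hh by (rule v.second_page[OF dv])
  show ?thesis
  proof (intro conjI)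
    show "\<exists>E d \<sigma>.
        homology_spectral_sequence E d \<sigma>
      \<and> (\<forall>p q. E 1 p q = Hv C D lact ract p q)
      \<and> (\<forall>p q. \<forall>x \<in> carrier (Hv C D lact ract p q). d 1 p q x = hdiff_Hv C D lact ract p q x)
      \<and> (\<forall>p q. \<sigma> 1 p q \<in> iso (HhHv C D lact ract p q) (E 2 p q))
      \<and> converges_to E d (categorical_homology (matched_product C D lact ract))"
      by (rule exI[of _ h.page], rule exI[of _ h.pdiff], rule exI[of _ "\<lambda>_ _ _. Union"])
        (simp add: h.spectral_sequence Hv dh isoh conv)
    show "\<exists>E d \<sigma>.
        homology_spectral_sequence (\<lambda>r q p. E r p q) (\<lambda>r q p. d r p q) (\<lambda>r q p. \<sigma> r p q)
      \<and> (\<forall>p q. E 1 p q = Hh C D lact ract p q)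
      \<and> (\<forall>p q. \<forall>x \<in> carrier (Hh C D lact ract p q). d 1 p q x = vdiff_Hh C D lact ract p q x)
      \<and> (\<forall>p q. \<sigma> 1 p q \<in> iso (HvHh C D lact ract p q) (E 2 p q))
      \<and> converges_to (\<lambda>r q p. E r p q) (\<lambda>r q p. d r p q)
          (categorical_homology (matched_product C D lact ract))"
      \<comment> \<open>The filtration degree of the transposed bicomplex is q, so its pages are
        read with exchanged arguments; p remains the horizontal degree.\<close>
      by (rule exI[of _ "\<lambda>r p q. v.page r q p"], rule exI[of _ "\<lambda>r p q. v.pdiff r q p"],
          rule exI[of _ "\<lambda>_ _ _. Union"])
        (simp add: v.spectral_sequence Hh dv isov conv)
  qed
qed

end
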